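(* Let $0\le\lambda<\frac{1}{\sum_{j\in\mathbb{Z}^d}a_j}$ and let $\mathbf{X}=\{X_i\}_{i\in\mathbb{Z}^d}$ be a sample from the minimal stationary distribution $\boldsymbol{\mu}$ of the interference queueing dynamics on $\mathbb{Z}^d$ with arrival intensity $\lambda$ and interference sequence $(a_j)_{j\in\mathbb{Z}^d}$ (see context). Fix any $K\in\mathbb{N}_0$ and $h\in\{1,\dots,d\}$. Let $f,g:\mathbb{N}_0^{(2K+1)^d}\to\mathbb{R}$ be functions such that $\mathbb{E}[f^2(\mathbf{X}_{0,K})]<\infty$ and $\mathbb{E}[g^2(\mathbf{X}_{0,K})]<\infty$. Then the following limit exists and satisfies $$\lim_{n\to\infty}\mathbb{E}\left[f(\mathbf{X}_{0,K})\,g(\mathbf{X}_{n\mathbf{e}_h,K})\right]=\mathbb{E}[f(\mathbf{X}_{0,K})]\,\mathbb{E}[g(\mathbf{X}_{0,K})].$$ In particular, the probability preserving transformation $\mathcal{Q}_h=\left(\mathbb{N}_0^{\mathbb{Z}^d},\mathcal{B}(\mathbb{N}_0^{\mathbb{Z}^d}),\boldsymbol{\mu},T_h\right)$ is strongly mixing for every $h\in\{1,\dots,d\}$. Hence the family $\{T_h\}_{h=1}^d$ is ergodic.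
   Context: Model. Fix $d\ge1$ and a sequence $(a_i)_{i\in\mathbb{Z}^d}$ (the interference sequence) with $a_i\ge0$, $a_i=a_{-i}$ for all $i$, $a_0=1$ and $\sum_{i\in\mathbb{Z}^d}a_i<\infty$ (infinitely many $a_i$ may be nonzero). Convention: $0/0=0$. $\mathbb{N}_0=\{0,1,2,\dots\}$. Let $\{\mathcal{A}_i\}_{i\in\mathbb{Z}^d}$ be independent Poisson point processes on $\mathbb{R}$ with intensity $\lambda$, and, independently, let $\{\mathcal{D}_i\}_{i\in\mathbb{Z}^d}$ be independent Poisson point processes of unit intensity on $\mathbb{R}\times[0,1]$. There is a queue at each $i\in\mathbb{Z}^d$, with queue length $X_i(t)\in\mathbb{N}_0$ at time $t$. An arrival ($X_i$ increases by 1) occurs at queue $i$ at each epoch of $\mathcal{A}_i$. At each atom $(t,u)$ of $\mathcal{D}_i$, a departure ($X_i$ decreases by 1) occurs from queue $i$ at time $t$ if and only if $u\le \frac{X_i(t)}{\sum_{j\in\mathbb{Z}^d}a_jX_{i-j}(t)}$, with queue lengths evaluated just before $t$. Thus, given the configuration, queue $i$ has departures at rate $\frac{X_i(t)}{\sum_{j}a_jX_{i-j}(t)}$. It is known that this process is well defined path-wise from the driving processes and is monotone: with the same driving processes, coordinate-wise ordered initial configurations remain coordinate-wise ordered for all later times. Minimal stationary distribution (Coupling-From-The-Past). For $t\ge0$ and $s\ge-t$ let $X_{i;t}(s)$ be the length of queue $i$ at time $s$ when the dynamics is started at time $-t$ with all queues empty, all these processes being built from the same $(\mathcal{A}_i,\mathcal{D}_i)_{i\in\mathbb{Z}^d}$.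 By monotonicity $t\mapsto X_{i;t}(s)$ is non-decreasing almost surely; set $X_{i;\infty}(s):=\lim_{t\to\infty}X_{i;t}(s)$. It is known that if $\lambda<1/\sum_{j}a_j$, then $\{X_{i;\infty}(s)\}$ is a (finite, translation invariant) stationary solution of the dynamics, and it is minimal: any other stationary solution stochastically dominates it coordinate-wise. The minimal stationary distribution $\boldsymbol{\mu}$ is the law of $\{X_{i;\infty}(s)\}_{i\in\mathbb{Z}^d}$ (for any fixed $s$) on $(\mathbb{N}_0^{\mathbb{Z}^d},\mathcal{B}(\mathbb{N}_0^{\mathbb{Z}^d}))$. Notation. $\mathbf{e}_h$ is the $h$-th standard unit vector of $\mathbb{Z}^d$. $\mathbf{X}_{0,K}:=\{X_i:\|i\|_\infty\le K\}$ and $\mathbf{X}_{n\mathbf{e}_h,K}:=\{X_i:\|i-n\mathbf{e}_h\|_\infty\le K\}$, both viewed as random elements of $\mathbb{N}_0^{(2K+1)^d}$, with coordinate $l$ ($\|l\|_\infty\le K$) of $\mathbf{X}_{n\mathbf{e}_h,K}$ being $X_{n\mathbf{e}_h+l}$. $T_h:\mathbb{N}_0^{\mathbb{Z}^d}\to\mathbb{N}_0^{\mathbb{Z}^d}$ is the shift $(T_h\mathbf{x})_i:=x_{i+\mathbf{e}_h}$; $\boldsymbol{\mu}$ is invariant under each $T_h$. $\mathcal{Q}_h$ is strongly mixing if $\lim_{n\to\infty}\boldsymbol{\mu}(A\cap T_h^{-n}B)=\boldsymbol{\mu}(A)\boldsymbol{\mu}(B)$ for all $A,B\in\mathcal{B}(\mathbb{N}_0^{\mathbb{Z}^d})$.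 A set $A\in\mathcal{B}(\mathbb{N}_0^{\mathbb{Z}^d})$ is invariant if $T_h^{-1}A=A$ for all $h\in\{1,\dots,d\}$; the family $\{T_h\}_{h=1}^d$ is ergodic if every invariant $A$ has $\boldsymbol{\mu}(A)\in\{0,1\}$. *)

theory Defs
  imports "HOL-Probability.Probability"
begin

section \<open>Poisson point processes\<close>

text \<open>
  A (simple) point process is a random locally finite set of atoms; its law is that of the numbers
  of atoms in bounded Borel sets. Since \<^const>\<open>card\<close> is 0 on infinite sets, only bounded
  sets are counted. For parameter 0 the Poisson weights are those of the point mass at 0, by
  \<open>0 ^ 0 = 1\<close>.
\<close>

definition poisson_point_process ::
  "'w measure \<Rightarrow> 'e::euclidean_space measure \<Rightarrow> ('w \<Rightarrow> 'e set) \<Rightarrow> bool" where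
  "poisson_point_process M \<nu> S \<longleftrightarrow>
     (\<forall>\<omega>\<in>space M. \<forall>B. bounded B \<longrightarrow> finite (S \<omega> \<inter> B)) \<and>
     (\<forall>B\<in>sets borel. bounded B \<longrightarrow>
        (\<lambda>\<omega>. card (S \<omega> \<inter> B)) \<in> measurable M (count_space UNIV)) \<and>
     (\<forall>B\<in>sets borel. bounded B \<longrightarrow>
        (\<forall>k. measure M {\<omega>\<in>space M. card (S \<omega> \<inter> B) = k}
             = measure \<nu> B ^ k / fact k * exp (- measure \<nu> B))) \<and>
     (\<forall>B :: nat \<Rightarrow> 'e set. (\<forall>m. B m \<in> sets borel \<and> bounded (B m)) \<and> disjoint_family B \<longrightarrow>
        prob_space.indep_vars M (\<lambda>_. count_space UNIV) (\<lambda>m \<omega>. card (S \<omega> \<inter> B m)) UNIV)"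

definition point_process_events :: "'w measure \<Rightarrow> ('w \<Rightarrow> 'e::euclidean_space set) \<Rightarrow> 'w set set" where
  "point_process_events M S =
     sigma_sets (space M)
       {{\<omega>\<in>space M. card (S \<omega> \<inter> B) = k} | B k. B \<in> sets borel \<and> bounded B}"


section \<open>The interference queueing dynamics\<close>

text \<open>
  The lattice is \<open>int ^ 'd\<close>. Atoms of \<open>A i\<close> are the arrival epochs at queue \<open>i\<close>; atoms
  \<open>(t, u)\<close> of \<open>D i\<close> are the potential departure epochs \<open>t\<close> with their marks \<open>u\<close>.
\<close>

definition driving_processes ::
  "'w measure \<Rightarrow> real \<Rightarrow> (int ^ 'd::finite \<Rightarrow> 'w \<Rightarrow> real set)
     \<Rightarrow> (int ^ 'd \<Rightarrow> 'w \<Rightarrow> (real \<times> real) set) \<Rightarrow> bool" where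
  "driving_processes M lam A D \<longleftrightarrow>
     (\<forall>i. poisson_point_process M (density lborel (\<lambda>_. ennreal lam)) (A i)) \<and>
     (\<forall>i. poisson_point_process M (density lborel (indicator (UNIV \<times> {0..1}))) (D i)) \<and>
     prob_space.indep_sets M
       (case_sum (\<lambda>i. point_process_events M (A i)) (\<lambda>i. point_process_events M (D i))) UNIV"

text \<open>
  The convention \<open>0 / 0 = 0\<close> is that of HOL. If the interference sum diverges, both
  \<^const>\<open>infsum\<close> and the quotient are 0, so the quotient is then the value of \<open>y i / \<infinity>\<close>.
\<close>

definition departure_rate ::
  "(int ^ 'd::finite \<Rightarrow> real) \<Rightarrow> (int ^ 'd \<Rightarrow> nat) \<Rightarrow> int ^ 'd \<Rightarrow> real" where
  "departure_rate a y i = real (y i) / (\<Sum>\<^sub>\<infinity>j. a j * real (y (i - j)))"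

definition before :: "(int ^ 'd::finite \<Rightarrow> real \<Rightarrow> nat) \<Rightarrow> real \<Rightarrow> int ^ 'd \<Rightarrow> nat" where
  "before x t = (\<lambda>i. Lim (at_left t) (x i))"

text \<open>
  \<open>x\<close> follows the dynamics driven by the realisation \<open>A\<close>, \<open>D\<close> from time \<open>t0\<close> on, starting
  from the configuration \<open>x0\<close>. The values of \<open>x\<close> before time \<open>t0\<close> are irrelevant.
\<close>

definition queue_evolution ::
  "(int ^ 'd::finite \<Rightarrow> real) \<Rightarrow> (int ^ 'd \<Rightarrow> real set) \<Rightarrow> (int ^ 'd \<Rightarrow> (real \<times> real) set)
     \<Rightarrow> real \<Rightarrow> (int ^ 'd \<Rightarrow> nat) \<Rightarrow> (int ^ 'd \<Rightarrow> real \<Rightarrow> nat) \<Rightarrow> bool" where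
  "queue_evolution a A D t0 x0 x \<longleftrightarrow>
     (\<forall>i. \<forall>s\<ge>t0.
        int (x i s) = int (x0 i) + int (card (A i \<inter> {t0<..s}))
          - int (card {(t, u) \<in> D i. t0 < t \<and> t \<le> s \<and> u \<le> departure_rate a (before x t) i}))"

text \<open>
  \<open>queue_from_empty a A D t i s\<close> is the length at time \<open>s\<close> of queue \<open>i\<close> when the dynamics
  is started at time \<open>- t\<close> with all queues empty. For Poisson driving processes, almost
  surely a trajectory exists for all \<open>t\<close> simultaneously, and it is unique for each fixed \<open>t\<close>,
  hence for all rational \<open>t\<close>. By monotonicity in \<open>t\<close>, the trajectories chosen at the
  remaining values of \<open>t\<close> lie between these, so that the choice does not affect the limit
  \<open>t \<rightarrow> \<infinity>\<close>.
\<close>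

definition queue_from_empty ::
  "(int ^ 'd::finite \<Rightarrow> real) \<Rightarrow> (int ^ 'd \<Rightarrow> real set) \<Rightarrow> (int ^ 'd \<Rightarrow> (real \<times> real) set)
     \<Rightarrow> real \<Rightarrow> int ^ 'd \<Rightarrow> real \<Rightarrow> nat" where
  "queue_from_empty a A D t = (SOME x. queue_evolution a A D (- t) (\<lambda>_. 0) x)"

definition queue_from_past ::
  "(int ^ 'd::finite \<Rightarrow> real) \<Rightarrow> (int ^ 'd \<Rightarrow> real set) \<Rightarrow> (int ^ 'd \<Rightarrow> (real \<times> real) set)
     \<Rightarrow> int ^ 'd \<Rightarrow> real \<Rightarrow> nat" where
  "queue_from_past a A D i s = Lim at_top (\<lambda>t. queue_from_empty a A D t i s)"

text \<open>
  The law of the configuration at time \<open>s\<close> of the dynamics started in the infinite past. The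
  limit is only meaningful almost surely, and the exceptional set need not be an event of
  \<open>M\<close>; hence the \<^const>\<open>completion\<close>.
\<close>

definition minimal_stationary_distribution ::
  "'w measure \<Rightarrow> (int ^ 'd::finite \<Rightarrow> real) \<Rightarrow> (int ^ 'd \<Rightarrow> 'w \<Rightarrow> real set)
     \<Rightarrow> (int ^ 'd \<Rightarrow> 'w \<Rightarrow> (real \<times> real) set) \<Rightarrow> real \<Rightarrow> (int ^ 'd \<Rightarrow> nat) measure" where
  "minimal_stationary_distribution M a A D s =
     distr (completion M) borel
       (\<lambda>\<omega> i. queue_from_past a (\<lambda>k. A k \<omega>) (\<lambda>k. D k \<omega>) i s)"


section \<open>Windows, shifts, mixing and ergodicity\<close>

definition sup_norm :: "int ^ 'd::finite \<Rightarrow> int" where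
  "sup_norm l = Max (range (\<lambda>h. \<bar>l $ h\<bar>))"

text \<open>
  The configuration seen in the window of radius \<open>K\<close> around \<open>p\<close>, with coordinates relative to
  \<open>p\<close>. Functions on the space of such window configurations are functions on
  \<open>int ^ 'd \<Rightarrow> nat\<close> applied to windows only, which are constant outside the index set.
\<close>

definition window :: "nat \<Rightarrow> int ^ 'd::finite \<Rightarrow> (int ^ 'd \<Rightarrow> nat) \<Rightarrow> int ^ 'd \<Rightarrow> nat" where
  "window K p x = (\<lambda>l\<in>{l. sup_norm l \<le> int K}. x (p + l))"

definition lattice_shift :: "'d::finite \<Rightarrow> (int ^ 'd \<Rightarrow> nat) \<Rightarrow> int ^ 'd \<Rightarrow> nat" where
  "lattice_shift h x = (\<lambda>i. x (i + axis h 1))"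

definition probability_preserving :: "'a measure \<Rightarrow> ('a \<Rightarrow> 'a) \<Rightarrow> bool" where
  "probability_preserving \<mu> T \<longleftrightarrow> prob_space \<mu> \<and> T \<in> measurable \<mu> \<mu> \<and> distr \<mu> \<mu> T = \<mu>"

definition strongly_mixing :: "'a measure \<Rightarrow> ('a \<Rightarrow> 'a) \<Rightarrow> bool" where
  "strongly_mixing \<mu> T \<longleftrightarrow>
     (\<forall>A\<in>sets \<mu>. \<forall>B\<in>sets \<mu>.
        (\<lambda>n. measure \<mu> (A \<inter> ((T ^^ n) -` B \<inter> space \<mu>))) \<longlonglongrightarrow> measure \<mu> A * measure \<mu> B)"

definition ergodic_family :: "'a measure \<Rightarrow> ('h \<Rightarrow> 'a \<Rightarrow> 'a) \<Rightarrow> bool" where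
  "ergodic_family \<mu> T \<longleftrightarrow>
     (\<forall>A\<in>sets \<mu>. (\<forall>h. T h -` A \<inter> space \<mu> = A) \<longrightarrow> measure \<mu> A = 0 \<or> measure \<mu> A = 1)"

end

theory Submission
  imports Defs
begin

text \<open>
  Trajectories started empty at a given time are bracketed by an iteration with the same driving points:
  the departures of the next upper bound are those prescribed by the lower bound and the interference of
  the upper bound, and conversely. Every bound is an explicit measurable function of the driving
  processes. The departure rate is Lipschitz in the queue lengths, hence at time \<open>t\<close> after the start the
  expected gap at stage \<open>k\<close> is at most \<open>\<lambda> C\<^sup>k t\<^sup>k\<^sup>+\<^sup>1 / (k+1)!\<close> with \<open>C = \<Sum>\<^sub>j a\<^sub>j\<close>, which vanishes as
  \<open>k \<rightarrow> \<infinity>\<close>. The state started empty at time \<open>-t\<close>, and therefore its limit as \<open>t \<rightarrow> \<infinity>\<close>, is thus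
  almost surely a measurable translation equivariant function of the driving processes. These form an
  i.i.d. field over the lattice, whose shifts are mixing because an event of a product measure is
  approximated by events of finitely many coordinates, and mixing passes to factors.
\<close>

section \<open>Trajectories of a single queue\<close>

text \<open>The lattice system is infinite and its trajectories enter through a choice operator, so
  neither uniqueness nor measurability is at hand for a fixed realisation. The brackets supply both:
  every solution lies between them, and almost surely they meet at a given site, time and integer
  starting time after finitely many stages. Real starting times are uncountably many; between two
  integers, a trajectory is enclosed by the least solution from the later one and the greatest
  solution from the earlier one. The factorial bound is an iterated compensator formula: the
  expected gap at stage k + 1 is at most C times the time integral of the expected gap at stage k,
  beginning with the expected number of arrivals. To derive it from independence of Poisson counts
  on disjoint sets alone, rates are sampled at left ends of time cells, where they depend on the
  past only, and rounded to finitely many values; left continuity of the rates recovers the exact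
  counts in the limit. The regularity of the inputs is collected in one almost sure, translation
  invariant event, off which the state is set to 0, so that its equivariance is exact.\<close>

definition arrivals :: "real set \<Rightarrow> real \<Rightarrow> real \<Rightarrow> nat" where
  "arrivals \<alpha> t0 t = card (\<alpha> \<inter> {t0<..<t})"

definition departures :: "(real \<times> real) set \<Rightarrow> real \<Rightarrow> real \<Rightarrow> (real \<Rightarrow> real) \<Rightarrow> nat" where
  "departures \<delta> t0 t R = card {(r, u) \<in> \<delta>. t0 < r \<and> r < t \<and> u \<le> R r}"

text \<open>
  Trajectories are recorded through their left limits: \<open>p t\<close> is the queue length just before
  \<open>t\<close>, so that only atoms in open time intervals are counted.
\<close>

definition queue_eq ::
  "real set \<Rightarrow> (real \<times> real) set \<Rightarrow> real \<Rightarrow> int \<Rightarrow> (real \<Rightarrow> real) \<Rightarrow> (real \<Rightarrow> nat) \<Rightarrow> bool" where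
  "queue_eq \<alpha> \<delta> t0 c R p \<longleftrightarrow>
     (\<forall>t>t0. int (p t) = c + int (arrivals \<alpha> t0 t) - int (departures \<delta> t0 t R))"

text \<open>The almost sure regularity of the input of one queue. Positive marks forbid departures
  from an empty queue, whose rate is 0. Distinct departure epochs make the queue fall by at most one
  at a time, on which the comparison of trajectories rests.\<close>

locale queue_input =
  fixes \<alpha> :: "real set" and \<delta> :: "(real \<times> real) set"
  assumes finite_arrivals: "finite (\<alpha> \<inter> {x..y})"
    and finite_departures: "finite (\<delta> \<inter> {x..y} \<times> UNIV)"
    and marks_pos: "(r, u) \<in> \<delta> \<Longrightarrow> 0 < u"
    and distinct_times: "inj_on fst \<delta>"
begin

lemma finite_arrivals': "finite (\<alpha> \<inter> {x<..<y})" "finite (\<alpha> \<inter> {x<..y})" "finite (\<alpha> \<inter> {x..<y})"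
  by (rule finite_subset[OF _ finite_arrivals[of x y]], force)+

lemma finite_departures':
  "finite {(r, u) \<in> \<delta>. x < r \<and> r < y \<and> P r u}" "finite {(r, u) \<in> \<delta>. x < r \<and> r \<le> y \<and> P r u}"
  by (rule finite_subset[OF _ finite_departures[of x y]], force)+

text \<open>Used to read off a quantity just after \<open>t1\<close> from a left-limit trajectory at
  a slightly later time. The point \<open>t1 + 1\<close> in the finite set \<open>F\<close> keeps it
  nonempty and its minimum inside the window in which atoms were collected.\<close>

lemma gap_right:
  obtains t where "t > t1" "\<alpha> \<inter> {t1<..<t} = {}" "\<delta> \<inter> {t1<..<t} \<times> UNIV = {}"
proof -
  define F where "F = (\<alpha> \<inter> {t1<..t1 + 1}) \<union> fst ` (\<delta> \<inter> {t1..t1 + 1} \<times> UNIV) \<inter> {t1<..} \<union> {t1 + 1}"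
  have F: "finite F" "F \<noteq> {}" "\<And>x. x \<in> F \<Longrightarrow> t1 < x"
    unfolding F_def using finite_arrivals' finite_departures by auto
  have "Min F > t1" using F by simp
  moreover have "x \<notin> {t1<..<Min F}" if "x \<in> \<alpha> \<or> x \<in> fst ` \<delta>" for x
  proof
    assume x: "x \<in> {t1<..<Min F}"
    have "Min F \<le> t1 + 1" using F by (intro Min_le) (auto simp: F_def)
    with x that have "x \<in> F" unfolding F_def by force
    with F x show False by (meson Min_le greaterThanLessThan_iff leD)
  qed
  ultimately show ?thesis by (intro that[of "Min F"]) force+
qed

lemma gap_left:
  assumes "t0 < t1"
  obtains t where "t0 \<le> t" "t < t1" "\<alpha> \<inter> {t<..<t1} = {}" "\<delta> \<inter> {t<..<t1} \<times> UNIV = {}"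
proof -
  define F where "F = (\<alpha> \<inter> {t0<..<t1}) \<union> fst ` (\<delta> \<inter> {t0..t1} \<times> UNIV) \<inter> {t0..<t1} \<union> {t0}"
  have F: "finite F" "F \<noteq> {}" "\<And>x. x \<in> F \<Longrightarrow> x < t1"
    unfolding F_def using finite_arrivals' finite_departures assms by auto
  have "Max F < t1" using F by simp
  moreover have ge: "t0 \<le> Max F" using F by (intro Max_ge) (auto simp: F_def)
  moreover have "x \<notin> {Max F<..<t1}" if "x \<in> \<alpha> \<or> x \<in> fst ` \<delta>" for x
  proof
    assume x: "x \<in> {Max F<..<t1}"
    with x that ge have "x \<in> F" unfolding F_def by force
    with F x show False by (meson Max_ge greaterThanLessThan_iff leD)
  qed
  ultimately show ?thesis by (intro that[of "Max F"]) force+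
qed

text \<open>Descends from \<open>t\<close> to the last departure atom before it. Arrivals need no
  induction step, because they act alike on all trajectories under comparison.\<close>

lemma atom_induct [consumes 1, case_names none step]:
  assumes "t > t0"
    and none: "\<And>t. t > t0 \<Longrightarrow> \<delta> \<inter> {t0<..<t} \<times> UNIV = {} \<Longrightarrow> Q t"
    and step: "\<And>t r u. (r, u) \<in> \<delta> \<Longrightarrow> t0 < r \<Longrightarrow> r < t \<Longrightarrow> \<delta> \<inter> {r<..<t} \<times> UNIV = {} \<Longrightarrow> Q r \<Longrightarrow> Q t"
  shows "Q t"
  using \<open>t > t0\<close>
proof (induction "card (\<delta> \<inter> {t0<..<t} \<times> UNIV)" arbitrary: t rule: less_induct)
  case less
  have fin: "finite (\<delta> \<inter> {t0<..<t} \<times> UNIV)"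
    by (rule finite_subset[OF _ finite_departures[of t0 t]]) force
  show ?case
  proof (cases "\<delta> \<inter> {t0<..<t} \<times> UNIV = {}")
    case True
    with none less show ?thesis by blast
  next
    case False
    define r where "r = Max (fst ` (\<delta> \<inter> {t0<..<t} \<times> UNIV))"
    have "r \<in> fst ` (\<delta> \<inter> {t0<..<t} \<times> UNIV)" unfolding r_def using fin False by (intro Max_in) auto
    then obtain u where ru: "(r, u) \<in> \<delta>" "t0 < r" "r < t" by auto
    have gap: "\<delta> \<inter> {r<..<t} \<times> UNIV = {}"
    proof (rule ccontr)
      assume "\<delta> \<inter> {r<..<t} \<times> UNIV \<noteq> {}"
      then obtain x v where "(x, v) \<in> \<delta>" "r < x" "x < t" by auto
      then have "(x, v) \<in> \<delta> \<inter> {t0<..<t} \<times> UNIV" using ru by auto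
      then have "x \<le> r" unfolding r_def using fin by (intro Max_ge) (auto intro: rev_image_eqI)
      with \<open>r < x\<close> show False by simp
    qed
    have "card (\<delta> \<inter> {t0<..<r} \<times> UNIV) < card (\<delta> \<inter> {t0<..<t} \<times> UNIV)"
      using ru by (intro psubset_card_mono[OF fin] psubsetI) (auto simp: set_eq_iff)
    from less(1)[OF this ru(2)] show ?thesis by (rule step[OF ru gap])
  qed
qed

lemma departures_empty: "\<delta> \<inter> {t0<..<t} \<times> UNIV = {} \<Longrightarrow> departures \<delta> t0 t R = 0"
  unfolding departures_def by (auto simp: card_eq_0_iff)

lemma departures_step:
  assumes "(r, u) \<in> \<delta>" "t0 < r" "r < t" "\<delta> \<inter> {r<..<t} \<times> UNIV = {}"
  shows "departures \<delta> t0 t R = departures \<delta> t0 r R + (if u \<le> R r then 1 else 0)"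
proof -
  have "{(x, v) \<in> \<delta>. t0 < x \<and> x < t \<and> v \<le> R x}
      = {(x, v) \<in> \<delta>. t0 < x \<and> x < r \<and> v \<le> R x} \<union> (if u \<le> R r then {(r, u)} else {})"
  proof (intro set_eqI, clarify)
    fix x v
    have "(x, v) \<in> \<delta> \<Longrightarrow> x = r \<Longrightarrow> v = u"
      using inj_onD[OF distinct_times, of "(x, v)" "(r, u)"] assms(1) by auto
    moreover have "(x, v) \<in> \<delta> \<Longrightarrow> x < t \<Longrightarrow> x \<le> r" using assms(4) by (force simp: not_le[symmetric])
    ultimately show "((x, v) \<in> {(x, v) \<in> \<delta>. t0 < x \<and> x < t \<and> v \<le> R x})
      = ((x, v) \<in> {(x, v) \<in> \<delta>. t0 < x \<and> x < r \<and> v \<le> R x} \<union> (if u \<le> R r then {(r, u)} else {}))"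
      using assms by (auto simp: order.order_iff_strict)
  qed
  then show ?thesis
    unfolding departures_def by (simp add: card_Un_disjoint finite_departures')
qed

lemma arrivals_split:
  assumes "t0 < r" "r < t"
  shows "arrivals \<alpha> t0 t = arrivals \<alpha> t0 r + card (\<alpha> \<inter> {r..<t})"
proof -
  have "\<alpha> \<inter> {t0<..<t} = (\<alpha> \<inter> {t0<..<r}) \<union> (\<alpha> \<inter> {r..<t})" using assms by auto
  then show ?thesis unfolding arrivals_def
    by (simp add: card_Un_disjoint finite_arrivals' disjoint_iff)
qed

text \<open>Both queues have the same arrivals and lose at most one customer per atom, so their
  order can break only at an atom where the two lengths agree. The rates therefore have to be
  ordered at such times only: there, a departure from \<open>q\<close> forces one from
  \<open>p\<close>.\<close>

lemma queue_eq_mono: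
  assumes p: "queue_eq \<alpha> \<delta> t0 c R p" and q: "queue_eq \<alpha> \<delta> t0 c' R' q" and "c \<le> c'"
    and le: "\<And>t. t > t0 \<Longrightarrow> p t = q t \<Longrightarrow> R' t \<le> R t"
    and "t > t0"
  shows "p t \<le> q t"
  using \<open>t > t0\<close>
proof (induction rule: atom_induct)
  case (none t)
  then show ?case using p q \<open>c \<le> c'\<close> unfolding queue_eq_def by (force simp: departures_empty)
next
  case (step t r u)
  have eq: "int (p t) = int (p r) + int (card (\<alpha> \<inter> {r..<t})) - (if u \<le> R r then 1 else 0)"
       "int (q t) = int (q r) + int (card (\<alpha> \<inter> {r..<t})) - (if u \<le> R' r then 1 else 0)"
    using p q step(2,3) arrivals_split[OF step(2,3)] departures_step[OF step(1-4)]
    unfolding queue_eq_def by auto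
  show ?case
  proof (cases "p r = q r")
    case True
    with le step(2) have "R' r \<le> R r" by blast
    with eq True show ?thesis by (auto split: if_splits)
  next
    case False
    with step eq show ?thesis by (auto split: if_splits)
  qed
qed

text \<open>The new initial value \<open>c'\<close> counts the atoms at \<open>t1\<close> as well,
  so it is the length just after \<open>t1\<close>. It is nonnegative because it equals
  \<open>p\<close> at any time inside the atom-free interval that follows.\<close>

lemma queue_eq_restart:
  assumes p: "queue_eq \<alpha> \<delta> t0 c R p" and "t0 \<le> t1"
  obtains c' where "c' \<ge> 0" "queue_eq \<alpha> \<delta> t1 c' R p"
proof -
  define c' where "c' = c + int (card (\<alpha> \<inter> {t0<..t1})) - int (card {(r, u) \<in> \<delta>. t0 < r \<and> r \<le> t1 \<and> u \<le> R r})"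
  have q: "queue_eq \<alpha> \<delta> t1 c' R p" unfolding queue_eq_def
  proof (intro allI impI)
    fix t assume "t > t1"
    have "\<alpha> \<inter> {t0<..<t} = (\<alpha> \<inter> {t0<..t1}) \<union> (\<alpha> \<inter> {t1<..<t})" using assms \<open>t > t1\<close> by auto
    then have 1: "arrivals \<alpha> t0 t = card (\<alpha> \<inter> {t0<..t1}) + arrivals \<alpha> t1 t"
      unfolding arrivals_def by (simp add: card_Un_disjoint finite_arrivals' disjoint_iff)
    have "{(r, u) \<in> \<delta>. t0 < r \<and> r < t \<and> u \<le> R r}
       = {(r, u) \<in> \<delta>. t0 < r \<and> r \<le> t1 \<and> u \<le> R r} \<union> {(r, u) \<in> \<delta>. t1 < r \<and> r < t \<and> u \<le> R r}"
      using assms \<open>t > t1\<close> by auto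
    then have 2: "departures \<delta> t0 t R
       = card {(r, u) \<in> \<delta>. t0 < r \<and> r \<le> t1 \<and> u \<le> R r} + departures \<delta> t1 t R"
      unfolding departures_def by (simp, subst card_Un_disjoint) (auto simp: finite_departures')
    show "int (p t) = c' + int (arrivals \<alpha> t1 t) - int (departures \<delta> t1 t R)"
      using p \<open>t > t1\<close> \<open>t0 \<le> t1\<close> unfolding queue_eq_def c'_def 1 2[symmetric] by (auto simp: 1 2)
  qed
  obtain t where t: "t > t1" "\<alpha> \<inter> {t1<..<t} = {}" "\<delta> \<inter> {t1<..<t} \<times> UNIV = {}" by (rule gap_right)
  then have "int (p t) = c'" using q departures_empty[OF t(3)]
    unfolding queue_eq_def by (auto simp: arrivals_def)
  then have "c' \<ge> 0" by linarith
  then show ?thesis using q that by blast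
qed

text \<open>Well-founded recursion over the departure epochs, which are locally finite.\<close>

lemma queue_eq_exists:
  assumes F: "\<And>t. F t 0 \<le> 0"
  obtains p where "queue_eq \<alpha> \<delta> t0 0 (\<lambda>t. F t (p t)) p"
proof -
  \<comment> \<open>Only departure epochs are predecessors: the value at \<open>t\<close> depends on
    earlier values solely through the rates at the atoms before \<open>t\<close>.\<close>
  define rel where "rel = {(r, t). t0 < r \<and> r < t \<and> r \<in> fst ` \<delta>}"
  have "rel \<subseteq> Wellfounded.measure (\<lambda>t. card (\<delta> \<inter> {t0<..<t} \<times> UNIV))"
  proof (clarify, unfold rel_def, clarsimp)
    fix r t u assume *: "t0 < r" "r < t" "(r, u) \<in> \<delta>"
    have "finite (\<delta> \<inter> {t0<..<t} \<times> UNIV)"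
      by (rule finite_subset[OF _ finite_departures[of t0 t]]) force
    then show "card (\<delta> \<inter> {t0<..<r} \<times> UNIV) < card (\<delta> \<inter> {t0<..<t} \<times> UNIV)"
      using * by (intro psubset_card_mono psubsetI) (auto simp: set_eq_iff)
  qed
  then have wf: "wf rel" by (rule wf_subset[OF wf_measure])
  define H where "H = (\<lambda>f t. nat (int (arrivals \<alpha> t0 t) - int (departures \<delta> t0 t (\<lambda>r. F r (f r)))))"
  define p where "p \<equiv> wfrec rel H"
  have p_eq: "p t = nat (int (arrivals \<alpha> t0 t) - int (departures \<delta> t0 t (\<lambda>r. F r (p r))))" for t
  proof -
    have "cut p rel t r = p r" if "(r, u) \<in> \<delta>" "t0 < r" "r < t" for r u
      by (rule cut_apply) (use that in \<open>force simp: rel_def\<close>)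
    then have "{(r, u) \<in> \<delta>. t0 < r \<and> r < t \<and> u \<le> F r (cut p rel t r)}
        = {(r, u) \<in> \<delta>. t0 < r \<and> r < t \<and> u \<le> F r (p r)}"
      by auto
    then show ?thesis
      using def_wfrec[OF p_def wf, of t] unfolding H_def departures_def by simp
  qed
  have "int (p t) = int (arrivals \<alpha> t0 t) - int (departures \<delta> t0 t (\<lambda>r. F r (p r)))" if "t > t0" for t
    using that
  proof (induction rule: atom_induct)
    case (none t)
    then show ?case using p_eq[of t] by (simp add: departures_empty)
  next
    case (step t r u)
    \<comment> \<open>An empty queue has rate at most 0, which is below every mark. Hence no atom
      takes a customer from it, and the truncation by \<open>nat\<close> in \<open>H\<close> never
      acts.\<close>
    have "u \<le> F r (p r) \<Longrightarrow> p r \<noteq> 0" using marks_pos[OF step(1)] F[of r] by (metis leD order_less_le_trans)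
    then show ?case
      using step p_eq[of t] arrivals_split[OF step(2,3)] departures_step[OF step(1-4)] by auto
  qed
  then have "queue_eq \<alpha> \<delta> t0 0 (\<lambda>t. F t (p t)) p" unfolding queue_eq_def by auto
  then show ?thesis by (rule that)
qed

lemma queue_eq_le_arrivals: "queue_eq \<alpha> \<delta> t0 0 R p \<Longrightarrow> t > t0 \<Longrightarrow> p t \<le> arrivals \<alpha> t0 t"
  unfolding queue_eq_def by force

section \<open>Passage between counts over closed intervals and left limits\<close>

lemma closed_counts_left_limit:
  assumes "t0 < t"
  shows "\<forall>\<^sub>F s in at_left t. card (\<alpha> \<inter> {t0<..s}) = arrivals \<alpha> t0 t
     \<and> card {(r, u) \<in> \<delta>. t0 < r \<and> r \<le> s \<and> u \<le> R r} = departures \<delta> t0 t R \<and> t0 \<le> s"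
proof -
  obtain t' where t': "t0 \<le> t'" "t' < t" "\<alpha> \<inter> {t'<..<t} = {}" "\<delta> \<inter> {t'<..<t} \<times> UNIV = {}"
    by (rule gap_left[OF assms])
  have "\<forall>\<^sub>F s in at_left t. s \<in> {t'<..<t}" using t' by (intro eventually_at_leftI[of t']) auto
  then show ?thesis
  proof eventually_elim
    case (elim s)
    have "\<alpha> \<inter> {t0<..s} = \<alpha> \<inter> {t0<..<t}" using t' elim by (force simp: disjoint_iff)
    moreover have "{(r, u) \<in> \<delta>. t0 < r \<and> r \<le> s \<and> u \<le> R r} = {(r, u) \<in> \<delta>. t0 < r \<and> r < t \<and> u \<le> R r}"
      using t' elim by (force simp: disjoint_iff)
    ultimately show ?case using elim t' unfolding arrivals_def departures_def by auto
  qed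
qed

text \<open>Close enough to the left of \<open>t\<close> the closed counts are constant and equal to
  the open ones, so the left limit is an eventually attained value. That value is nonnegative as it
  equals some \<open>x s\<close>.\<close>

lemma queue_eq_of_closed:
  assumes "\<And>s. s \<ge> t0 \<Longrightarrow> int (x s) = c + int (card (\<alpha> \<inter> {t0<..s}))
      - int (card {(r, u) \<in> \<delta>. t0 < r \<and> r \<le> s \<and> u \<le> R r})"
  shows "queue_eq \<alpha> \<delta> t0 c R (\<lambda>t. Lim (at_left t) x)"
  unfolding queue_eq_def
proof (intro allI impI)
  fix t assume "t > t0"
  define v where "v = c + int (arrivals \<alpha> t0 t) - int (departures \<delta> t0 t R)"
  have "\<forall>\<^sub>F s in at_left t. int (x s) = v"
    using closed_counts_left_limit[OF \<open>t > t0\<close>, of R]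
    by eventually_elim (use assms in \<open>auto simp: v_def\<close>)
  then have "\<forall>\<^sub>F s in at_left t. x s = nat v \<and> v \<ge> 0"
    by eventually_elim (metis int_nat_eq nat_int of_nat_0_le_iff)
  then have "\<forall>\<^sub>F s in at_left t. x s = nat v" and "v \<ge> 0"
    by (auto elim: eventually_mono dest: eventually_happens)
  then have "Lim (at_left t) x = nat v"
    by (intro tendsto_Lim tendsto_eventually) auto
  with \<open>v \<ge> 0\<close> show "int (Lim (at_left t) x) = c + int (arrivals \<alpha> t0 t) - int (departures \<delta> t0 t R)"
    by (simp add: v_def)
qed

text \<open>The expression is the length just after \<open>s\<close>, hence equal to
  \<open>p\<close> at a slightly later time. It allows the right-continuous trajectory to be defined
  with natural numbers as values.\<close>

lemma closed_of_queue_eq: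
  assumes "queue_eq \<alpha> \<delta> t0 c R p" "s \<ge> t0"
  shows "c + int (card (\<alpha> \<inter> {t0<..s})) - int (card {(r, u) \<in> \<delta>. t0 < r \<and> r \<le> s \<and> u \<le> R r}) \<ge> 0"
proof -
  obtain t where t: "t > s" "\<alpha> \<inter> {s<..<t} = {}" "\<delta> \<inter> {s<..<t} \<times> UNIV = {}" by (rule gap_right)
  have "\<alpha> \<inter> {t0<..s} = \<alpha> \<inter> {t0<..<t}" using t by (force simp: disjoint_iff)
  moreover have "{(r, u) \<in> \<delta>. t0 < r \<and> r \<le> s \<and> u \<le> R r} = {(r, u) \<in> \<delta>. t0 < r \<and> r < t \<and> u \<le> R r}"
    using t by (force simp: disjoint_iff)
  moreover have "int (p t) = c + int (arrivals \<alpha> t0 t) - int (departures \<delta> t0 t R)"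
    using assms t unfolding queue_eq_def by auto
  ultimately show ?thesis unfolding arrivals_def departures_def by simp
qed

end

section \<open>Solutions on the lattice\<close>

definition rate :: "real \<Rightarrow> real \<Rightarrow> real" where
  "rate v e = v / (v + e)"

text \<open>The diagonal term is left out because the rate increases in the own length and decreases
  in the contribution of the others; the two have to be bounded in opposite directions.\<close>

definition interference :: "(int ^ 'd::finite \<Rightarrow> real) \<Rightarrow> (int ^ 'd \<Rightarrow> nat) \<Rightarrow> int ^ 'd \<Rightarrow> real" where
  "interference a y i = (\<Sum>\<^sub>\<infinity>j\<in>- {0}. a j * real (y (i - j)))"

definition summable_config :: "(int ^ 'd::finite \<Rightarrow> real) \<Rightarrow> (int ^ 'd \<Rightarrow> nat) \<Rightarrow> bool" where
  "summable_config a y \<longleftrightarrow> (\<forall>i. (\<lambda>j. a j * real (y (i - j))) summable_on UNIV)"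

lemma rate_0 [simp]: "rate 0 e = 0"
  by (simp add: rate_def)

lemma rate_bounds: "0 \<le> v \<Longrightarrow> 0 \<le> e \<Longrightarrow> 0 \<le> rate v e \<and> rate v e \<le> 1"
  by (cases "v + e = 0") (auto simp: rate_def)

lemma rate_antimono: "0 \<le> v \<Longrightarrow> 0 \<le> e \<Longrightarrow> e \<le> e' \<Longrightarrow> rate v e' \<le> rate v e"
  by (cases "v = 0") (auto simp: rate_def intro!: divide_left_mono mult_pos_pos)

lemma rate_mono: "0 \<le> v \<Longrightarrow> v \<le> v' \<Longrightarrow> 0 \<le> e \<Longrightarrow> rate v e \<le> rate v' e"
proof (cases "v = 0")
  case False
  assume "0 \<le> v" "v \<le> v'" "0 \<le> e"
  with False have "v * (v' + e) \<le> v' * (v + e)" by (simp add: algebra_simps mult_left_mono)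
  with False \<open>0 \<le> v\<close> \<open>v \<le> v'\<close> \<open>0 \<le> e\<close> show ?thesis
    by (simp add: rate_def divide_simps mult.commute)
qed (auto simp: rate_def)

text \<open>Queue lengths are integers, so that a positive queue length is at least 1.\<close>

lemma rate_lipschitz:
  fixes w v :: nat
  assumes "w \<le> v" "0 \<le> e" "e \<le> e'"
  shows "rate v e - rate w e' \<le> (real v - real w) + (e' - e)"
proof (cases "w = 0")
  case True
  have "rate v e \<le> real v" if "v \<noteq> 0" using rate_bounds[of v e] assms that by auto
  with True assms show ?thesis by (cases "v = 0") auto
next
  case False
  then have w: "1 \<le> real w" and v: "1 \<le> real v" using assms by auto
  \<comment> \<open>The own length is changed at fixed interference, then the interference at fixed
    own length. Each difference is the increment times a quotient, and this quotient is at most 1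
    because \<open>v\<close> and \<open>w\<close> are at least 1.\<close>
  have "rate v e - rate w e' = (rate v e - rate w e) + (rate w e - rate w e')" by simp
  also have "rate v e - rate w e = (real v - real w) * (e / ((real v + e) * (real w + e)))"
    using w v assms by (simp add: rate_def field_simps)
  also have "\<dots> \<le> (real v - real w) * 1"
  proof (intro mult_left_mono)
    have "e \<le> (real v + e) * 1" using v assms by simp
    also have "\<dots> \<le> (real v + e) * (real w + e)" using w v assms by (intro mult_left_mono) auto
    finally show "e / ((real v + e) * (real w + e)) \<le> 1" using w v assms by (subst divide_le_eq_1_pos) (auto intro!: mult_pos_pos)
  qed (use assms in auto)
  also have "rate w e - rate w e' = (e' - e) * (real w / ((real w + e) * (real w + e')))"
    using w assms by (simp add: rate_def field_simps)
  also have "\<dots> \<le> (e' - e) * 1"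
  proof (intro mult_left_mono)
    have "real w \<le> (real w + e) * 1" using w assms by simp
    also have "\<dots> \<le> (real w + e) * (real w + e')" using w assms by (intro mult_left_mono) auto
    finally show "real w / ((real w + e) * (real w + e')) \<le> 1" using w assms by (subst divide_le_eq_1_pos) (auto intro!: mult_pos_pos)
  qed (use assms in auto)
  finally show ?thesis by simp
qed

text \<open>Summability of the weighted arrivals bounds the interference of every configuration
  reachable from the empty one, so the default value 0 of a divergent \<open>infsum\<close> does not
  enter the rates.\<close>

locale interference_input =
  fixes a :: "int ^ 'd::finite \<Rightarrow> real"
    and A :: "int ^ 'd \<Rightarrow> real set" and D :: "int ^ 'd \<Rightarrow> (real \<times> real) set"
  assumes a_nonneg: "0 \<le> a i" and a_0: "a 0 = 1"
    and inputs: "queue_input (A i) (D i)"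
    and summable_arrivals: "summable_config a (\<lambda>i. arrivals (A i) t0 t)"
begin

lemma summable_config_mono:
  assumes "summable_config a z" "\<And>i. y i \<le> z i"
  shows "summable_config a y"
  unfolding summable_config_def
proof
  fix i
  have "(\<lambda>j. a j * real (z (i - j))) summable_on UNIV" using assms(1) unfolding summable_config_def by blast
  then show "(\<lambda>j. a j * real (y (i - j))) summable_on UNIV"
    by (rule summable_on_comparison_test) (auto intro!: mult_left_mono mult_nonneg_nonneg simp: a_nonneg assms(2))
qed

lemma interference_nonneg: "0 \<le> interference a y i"
  unfolding interference_def by (intro infsum_nonneg mult_nonneg_nonneg) (auto simp: a_nonneg)

lemma interference_mono:
  assumes "summable_config a z" "\<And>i. y i \<le> z i"
  shows "interference a y i \<le> interference a z i"
proof -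
  have s: "(\<lambda>j. a j * real (x (i - j))) summable_on - {0}" if "summable_config a x" for x
    using that unfolding summable_config_def by (blast intro: summable_on_subset_banach)
  show ?thesis unfolding interference_def
    by (intro infsum_mono s assms summable_config_mono[OF assms]) (auto intro!: mult_left_mono a_nonneg simp: assms)
qed

lemma departure_rate_eq:
  assumes "summable_config a y"
  shows "departure_rate a y i = rate (y i) (interference a y i)"
proof -
  have s: "(\<lambda>j. a j * real (y (i - j))) summable_on - {0}"
    using assms unfolding summable_config_def by (blast intro: summable_on_subset_banach)
  have "(\<Sum>\<^sub>\<infinity>j\<in>insert 0 (- {0}). a j * real (y (i - j))) = a 0 * real (y (i - 0)) + interference a y i"
    unfolding interference_def by (rule infsum_insert) (use s in auto)
  moreover have "insert 0 (- {0}) = (UNIV :: (int ^ 'd) set)" by auto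
  ultimately show ?thesis unfolding departure_rate_def rate_def by (simp add: a_0)
qed

section \<open>Solutions, and the response of one queue to a fixed environment\<close>

definition solves :: "real \<Rightarrow> (int ^ 'd \<Rightarrow> real \<Rightarrow> nat) \<Rightarrow> bool" where
  "solves t0 b \<longleftrightarrow> (\<forall>i. queue_eq (A i) (D i) t0 0 (\<lambda>t. departure_rate a (\<lambda>j. b j t) i) (b i))"

lemma queue_eq_cong:
  assumes "queue_eq \<alpha> \<delta> t0 c R p" "\<And>t. t > t0 \<Longrightarrow> R t = R' t" "\<And>t. t > t0 \<Longrightarrow> p t = p' t"
  shows "queue_eq \<alpha> \<delta> t0 c R' p'"
proof -
  have "{(r, u) \<in> \<delta>. t0 < r \<and> r < t \<and> u \<le> R r} = {(r, u) \<in> \<delta>. t0 < r \<and> r < t \<and> u \<le> R' r}" for t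
    using assms(2) by auto
  then show ?thesis using assms(1,3) unfolding queue_eq_def departures_def by auto
qed

text \<open>At equal own lengths the two rates differ by the interference only, and this is the only
  comparison that \<open>queue_eq_mono\<close> asks for.\<close>

lemma queue_eq_environment_mono:
  assumes p: "queue_eq (A i) (D i) t0 c (\<lambda>t. rate (p t) (interference a (\<lambda>j. y j t) i)) p"
    and q: "queue_eq (A i) (D i) t0 c' (\<lambda>t. rate (q t) (interference a (\<lambda>j. z j t) i)) q"
    and "c \<le> c'" and z: "\<And>t. t > t0 \<Longrightarrow> summable_config a (\<lambda>j. z j t)"
    and yz: "\<And>j t. t > t0 \<Longrightarrow> y j t \<le> z j t" and "t > t0"
  shows "p t \<le> q t"
proof -
  interpret queue_input "A i" "D i" by (rule inputs)
  show ?thesis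
  proof (rule queue_eq_mono[OF p q \<open>c \<le> c'\<close> _ \<open>t > t0\<close>])
    fix t assume t: "t > t0" "p t = q t"
    have "interference a (\<lambda>j. y j t) i \<le> interference a (\<lambda>j. z j t) i"
      by (rule interference_mono[OF z[OF t(1)] yz[OF t(1)]])
    then show "rate (q t) (interference a (\<lambda>j. z j t) i) \<le> rate (p t) (interference a (\<lambda>j. y j t) i)"
      unfolding t(2) by (rule rate_antimono[OF of_nat_0_le_iff interference_nonneg])
  qed
qed

text \<open>Only the other queues are frozen; the own length enters its rate self-consistently.
  Freezing it as well would destroy monotonicity, since a longer queue is served faster.\<close>

definition response :: "real \<Rightarrow> (int ^ 'd \<Rightarrow> real \<Rightarrow> nat) \<Rightarrow> int ^ 'd \<Rightarrow> real \<Rightarrow> nat" where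
  "response t0 y i =
     (SOME p. queue_eq (A i) (D i) t0 0 (\<lambda>t. rate (p t) (interference a (\<lambda>j. y j t) i)) p)"

lemma response:
  "queue_eq (A i) (D i) t0 0 (\<lambda>t. rate (response t0 y i t) (interference a (\<lambda>j. y j t) i)) (response t0 y i)"
proof -
  interpret queue_input "A i" "D i" by (rule inputs)
  have "\<exists>p. queue_eq (A i) (D i) t0 0 (\<lambda>t. rate (real (p t)) (interference a (\<lambda>j. y j t) i)) p"
    by (rule queue_eq_exists[of "\<lambda>t v. rate (real v) (interference a (\<lambda>j. y j t) i)" t0]) auto
  then show ?thesis unfolding response_def by (rule someI_ex)
qed

lemma response_mono:
  assumes "\<And>t. t > t0 \<Longrightarrow> summable_config a (\<lambda>j. z j t)" "\<And>j t. t > t0 \<Longrightarrow> y j t \<le> z j t" "t > t0"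
  shows "response t0 y i t \<le> response t0 z i t"
  by (rule queue_eq_environment_mono[OF response response _ assms]) auto

lemma response_le: "t > t0 \<Longrightarrow> response t0 y i t \<le> arrivals (A i) t0 t"
  by (rule queue_input.queue_eq_le_arrivals[OF inputs response])

lemma summable_config_le_arrivals:
  "(\<And>i. y i \<le> arrivals (A i) t0 t) \<Longrightarrow> summable_config a y"
  by (rule summable_config_mono[OF summable_arrivals])

lemma solves_le: "solves t0 b \<Longrightarrow> t > t0 \<Longrightarrow> b i t \<le> arrivals (A i) t0 t"
  unfolding solves_def using queue_input.queue_eq_le_arrivals[OF inputs] by blast

lemma solves_summable: "solves t0 b \<Longrightarrow> t > t0 \<Longrightarrow> summable_config a (\<lambda>i. b i t)"
  by (rule summable_config_le_arrivals) (rule solves_le)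

lemma solves_rate:
  assumes "solves t0 b"
  shows "queue_eq (A i) (D i) t0 0 (\<lambda>t. rate (b i t) (interference a (\<lambda>j. b j t) i)) (b i)"
  using assms unfolding solves_def
  by (auto intro: queue_eq_cong[where p = "b i"] simp: departure_rate_eq[OF solves_summable[OF assms]])

lemma response_fixpoint_solves:
  assumes eq: "\<And>i t. t > t0 \<Longrightarrow> response t0 b i t = b i t"
  shows "solves t0 b"
  unfolding solves_def
proof
  fix i
  have "b j t \<le> arrivals (A j) t0 t" if "t > t0" for j t using response_le[of t0 t b j] eq that by simp
  then have "departure_rate a (\<lambda>j. b j t) i = rate (b i t) (interference a (\<lambda>j. b j t) i)" if "t > t0" for t
    using that by (intro departure_rate_eq summable_config_le_arrivals) auto
  then show "queue_eq (A i) (D i) t0 0 (\<lambda>t. departure_rate a (\<lambda>j. b j t) i) (b i)"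
    using eq by (intro queue_eq_cong[OF response[of i t0 b]]) auto
qed

text \<open>
  Both extremal solutions are Knaster-Tarski fixed points of the response map, which is monotone:
  a larger environment slows the departures down.
\<close>

lemma least_solution:
  obtains b where "solves t0 b"
    "\<And>t1 b' i t. t1 \<le> t0 \<Longrightarrow> solves t1 b' \<Longrightarrow> t > t0 \<Longrightarrow> b i t \<le> b' i t"
proof -
  \<comment> \<open>The pre-fixed points of the response map with convergent interference. Their
    pointwise infimum is attained at each site and time, because lengths are natural
    numbers.\<close>
  define S where "S = {y. (\<forall>t>t0. summable_config a (\<lambda>j. y j t)) \<and> (\<forall>i. \<forall>t>t0. response t0 y i t \<le> y i t)}"
  define b where "b = (\<lambda>i t. LEAST m. \<exists>y\<in>S. y i t = m)"
  have N: "(\<lambda>i t. arrivals (A i) t0 t) \<in> S"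
    unfolding S_def using summable_arrivals response_le by auto
  have b_le: "b i t \<le> y i t" if "y \<in> S" for y i t
    unfolding b_def using that by (intro Least_le) auto
  have b_in: "\<exists>y\<in>S. y i t = b i t" for i t
    unfolding b_def by (rule LeastI_ex) (use N in auto)
  have b_sum: "summable_config a (\<lambda>j. b j t)" for t
    by (rule summable_config_le_arrivals) (use b_le[OF N] in auto)
  have Gb: "response t0 b i t \<le> b i t" if t: "t > t0" for i t
  proof -
    obtain y where y: "y \<in> S" "y i t = b i t" using b_in by blast
    have "response t0 b i t \<le> response t0 y i t"
      by (rule response_mono) (use y t b_le in \<open>auto simp: S_def\<close>)
    also have "\<dots> \<le> y i t" using y(1) t unfolding S_def by blast
    finally show ?thesis using y by simp
  qed
  have "response t0 b \<in> S"
    unfolding S_def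
    by (auto intro!: summable_config_le_arrivals response_le response_mono Gb b_sum)
  then have "response t0 b i t = b i t" if "t > t0" for i t
    using Gb[OF that] b_le by (simp add: antisym)
  then have "solves t0 b" by (rule response_fixpoint_solves)
  moreover have "b i t \<le> b' i t" if b': "solves t1 b'" and t: "t1 \<le> t0" "t > t0" for t1 b' i t
  proof -
    \<comment> \<open>Restarted at \<open>t0\<close>, the solution \<open>b'\<close> is the
      trajectory of a queue in its own environment from a nonnegative length \<open>c\<close>. The
      response starts empty in the same environment and stays below it.\<close>
    have "b' \<in> S" unfolding S_def
    proof (intro CollectI conjI allI impI)
      fix t i assume "t > t0"
      interpret queue_input "A i" "D i" by (rule inputs)
      obtain c where "c \<ge> 0" "queue_eq (A i) (D i) t0 c (\<lambda>t. rate (b' i t) (interference a (\<lambda>j. b' j t) i)) (b' i)"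
        by (rule queue_eq_restart[OF solves_rate[OF b'] \<open>t1 \<le> t0\<close>])
      then show "response t0 b' i t \<le> b' i t"
        by (intro queue_eq_environment_mono[OF response])
          (use \<open>t > t0\<close> t solves_summable[OF b'] in auto)
    qed (use solves_summable[OF b'] t in auto)
    then show ?thesis by (rule b_le)
  qed
  ultimately show ?thesis by (rule that)
qed

text \<open>The supremum of the post-fixed points; the arrivals bound them, so
  \<open>GREATEST\<close> is attained. It dominates all solutions with a later start, as the least
  solution lies below those with an earlier start, and this pair of bounds encloses trajectories
  with arbitrary real starting times.\<close>

lemma greatest_solution:
  obtains b where "solves t0 b"
    "\<And>t1 b' i t. t0 \<le> t1 \<Longrightarrow> solves t1 b' \<Longrightarrow> t > t1 \<Longrightarrow> b' i t \<le> b i t"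
proof -
  define S where "S = {y. \<forall>i. \<forall>t>t0. y i t \<le> response t0 y i t}"
  have le_N: "y i t \<le> arrivals (A i) t0 t" if "y \<in> S" "t > t0" for y i t
    using that response_le[of t0 t y i] unfolding S_def by (auto intro: le_trans)
  define b where "b = (\<lambda>i t. GREATEST m. \<exists>y\<in>S. y i t = m)"
  have Z: "(\<lambda>i t. 0) \<in> S"
    unfolding S_def by auto
  have bound: "m \<le> arrivals (A i) t0 t" if "\<exists>y\<in>S. y i t = m" "t > t0" for m i t
    using that le_N by blast
  have b_ge: "y i t \<le> b i t" if "y \<in> S" "t > t0" for y i t
    unfolding b_def by (rule Greatest_le_nat[OF _ bound]) (use that in blast)+
  have b_in: "\<exists>y\<in>S. y i t = b i t" if "t > t0" for i t
    unfolding b_def by (rule GreatestI_ex_nat[OF _ bound]) (use that Z in blast)+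
  have b_sum: "summable_config a (\<lambda>j. b j t)" if "t > t0" for t
  proof (rule summable_config_le_arrivals)
    fix i show "b i t \<le> arrivals (A i) t0 t"
      using b_in[OF that, of i] le_N[OF _ that] by metis
  qed
  have Gb: "b i t \<le> response t0 b i t" if t: "t > t0" for i t
  proof -
    obtain y where y: "y \<in> S" "y i t = b i t" using b_in[OF t] by blast
    have "y i t \<le> response t0 y i t" using y(1) t unfolding S_def by blast
    then have "b i t \<le> response t0 y i t" by (simp only: y(2))
    also have "\<dots> \<le> response t0 b i t"
      by (rule response_mono) (use y t b_ge b_sum in auto)
    finally show ?thesis .
  qed
  have "response t0 b \<in> S"
    unfolding S_def using Gb b_sum by (auto intro!: response_mono[OF summable_config_le_arrivals[OF response_le]])
  then have "response t0 b i t = b i t" if "t > t0" for i t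
    using Gb[OF that] b_ge that by (simp add: antisym)
  then have "solves t0 b" by (rule response_fixpoint_solves)
  moreover have "b' i t \<le> b i t" if b': "solves t1 b'" and t: "t0 \<le> t1" "t > t1" for t1 b' i t
  proof -
    \<comment> \<open>Extended by empty queues up to its starting time \<open>t1\<close>, the later
      solution becomes a post-fixed point from \<open>t0\<close> on: at \<open>t1\<close> the
      response may already be positive, which only helps.\<close>
    define y where "y = (\<lambda>i t. if t > t1 then b' i t else 0)"
    have "y \<in> S" unfolding S_def
    proof (intro CollectI allI impI)
      fix t i assume "t > t0"
      interpret queue_input "A i" "D i" by (rule inputs)
      obtain c where c: "c \<ge> 0" "queue_eq (A i) (D i) t1 c
          (\<lambda>t. rate (response t0 y i t) (interference a (\<lambda>j. y j t) i)) (response t0 y i)"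
        by (rule queue_eq_restart[OF response \<open>t0 \<le> t1\<close>])
      show "y i t \<le> response t0 y i t"
      proof (cases "t > t1")
        case True
        have "b' i t \<le> response t0 y i t"
          by (rule queue_eq_environment_mono[OF solves_rate[OF b'] c(2,1)])
            (use True solves_summable[OF b'] in \<open>auto simp: y_def\<close>)
        with True show ?thesis by (simp add: y_def)
      qed (simp add: y_def)
    qed
    from b_ge[OF this, of t i] show ?thesis using t by (simp add: y_def)
  qed
  ultimately show ?thesis by (rule that)
qed

section \<open>Correspondence with the queueing dynamics\<close>

lemma before_solves:
  assumes "queue_evolution a A D t0 (\<lambda>_. 0) x"
  shows "solves t0 (\<lambda>i t. before x t i)"
  unfolding solves_def
proof
  fix i
  interpret queue_input "A i" "D i" by (rule inputs)
  have "queue_eq (A i) (D i) t0 0 (\<lambda>t. departure_rate a (before x t) i) (\<lambda>t. Lim (at_left t) (x i))"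
    by (rule queue_eq_of_closed) (use assms in \<open>auto simp: queue_evolution_def\<close>)
  then show "queue_eq (A i) (D i) t0 0 (\<lambda>t. departure_rate a (\<lambda>j. before x t j) i) (\<lambda>t. before x t i)"
    by (simp add: before_def)
qed

text \<open>Needed for the choice in \<open>queue_from_empty\<close> to yield a trajectory. A
  solution \<open>b\<close> records left limits only; \<open>x\<close> counts over closed intervals
  with the departures decided by \<open>b\<close>. The left limits of \<open>x\<close> are again
  \<open>b\<close>, so these are the departures that \<open>x\<close> itself prescribes.\<close>

lemma queue_evolution_exists: "\<exists>x. queue_evolution a A D t0 (\<lambda>_. 0) x"
proof -
  obtain b where b: "solves t0 b" by (rule least_solution)
  define R where "R = (\<lambda>i t. departure_rate a (\<lambda>j. b j t) i)"
  define x where "x = (\<lambda>i s. nat (int (card (A i \<inter> {t0<..s}))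
     - int (card {(r, u) \<in> D i. t0 < r \<and> r \<le> s \<and> u \<le> R i r})))"
  have q: "queue_eq (A i) (D i) t0 0 (R i) (b i)" for i using b unfolding solves_def R_def by auto
  have x: "int (x i s) = 0 + int (card (A i \<inter> {t0<..s}))
     - int (card {(r, u) \<in> D i. t0 < r \<and> r \<le> s \<and> u \<le> R i r})" if "s \<ge> t0" for i s
    using queue_input.closed_of_queue_eq[OF inputs q that] unfolding x_def by simp
  have "queue_eq (A i) (D i) t0 0 (R i) (\<lambda>t. Lim (at_left t) (x i))" for i
    by (rule queue_input.queue_eq_of_closed[OF inputs x])
  then have "before x t = (\<lambda>j. b j t)" if "t > t0" for t
    using q that unfolding before_def queue_eq_def by (auto simp flip: of_nat_eq_iff[where 'a = int])
  then have "{(r, u) \<in> D i. t0 < r \<and> r \<le> s \<and> u \<le> R i r}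
     = {(t, u) \<in> D i. t0 < t \<and> t \<le> s \<and> u \<le> departure_rate a (before x t) i}" for i s
    unfolding R_def by auto
  then have "queue_evolution a A D t0 (\<lambda>_. 0) x"
    using x unfolding queue_evolution_def by auto
  then show ?thesis by blast
qed

text \<open>Lengths at time \<open>s\<close> itself include a jump at \<open>s\<close>, left limits
  do not. The hypothesis is almost surely satisfied at a deterministic time.\<close>

lemma queue_evolution_no_atoms:
  assumes x: "queue_evolution a A D t0 (\<lambda>_. 0) x" and "t0 < s"
    and "s \<notin> A i" "s \<notin> fst ` D i"
  shows "x i s = before x s i"
proof -
  have "{t0<..s} = insert s {t0<..<s}" using \<open>t0 < s\<close> by auto
  then have "A i \<inter> {t0<..s} = A i \<inter> {t0<..<s}" using assms(3) by auto
  moreover have "{(t, u) \<in> D i. t0 < t \<and> t \<le> s \<and> u \<le> departure_rate a (before x t) i}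
     = {(t, u) \<in> D i. t0 < t \<and> t < s \<and> u \<le> departure_rate a (before x t) i}"
    using assms(4) by (force simp: order.order_iff_strict)
  ultimately have "int (x i s) = int (before x s i)"
    using x before_solves[OF x] \<open>t0 < s\<close>
    unfolding queue_evolution_def solves_def queue_eq_def arrivals_def departures_def by auto
  then show ?thesis by simp
qed

end

section \<open>Measurable bounds for the solutions\<close>

text \<open>Domination by \<open>h\<close> turns all sums involved into Bochner integrals over the
  counting measure, where dominated convergence applies.\<close>

lemma infsum_dominated_convergence:
  fixes f :: "nat \<Rightarrow> 'b \<Rightarrow> real"
  assumes h: "h summable_on S" and le: "\<And>n j. j \<in> S \<Longrightarrow> \<bar>f n j\<bar> \<le> h j"
    and lim: "\<And>j. j \<in> S \<Longrightarrow> (\<lambda>n. f n j) \<longlonglongrightarrow> l j"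
  shows "(\<lambda>n. \<Sum>\<^sub>\<infinity>j\<in>S. f n j) \<longlonglongrightarrow> (\<Sum>\<^sub>\<infinity>j\<in>S. l j)"
proof -
  have h0: "0 \<le> h j" if "j \<in> S" for j using le[OF that, of 0] by linarith
  have l: "\<bar>l j\<bar> \<le> h j" if "j \<in> S" for j
    using le[OF that] by (intro LIMSEQ_le_const2[OF tendsto_rabs[OF lim[OF that]]]) auto
  have abs: "Infinite_Set_Sum.abs_summable_on x S \<and> infsetsum x S = infsum x S"
    if "\<And>j. j \<in> S \<Longrightarrow> \<bar>x j\<bar> \<le> h j" for x :: "'b \<Rightarrow> real"
  proof -
    have "(\<lambda>j. norm (x j)) summable_on S"
      by (rule summable_on_comparison_test[OF h]) (use that in auto)
    then have "Infinite_Set_Sum.abs_summable_on x S" by (simp add: abs_summable_equivalent[symmetric])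
    then show ?thesis by (auto intro: infsetsum_infsum)
  qed
  have "integrable (count_space S) h"
    using abs[of h] h0 by (auto simp: abs_summable_on_def)
  then have "(\<lambda>n. infsetsum (f n) S) \<longlonglongrightarrow> infsetsum l S"
    unfolding infsetsum_def
    by (rule integral_dominated_convergence[rotated 2]) (use le lim in \<open>auto simp: AE_count_space\<close>)
  then show ?thesis using abs le l by simp
qed

text \<open>Convergence of \<open>f\<close> and of \<open>Y\<close> to any given value are
  equivalent, so the two limit operators pick the same value even if neither converges.\<close>

lemma Lim_at_top_eq_lim:
  fixes f :: "real \<Rightarrow> nat"
  assumes le: "\<And>n t. n0 \<le> n \<Longrightarrow> real n \<le> t \<Longrightarrow> t \<le> real (Suc n) \<Longrightarrow> Y n \<le> f t \<and> f t \<le> Y (Suc n)"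
  shows "Lim at_top f = lim Y"
proof -
  \<comment> \<open>The integer \<open>n\<close> belongs to two unit intervals: the right one gives
    \<open>Y n\<close> as a lower bound and the left one as an upper bound. The latter requires a
    predecessor of \<open>n\<close> that is still at least \<open>n0\<close>.\<close>
  have eq: "f (real n) = Y n" if n: "Suc n0 \<le> n" for n
    using le[of n "real n"] le[of "n - 1" "real n"] n by (auto simp: of_nat_diff)
  have "(f \<longlongrightarrow> l) at_top \<longleftrightarrow> Y \<longlonglongrightarrow> l" for l
  proof
    assume "(f \<longlongrightarrow> l) at_top"
    then have "(\<lambda>n. f (real n)) \<longlonglongrightarrow> l" by (rule filterlim_compose) (rule filterlim_real_sequentially)
    then show "Y \<longlonglongrightarrow> l"
      by (rule Lim_transform_eventually) (use eq in \<open>auto intro: eventually_sequentiallyI\<close>)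
  next
    assume "Y \<longlonglongrightarrow> l"
    then obtain N where N: "\<And>n. n \<ge> N \<Longrightarrow> Y n = l"
      unfolding tendsto_discrete eventually_sequentially by auto
    have "f t = l" if t: "t \<ge> real (N + n0)" for t
    proof -
      define n where "n = nat \<lfloor>t\<rfloor>"
      have "0 \<le> t" using t by linarith
      then have n: "real n \<le> t" "t \<le> real (Suc n)" unfolding n_def by linarith+
      have "N + n0 \<le> n" using t unfolding n_def by linarith
      with le[OF _ n] N[of n] N[of "Suc n"] show ?thesis by simp
    qed
    then have "\<forall>\<^sub>F t in at_top. f t = l" unfolding eventually_at_top_linorder by blast
    then show "(f \<longlongrightarrow> l) at_top" by (rule tendsto_eventually)
  qed
  then show ?thesis unfolding Topological_Spaces.Lim_def by simp
qed

text \<open>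
  Departures increase with the own queue length and decrease with the others. Hence if
  \<open>lower\<close> and \<open>upper\<close> bracket a solution at stage \<open>k\<close>, inserting them crosswise into the
  equation yields a bracket at stage \<open>k + 1\<close>, which is explicit in the driving processes.
\<close>

fun upper lower ::
  "(int ^ 'd::finite \<Rightarrow> real) \<Rightarrow> (int ^ 'd \<Rightarrow> real set) \<Rightarrow> (int ^ 'd \<Rightarrow> (real \<times> real) set)
     \<Rightarrow> real \<Rightarrow> nat \<Rightarrow> int ^ 'd \<Rightarrow> real \<Rightarrow> nat" where
  "upper a A D t0 0 i t = arrivals (A i) t0 t"
| "upper a A D t0 (Suc k) i t = arrivals (A i) t0 t - departures (D i) t0 t
     (\<lambda>r. rate (lower a A D t0 k i r) (interference a (\<lambda>j. upper a A D t0 k j r) i))"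
| "lower a A D t0 0 i t = 0"
| "lower a A D t0 (Suc k) i t = arrivals (A i) t0 t - departures (D i) t0 t
     (\<lambda>r. rate (upper a A D t0 k i r) (interference a (\<lambda>j. lower a A D t0 k j r) i))"

definition low_rate where
  "low_rate a A D t0 k i r = rate (lower a A D t0 k i r) (interference a (\<lambda>j. upper a A D t0 k j r) i)"

definition high_rate where
  "high_rate a A D t0 k i r = rate (upper a A D t0 k i r) (interference a (\<lambda>j. lower a A D t0 k j r) i)"

lemma upper_Suc: "upper a A D t0 (Suc k) i t = arrivals (A i) t0 t - departures (D i) t0 t (low_rate a A D t0 k i)"
  and lower_Suc: "lower a A D t0 (Suc k) i t = arrivals (A i) t0 t - departures (D i) t0 t (high_rate a A D t0 k i)"
  by (simp_all add: low_rate_def high_rate_def[abs_def] low_rate_def[abs_def])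

context queue_input
begin

lemma departures_mono:
  assumes "\<And>r. t0 < r \<Longrightarrow> r < t \<Longrightarrow> R r \<le> R' r"
  shows "departures \<delta> t0 t R \<le> departures \<delta> t0 t R'"
  unfolding departures_def using assms
  by (intro card_mono finite_departures') (auto intro!: order_trans[OF _ assms])

lemma counts_left_limit:
  assumes "t0 < t"
  shows "\<forall>\<^sub>F s in at_left t. arrivals \<alpha> t0 s = arrivals \<alpha> t0 t \<and> departures \<delta> t0 s R = departures \<delta> t0 t R"
proof -
  obtain t' where t': "t0 \<le> t'" "t' < t" "\<alpha> \<inter> {t'<..<t} = {}" "\<delta> \<inter> {t'<..<t} \<times> UNIV = {}"
    by (rule gap_left[OF assms])
  have "\<forall>\<^sub>F s in at_left t. s \<in> {t'<..<t}" using t' by (intro eventually_at_leftI[of t']) auto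
  then show ?thesis
  proof eventually_elim
    case (elim s)
    have "\<alpha> \<inter> {t0<..<s} = \<alpha> \<inter> {t0<..<t}" using t' elim by (force simp: disjoint_iff)
    moreover have "{(r, u) \<in> \<delta>. t0 < r \<and> r < s \<and> u \<le> R r} = {(r, u) \<in> \<delta>. t0 < r \<and> r < t \<and> u \<le> R r}"
      using t' elim by (force simp: disjoint_iff)
    ultimately show ?case unfolding arrivals_def departures_def by auto
  qed
qed

end

context interference_input
begin

abbreviation "up \<equiv> upper a A D"
abbreviation "lo \<equiv> lower a A D"

lemma upper_le: "up t0 k i t \<le> arrivals (A i) t0 t"
  by (cases k) auto

lemma summable_upper: "summable_config a (\<lambda>i. up t0 k i t)"
  by (rule summable_config_le_arrivals) (rule upper_le)

text \<open>The low rate combines the smallest own length with the largest interference, the high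
  rate the opposite, so the rate of \<open>b\<close> lies between them. The crosswise equation is
  not self-consistent, and its departures may exceed the arrivals; truncation at 0 is harmless
  because \<open>b\<close> is nonnegative.\<close>

lemma bracket:
  assumes b: "solves t0 b"
  shows "t > t0 \<Longrightarrow> lo t0 k i t \<le> b i t \<and> b i t \<le> up t0 k i t"
proof (induction k arbitrary: i t)
  case 0
  then show ?case using solves_le[OF b] by auto
next
  case (Suc k)
  interpret queue_input "A i" "D i" by (rule inputs)
  define R where "R = (\<lambda>t. rate (b i t) (interference a (\<lambda>j. b j t) i))"
  have "int (b i t) = int (arrivals (A i) t0 t) - int (departures (D i) t0 t R)"
    using solves_rate[OF b, of i] \<open>t > t0\<close> unfolding queue_eq_def R_def by auto
  moreover have "departures (D i) t0 t (low_rate a A D t0 k i) \<le> departures (D i) t0 t R"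
  proof (rule departures_mono)
    fix r assume r: "t0 < r" "r < t"
    have "interference a (\<lambda>j. b j r) i \<le> interference a (\<lambda>j. up t0 k j r) i"
      by (rule interference_mono[OF summable_upper]) (use Suc.IH r in auto)
    then have "low_rate a A D t0 k i r \<le> rate (lo t0 k i r) (interference a (\<lambda>j. b j r) i)"
      unfolding low_rate_def by (intro rate_antimono interference_nonneg) auto
    also have "\<dots> \<le> R r" unfolding R_def
      by (intro rate_mono interference_nonneg) (use Suc.IH r in auto)
    finally show "low_rate a A D t0 k i r \<le> R r" .
  qed
  moreover have "departures (D i) t0 t R \<le> departures (D i) t0 t (high_rate a A D t0 k i)"
  proof (rule departures_mono)
    fix r assume r: "t0 < r" "r < t"
    have "interference a (\<lambda>j. lo t0 k j r) i \<le> interference a (\<lambda>j. b j r) i"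
      by (rule interference_mono[OF solves_summable[OF b]]) (use Suc.IH r in auto)
    then have "rate (b i r) (interference a (\<lambda>j. b j r) i) \<le> rate (b i r) (interference a (\<lambda>j. lo t0 k j r) i)"
      by (intro rate_antimono interference_nonneg) auto
    also have "\<dots> \<le> high_rate a A D t0 k i r" unfolding high_rate_def
      by (intro rate_mono interference_nonneg) (use Suc.IH r in auto)
    finally show "R r \<le> high_rate a A D t0 k i r" unfolding R_def .
  qed
  ultimately show ?case unfolding upper_Suc lower_Suc by linarith
qed

lemma arrivals_before_start: "t \<le> t0 \<Longrightarrow> arrivals (A i) t0 t = 0"
  by (simp add: arrivals_def)

text \<open>After \<open>t0\<close> any solution separates the two bounds, so existence of one
  suffices. Up to \<open>t0\<close> there are no arrivals and the lower bound is 0.\<close>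

lemma lower_le_upper: "lo t0 k i t \<le> up t0 k i t"
proof (cases "t > t0")
  case True
  obtain b where "solves t0 b" by (rule least_solution)
  from bracket[OF this True, of k i] show ?thesis by simp
next
  case False
  then have "lo t0 k i t = 0"
    using arrivals_before_start[of t t0 i] by (cases k) auto
  then show ?thesis by simp
qed

lemma summable_lower: "summable_config a (\<lambda>i. lo t0 k i t)"
  by (rule summable_config_mono[OF summable_upper lower_le_upper])

lemma interference_lower_le_upper:
  "interference a (\<lambda>j. lo t0 k j r) i \<le> interference a (\<lambda>j. up t0 k j r) i"
  by (rule interference_mono) (rule summable_upper, rule lower_le_upper)

lemma rate_interference_bounds:
  "0 \<le> low_rate a A D t0 k i r" "low_rate a A D t0 k i r \<le> high_rate a A D t0 k i r"
  "high_rate a A D t0 k i r \<le> 1"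
proof -
  have "low_rate a A D t0 k i r \<le> rate (lo t0 k i r) (interference a (\<lambda>j. lo t0 k j r) i)"
    unfolding low_rate_def
    by (rule rate_antimono[OF of_nat_0_le_iff interference_nonneg interference_lower_le_upper])
  also have "\<dots> \<le> high_rate a A D t0 k i r" unfolding high_rate_def
    by (rule rate_mono[OF of_nat_0_le_iff _ interference_nonneg]) (simp add: lower_le_upper)
  finally show "low_rate a A D t0 k i r \<le> high_rate a A D t0 k i r" .
  show "0 \<le> low_rate a A D t0 k i r"
    unfolding low_rate_def by (rule rate_bounds[OF of_nat_0_le_iff interference_nonneg, THEN conjunct1])
  show "high_rate a A D t0 k i r \<le> 1"
    unfolding high_rate_def by (rule rate_bounds[OF of_nat_0_le_iff interference_nonneg, THEN conjunct2])
qed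

text \<open>The Lipschitz estimate has constant 1 in the own length and in the interference of the
  others. Since \<open>a 0 = 1\<close>, both contributions form a single convolution of
  \<open>a\<close> with the gaps.\<close>

lemma rate_gap:
  "high_rate a A D t0 k i r - low_rate a A D t0 k i r
     \<le> (\<Sum>\<^sub>\<infinity>j. a j * (real (up t0 k (i - j) r) - real (lo t0 k (i - j) r)))"
proof -
  have s: "(\<lambda>j. a j * real (x (i - j))) summable_on S" if "summable_config a x" for x S
    using that unfolding summable_config_def by (blast intro: summable_on_subset_banach)
  have d: "(\<lambda>j. a j * (real (up t0 k (i - j) r) - real (lo t0 k (i - j) r))) summable_on S" for S
    by (rule summable_on_comparison_test[OF s[OF summable_upper, of t0 k r S]])
      (auto simp: a_nonneg lower_le_upper intro!: mult_nonneg_nonneg mult_left_mono)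
  have "high_rate a A D t0 k i r - low_rate a A D t0 k i r
     \<le> (real (up t0 k i r) - real (lo t0 k i r))
       + (interference a (\<lambda>j. up t0 k j r) i - interference a (\<lambda>j. lo t0 k j r) i)"
    unfolding high_rate_def low_rate_def
    by (rule rate_lipschitz[OF lower_le_upper interference_nonneg interference_lower_le_upper])
  also have "interference a (\<lambda>j. up t0 k j r) i - interference a (\<lambda>j. lo t0 k j r) i
     = (\<Sum>\<^sub>\<infinity>j\<in>- {0}. a j * (real (up t0 k (i - j) r) - real (lo t0 k (i - j) r)))"
    unfolding interference_def
    using infsum_add[OF d[of "- {0}"] s[OF summable_lower, of t0 k r "- {0}"]]
    by (simp add: algebra_simps)
  also have "(real (up t0 k i r) - real (lo t0 k i r)) + \<dots>
     = (\<Sum>\<^sub>\<infinity>j\<in>insert 0 (- {0}). a j * (real (up t0 k (i - j) r) - real (lo t0 k (i - j) r)))"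
    by (subst infsum_insert) (use d in \<open>auto simp: a_0\<close>)
  also have "insert 0 (- {0}) = (UNIV :: (int ^ 'd) set)" by auto
  finally show ?thesis .
qed

section \<open>Left continuity of the bracketing rates\<close>

lemma bracket_left_limit:
  assumes "t0 < t"
  shows "\<forall>\<^sub>F s in at_left t. up t0 k i s = up t0 k i t" "\<forall>\<^sub>F s in at_left t. lo t0 k i s = lo t0 k i t"
proof -
  interpret queue_input "A i" "D i" by (rule inputs)
  note * = counts_left_limit[OF assms]
  show "\<forall>\<^sub>F s in at_left t. up t0 k i s = up t0 k i t"
  proof (cases k)
    case 0
    show ?thesis using *[of "\<lambda>_. 0"] unfolding 0 by eventually_elim simp
  next
    case (Suc k')
    show ?thesis using *[of "low_rate a A D t0 k' i"] unfolding Suc upper_Suc by eventually_elim simp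
  qed
  show "\<forall>\<^sub>F s in at_left t. lo t0 k i s = lo t0 k i t"
  proof (cases k)
    case (Suc k')
    show ?thesis using *[of "high_rate a A D t0 k' i"] unfolding Suc lower_Suc by eventually_elim simp
  qed simp
qed

text \<open>Each queue is constant shortly before \<open>t\<close>, but not uniformly over the
  sites; dominated convergence with the arrivals up to \<open>t\<close> bridges this. The offset
  \<open>M\<close> brings the whole sequence below \<open>t\<close>, where the domination
  holds.\<close>

lemma interference_left_limit:
  assumes "t0 < t" and g: "filterlim g (at_left t) sequentially"
    and ev: "\<And>j. \<forall>\<^sub>F s in at_left t. y j s = y j t" and le: "\<And>j s. y j s \<le> arrivals (A j) t0 s"
  shows "(\<lambda>m. interference a (\<lambda>j. y j (g m)) i) \<longlonglongrightarrow> interference a (\<lambda>j. y j t) i"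
proof -
  have "\<forall>\<^sub>F s in at_left t. s < t" by (simp add: eventually_at_filter)
  then have "\<forall>\<^sub>F m in sequentially. g m < t" using g unfolding filterlim_iff by blast
  then obtain M where M: "\<And>m. m \<ge> M \<Longrightarrow> g m < t" unfolding eventually_sequentially by blast
  have "(\<lambda>m. interference a (\<lambda>j. y j (g (m + M))) i) \<longlonglongrightarrow> interference a (\<lambda>j. y j t) i"
    unfolding interference_def
  proof (rule infsum_dominated_convergence)
    show "(\<lambda>j. a j * real (arrivals (A (i - j)) t0 t)) summable_on - {0}"
      using summable_arrivals[of t0 t] unfolding summable_config_def by (blast intro: summable_on_subset_banach)
    fix j :: "int ^ 'd" and m :: nat assume "j \<in> - {0}"
    have "y (i - j) (g (m + M)) \<le> arrivals (A (i - j)) t0 (g (m + M))" by (rule le)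
    also have "\<dots> \<le> arrivals (A (i - j)) t0 t" unfolding arrivals_def
      using M[of "m + M"] queue_input.finite_arrivals'(1)[OF inputs, of "i - j" t0 t] by (intro card_mono) auto
    finally show "\<bar>a j * real (y (i - j) (g (m + M)))\<bar> \<le> a j * real (arrivals (A (i - j)) t0 t)"
      by (simp add: abs_mult a_nonneg mult_left_mono)
    have "\<forall>\<^sub>F m in sequentially. y (i - j) (g m) = y (i - j) t"
      using g ev[of "i - j"] by (auto simp: filterlim_iff)
    then have "\<forall>\<^sub>F m in sequentially. y (i - j) (g (m + M)) = y (i - j) t"
      by (subst eventually_sequentially_seg)
    then show "(\<lambda>m. a j * real (y (i - j) (g (m + M)))) \<longlonglongrightarrow> a j * real (y (i - j) t)"
      by (intro tendsto_eventually) (auto elim: eventually_mono)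
  qed
  then show ?thesis by (rule LIMSEQ_offset)
qed

text \<open>The rate is discontinuous where own length and interference both vanish. Lengths that
  are eventually constant avoid the problem: at length 0 the rate is eventually 0, otherwise the
  limiting denominator is positive.\<close>

lemma rate_tendsto:
  assumes "e \<longlonglongrightarrow> e0" "0 \<le> e0" "\<forall>\<^sub>F m in sequentially. v m = v0"
  shows "(\<lambda>m. rate (real (v m)) (e m)) \<longlonglongrightarrow> rate (real v0) e0"
proof (cases "v0 = 0")
  case True
  then show ?thesis using assms(3) by (intro tendsto_eventually) (auto elim: eventually_mono)
next
  case False
  with assms(2) have "real v0 + e0 \<noteq> 0" by linarith
  then have "(\<lambda>m. real v0 / (real v0 + e m)) \<longlonglongrightarrow> real v0 / (real v0 + e0)"
    by (intro tendsto_intros assms(1))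
  then show ?thesis unfolding rate_def
    by (rule Lim_transform_eventually) (use assms(3) in \<open>auto elim: eventually_mono\<close>)
qed

lemma rates_left_limit:
  assumes "t0 < t" and g: "filterlim g (at_left t) sequentially"
  shows "(\<lambda>m. low_rate a A D t0 k i (g m)) \<longlonglongrightarrow> low_rate a A D t0 k i t"
    and "(\<lambda>m. high_rate a A D t0 k i (g m)) \<longlonglongrightarrow> high_rate a A D t0 k i t"
proof -
  note ev = bracket_left_limit[OF \<open>t0 < t\<close>]
  show "(\<lambda>m. low_rate a A D t0 k i (g m)) \<longlonglongrightarrow> low_rate a A D t0 k i t"
    unfolding low_rate_def
    by (intro rate_tendsto interference_left_limit[OF assms] ev upper_le interference_nonneg)
      (use g ev(2)[of k i] in \<open>auto simp: filterlim_iff\<close>)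
  show "(\<lambda>m. high_rate a A D t0 k i (g m)) \<longlonglongrightarrow> high_rate a A D t0 k i t"
    unfolding high_rate_def
    by (intro rate_tendsto interference_left_limit[OF assms] ev interference_nonneg
        order_trans[OF lower_le_upper upper_le])
      (use g ev(1)[of k i] in \<open>auto simp: filterlim_iff\<close>)
qed

text \<open>Merged brackets determine all solutions started at an integer time. For a starting time
  between two integers, the chosen trajectory lies above the least solution from the later one and
  below the greatest from the earlier one, so its value is enclosed by consecutive terms of one
  explicit sequence.\<close>

lemma queue_from_past_eq:
  assumes ex: "\<And>n::nat. \<exists>k. up (- real n) k i s = lo (- real n) k i s"
    and s: "s \<notin> A i" "s \<notin> fst ` D i"
  shows "queue_from_past a A D i s
    = lim (\<lambda>n. lo (- real n) (LEAST k. up (- real n) k i s = lo (- real n) k i s) i s)"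
  unfolding queue_from_past_def
proof (rule Lim_at_top_eq_lim)
  define Y where "Y = (\<lambda>n. lo (- real n) (LEAST k. up (- real n) k i s = lo (- real n) k i s) i s)"
  fix n :: nat and t :: real
  assume n: "nat (\<lfloor>- s\<rfloor> + 1) \<le> n" and t: "real n \<le> t" "t \<le> real (Suc n)"
  \<comment> \<open>The lower bound on \<open>n\<close> guarantees that the dynamics starts strictly
    before \<open>s\<close>.\<close>
  have s': "- real m < s" if "m \<ge> n" for m :: nat
    using n that by linarith
  have Y: "b i s = Y m" if "solves (- real m) b" "m \<ge> n" for b m
    using bracket[OF that(1) s'[OF that(2)], of "LEAST k. up (- real m) k i s = lo (- real m) k i s" i]
      LeastI_ex[OF ex[of m]] unfolding Y_def by simp
  define x where "x = queue_from_empty a A D t"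
  have x: "queue_evolution a A D (- t) (\<lambda>_. 0) x"
    unfolding x_def queue_from_empty_def using queue_evolution_exists by (rule someI_ex)
  then have b: "solves (- t) (\<lambda>i t. before x t i)" by (rule before_solves)
  have xs: "x i s = before x s i"
    using queue_evolution_no_atoms[OF x _ s] s'[of n] t by simp
  obtain l where l: "solves (- real n) l" "l i s \<le> before x s i"
    using least_solution[of "- real n"] b t s'[of n] by (metis le_imp_neg_le order_refl)
  obtain h where h: "solves (- real (Suc n)) h" "before x s i \<le> h i s"
    using greatest_solution[of "- real (Suc n)"] b t s'[of n] by (smt (verit) less_le_not_le order_refl)
  show "Y n \<le> queue_from_empty a A D t i s \<and> queue_from_empty a A D t i s \<le> Y (Suc n)"
    using l h Y[of n l] Y[of "Suc n" h] xs unfolding x_def by simp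
qed

end

section \<open>Poisson point processes\<close>

definition locally_finite_sets :: "'e::euclidean_space set set" where
  "locally_finite_sets = {S. \<forall>B. bounded B \<longrightarrow> finite (S \<inter> B)}"

definition configurations :: "'e::euclidean_space set measure" where
  "configurations = sigma locally_finite_sets
     {{S \<in> locally_finite_sets. card (S \<inter> B) = k} | B k. B \<in> sets borel \<and> bounded B}"

lemma space_configurations [simp]: "space configurations = locally_finite_sets"
  unfolding configurations_def by (rule space_measure_of) auto

lemma sets_configurations:
  "sets configurations = sigma_sets locally_finite_sets
     {{S \<in> locally_finite_sets. card (S \<inter> B) = k} | B k. B \<in> sets borel \<and> bounded B}"
  unfolding configurations_def by (rule sets_measure_of) auto

lemma measurable_card [measurable]:
  assumes "B \<in> sets borel" "bounded B"
  shows "(\<lambda>S. card (S \<inter> B)) \<in> measurable configurations (count_space UNIV)"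
proof (subst measurable_count_space_eq2_countable)
  have "(\<lambda>S. card (S \<inter> B)) -` {k} \<inter> space configurations \<in> sets configurations" for k
  proof -
    have "(\<lambda>S. card (S \<inter> B)) -` {k} \<inter> space configurations = {S \<in> locally_finite_sets. card (S \<inter> B) = k}"
      by auto
    also have "\<dots> \<in> sets configurations"
      unfolding sets_configurations by (rule sigma_sets.Basic) (use assms in blast)
    finally show ?thesis .
  qed
  then show "(\<lambda>S. card (S \<inter> B)) \<in> space configurations \<rightarrow> UNIV \<and>
      (\<forall>k\<in>UNIV. (\<lambda>S. card (S \<inter> B)) -` {k} \<inter> space configurations \<in> sets configurations)"
    by blast
qed

lemma measurable_configurationsI:
  assumes "\<And>x. x \<in> space M \<Longrightarrow> f x \<in> locally_finite_sets"
    and "\<And>B. B \<in> sets borel \<Longrightarrow> bounded B \<Longrightarrow> (\<lambda>x. card (f x \<inter> B)) \<in> measurable M (count_space UNIV)"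
  shows "f \<in> measurable M configurations"
  unfolding configurations_def
proof (rule measurable_measure_of)
  fix Y assume "Y \<in> {{S \<in> locally_finite_sets. card (S \<inter> B) = k} | B k. B \<in> sets borel \<and> bounded (B :: 'b set)}"
  then obtain B k where Y: "Y = {S \<in> locally_finite_sets. card (S \<inter> B) = k}" "B \<in> sets borel" "bounded B" by blast
  have "f -` Y \<inter> space M = (\<lambda>x. card (f x \<inter> B)) -` {k} \<inter> space M" using assms(1) Y by auto
  also have "\<dots> \<in> sets M" by (rule measurable_sets[OF assms(2)[OF Y(2,3)]]) auto
  finally show "f -` Y \<inter> space M \<in> sets M" .
qed (use assms in auto)

lemma locally_finite_sets_subset: "S \<in> locally_finite_sets \<Longrightarrow> S' \<subseteq> S \<Longrightarrow> S' \<in> locally_finite_sets"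
  unfolding locally_finite_sets_def
proof clarify
  fix B :: "'a set" assume "\<forall>B. bounded B \<longrightarrow> finite (S \<inter> B)" "S' \<subseteq> S" "bounded B"
  then show "finite (S' \<inter> B)" by (intro finite_subset[of "S' \<inter> B" "S \<inter> B"]) auto
qed

lemma measurable_restriction [measurable]:
  assumes "H \<in> sets borel"
  shows "(\<lambda>S. S \<inter> H) \<in> measurable configurations configurations"
proof (rule measurable_configurationsI)
  fix B :: "'a set" assume "B \<in> sets borel" "bounded B"
  then have "(\<lambda>S. card (S \<inter> (H \<inter> B))) \<in> measurable configurations (count_space UNIV)"
    using assms by (intro measurable_card) auto
  then show "(\<lambda>S. card (S \<inter> H \<inter> B)) \<in> measurable configurations (count_space UNIV)" by (simp add: Int_assoc)
qed (simp add: locally_finite_sets_subset[OF _ Int_lower1])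

text \<open>Events fixing a single count are not closed under intersection; finite conjunctions of
  them are, and generate the same sigma-algebra.\<close>

definition count_cylinders :: "'e::euclidean_space set set set" where
  "count_cylinders = {{S \<in> locally_finite_sets. \<forall>(b, k)\<in>F. card (S \<inter> b) = k} | F.
     finite F \<and> (\<forall>(b, k)\<in>F. b \<in> sets borel \<and> bounded b)}"

lemma count_cylinders_subset: "count_cylinders \<subseteq> Pow locally_finite_sets"
  by (auto simp: count_cylinders_def)

lemma Int_stable_count_cylinders: "Int_stable count_cylinders"
proof (rule Int_stableI)
  fix X Y :: "'a set set" assume "X \<in> count_cylinders" "Y \<in> count_cylinders"
  then obtain F G where "finite F" "finite G" "\<forall>(b, k)\<in>F. b \<in> sets borel \<and> bounded b"
    "\<forall>(b, k)\<in>G. b \<in> sets borel \<and> bounded b"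
    "X = {S \<in> locally_finite_sets. \<forall>(b, k)\<in>F. card (S \<inter> b) = k}"
    "Y = {S \<in> locally_finite_sets. \<forall>(b, k)\<in>G. card (S \<inter> b) = k}"
    unfolding count_cylinders_def by blast
  then show "X \<inter> Y \<in> count_cylinders"
    unfolding count_cylinders_def by (intro CollectI exI[of _ "F \<union> G"]) (auto simp: ball_Un)
qed

lemma sets_configurations_cylinders:
  "sets configurations = sigma_sets locally_finite_sets (count_cylinders :: 'e::euclidean_space set set set)"
proof
  show "sets configurations \<subseteq> sigma_sets locally_finite_sets (count_cylinders :: 'e set set set)"
    unfolding sets_configurations
  proof (rule sigma_sets_mono, rule subsetI)
    fix X :: "'e set set"
    assume "X \<in> {{S \<in> locally_finite_sets. card (S \<inter> B) = k} | B k. B \<in> sets borel \<and> bounded B}"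
    then obtain B k where X: "X = {S \<in> locally_finite_sets. card (S \<inter> B) = k}" "B \<in> sets borel" "bounded B" by blast
    then have "{S \<in> locally_finite_sets. card (S \<inter> B) = k} \<in> count_cylinders"
      unfolding count_cylinders_def by (intro CollectI exI[of _ "{(B, k)}"]) auto
    then show "X \<in> sigma_sets locally_finite_sets count_cylinders"
      unfolding X(1) by (rule sigma_sets.Basic)
  qed
  have "X \<in> sets configurations" if "X \<in> count_cylinders" for X :: "'e set set"
  proof -
    from that obtain F where F: "finite F" "\<forall>(b, k)\<in>F. b \<in> sets borel \<and> bounded b"
      "X = {S \<in> locally_finite_sets. \<forall>(b, k)\<in>F. card (S \<inter> b) = k}" unfolding count_cylinders_def by blast
    have "{S \<in> space configurations. \<forall>p\<in>F. card (S \<inter> fst p) = snd p} \<in> sets configurations"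
    proof (rule sets.sets_Collect_finite_All[OF _ F(1)])
      fix p assume "p \<in> F"
      then have "(\<lambda>S. card (S \<inter> fst p)) \<in> measurable configurations (count_space UNIV)"
        using F(2) by (intro measurable_card) auto
      from measurable_sets[OF this, of "{snd p}"]
      show "{S \<in> space configurations. card (S \<inter> fst p) = snd p} \<in> sets configurations"
        by (simp add: vimage_def Int_def conj_commute)
    qed
    then show ?thesis by (simp add: F(3) case_prod_beta)
  qed
  then show "sigma_sets locally_finite_sets count_cylinders \<subseteq> (sets configurations :: 'e set set set)"
    using sets.sigma_sets_subset[of count_cylinders "configurations :: 'e set measure"] by auto
qed

text \<open>Independence of Poisson counts is available for sequences of disjoint sets only. The
  pieces are the nonempty atoms of the finite set algebra, one for each subfamily of sets containing
  a point, padded with empty sets to a sequence.\<close>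

lemma finite_partition:
  fixes \<B> :: "'e::euclidean_space set set"
  assumes "finite \<B>" and \<B>: "\<And>b. b \<in> \<B> \<Longrightarrow> b \<in> sets borel \<and> bounded b"
  obtains B :: "nat \<Rightarrow> 'e set" and I where "\<forall>m. B m \<in> sets borel \<and> bounded (B m) \<and> B m \<subseteq> \<Union>\<B>"
    "disjoint_family B" "\<forall>b\<in>\<B>. finite (I b) \<and> b = (\<Union>m\<in>I b. B m)"
proof -
  obtain f where f: "bij_betw f {..<card (Pow \<B>)} (Pow \<B>)"
    using ex_bij_betw_nat_finite[of "Pow \<B>"] assms(1) by (auto simp: atLeast0LessThan)
  define B where "B m = (if m < card (Pow \<B>) then {x \<in> \<Union>\<B>. {b \<in> \<B>. x \<in> b} = f m} else {})" for m
  define I where "I b = {m. m < card (Pow \<B>) \<and> b \<in> f m}" for b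
  have "B m \<in> sets borel" for m
  proof -
    have "{x \<in> \<Union>\<B>. {b \<in> \<B>. x \<in> b} = f m} = {x \<in> space borel. x \<in> \<Union>\<B> \<and> (\<forall>b\<in>\<B>. x \<in> b \<longleftrightarrow> b \<in> f m)}"
      if "m < card (Pow \<B>)"
      using bij_betwE[OF f] that by (auto simp: set_eq_iff)
    moreover have "{x \<in> space borel. x \<in> \<Union>\<B> \<and> (\<forall>b\<in>\<B>. x \<in> b \<longleftrightarrow> b \<in> f m)} \<in> sets borel"
    proof -
      have "\<Union>\<B> \<in> sets borel" using assms by (intro sets.finite_Union) auto
      moreover have "{x \<in> space borel. \<forall>b\<in>\<B>. x \<in> b \<longleftrightarrow> b \<in> f m} \<in> sets borel"
      proof (rule sets.sets_Collect_finite_All[OF _ assms(1)])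
        fix b assume "b \<in> \<B>"
        then have "b \<in> sets borel" using \<B> by blast
        then show "{x \<in> space borel. (x \<in> b) = (b \<in> f m)} \<in> sets borel"
          by (cases "b \<in> f m") (auto simp: Collect_neg_eq[symmetric] Compl_eq[symmetric])
      qed
      ultimately have "\<Union>\<B> \<inter> {x \<in> space borel. \<forall>b\<in>\<B>. x \<in> b \<longleftrightarrow> b \<in> f m} \<in> sets borel" by (rule sets.Int)
      then show ?thesis by (simp add: Int_def)
    qed
    ultimately show ?thesis by (simp add: B_def)
  qed
  moreover have sub: "B m \<subseteq> \<Union>\<B>" for m by (auto simp: B_def)
  moreover have "bounded (\<Union>\<B>)" using assms by (intro bounded_Union) auto
  then have "bounded (B m)" for m using sub by (rule bounded_subset)
  moreover have "disjoint_family B"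
    using bij_betw_imp_inj_on[OF f] by (auto simp: disjoint_family_on_def B_def inj_on_def)
  moreover have "b = (\<Union>m\<in>I b. B m)" if "b \<in> \<B>" for b
  proof (intro set_eqI iffI)
    fix x assume x: "x \<in> b"
    have "{b \<in> \<B>. x \<in> b} \<in> f ` {..<card (Pow \<B>)}" using bij_betw_imp_surj_on[OF f] by auto
    then obtain m where "m < card (Pow \<B>)" "f m = {b \<in> \<B>. x \<in> b}" by auto
    then show "x \<in> (\<Union>m\<in>I b. B m)" using x that by (intro UN_I[of m]) (auto simp: I_def B_def)
  qed (auto simp: I_def B_def)
  ultimately show ?thesis by (intro that[of B I]) (auto simp: I_def)
qed

lemma card_partition:
  assumes "S \<in> locally_finite_sets" "finite I" "disjoint_family B" "\<And>m. bounded (B m)"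
  shows "card (S \<inter> (\<Union>m\<in>I. B m)) = (\<Sum>m\<in>I. card (S \<inter> B m))"
proof -
  have "card (\<Union>m\<in>I. S \<inter> B m) = (\<Sum>m\<in>I. card (S \<inter> B m))"
    by (intro card_UN_disjoint) (use assms in \<open>auto simp: locally_finite_sets_def disjoint_family_on_def\<close>)
  then show ?thesis by (simp only: Int_UN_distrib)
qed

text \<open>Reduces an event about the restriction to \<open>H\<close> to a condition
  \<open>Q\<close> on counts in disjoint pieces of \<open>H\<close>. Measurability of
  \<open>Q\<close> is stated for arbitrary count functions because it is used on product spaces with
  different index sets. The case of the whole space serves the uniqueness of the law, a proper
  \<open>H\<close> the independence of past and future.\<close>

lemma cylinder_partition:
  fixes X :: "'e::euclidean_space set set"
  assumes "X \<in> count_cylinders" "H \<in> sets borel"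
  obtains B :: "nat \<Rightarrow> 'e set" and Q :: "(nat \<Rightarrow> nat) \<Rightarrow> bool"
  where "\<forall>m. B m \<in> sets borel \<and> bounded (B m) \<and> B m \<subseteq> H" "disjoint_family B"
    "\<forall>S\<in>locally_finite_sets. S \<inter> H \<in> X \<longleftrightarrow> Q (\<lambda>m. card (S \<inter> B m))"
    "\<forall>(M :: (nat \<Rightarrow> nat) measure) f. (\<forall>m. f m \<in> measurable M (count_space UNIV)) \<longrightarrow> {\<omega> \<in> space M. Q (\<lambda>m. f m \<omega>)} \<in> sets M"
proof -
  from assms(1) obtain F where F: "finite F" "\<forall>(b, k)\<in>F. b \<in> sets borel \<and> bounded b"
    "X = {S \<in> locally_finite_sets. \<forall>(b, k)\<in>F. card (S \<inter> b) = k}" unfolding count_cylinders_def by blast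
  define \<B> where "\<B> = (\<lambda>p. H \<inter> fst p) ` F"
  have fin: "finite \<B>" unfolding \<B>_def using F(1) by simp
  have bd: "b \<in> sets borel \<and> bounded b" if b: "b \<in> \<B>" for b
  proof -
    obtain p where p: "b = H \<inter> fst p" "p \<in> F" using b unfolding \<B>_def by (rule imageE)
    then have "fst p \<in> sets borel" "bounded (fst p)" using F(2) by auto
    with p assms(2) show ?thesis by (auto intro!: bounded_Int)
  qed
  obtain B :: "nat \<Rightarrow> 'e set" and I where B: "\<forall>m. B m \<in> sets borel \<and> bounded (B m) \<and> B m \<subseteq> \<Union>\<B>"
    "disjoint_family B" "\<forall>b\<in>\<B>. finite (I b) \<and> b = (\<Union>m\<in>I b. B m)" by (rule finite_partition[OF fin bd])
  define Q where "Q = (\<lambda>c. \<forall>p\<in>F. (\<Sum>m\<in>I (H \<inter> fst p). c m) = snd p)"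
  show ?thesis
  proof (rule that[of B Q]; (intro allI ballI impI)?)
    show "B m \<in> sets borel \<and> bounded (B m) \<and> B m \<subseteq> H" for m using B(1)[rule_format, of m] unfolding \<B>_def by auto
    fix S :: "'e set" assume S: "S \<in> locally_finite_sets"
    have "card (S \<inter> H \<inter> fst p) = (\<Sum>m\<in>I (H \<inter> fst p). card (S \<inter> B m))" if "p \<in> F" for p
    proof -
      have b: "finite (I (H \<inter> fst p))" "H \<inter> fst p = (\<Union>m\<in>I (H \<inter> fst p). B m)"
        using B(3)[rule_format, of "H \<inter> fst p"] that by (auto simp: \<B>_def)
      have "card (S \<inter> (\<Union>m\<in>I (H \<inter> fst p). B m)) = (\<Sum>m\<in>I (H \<inter> fst p). card (S \<inter> B m))"
        by (rule card_partition[OF S b(1) B(2)]) (use B in auto)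
      then show ?thesis using b(2) by (simp add: Int_assoc)
    qed
    then show "S \<inter> H \<in> X \<longleftrightarrow> Q (\<lambda>m. card (S \<inter> B m))"
      unfolding F(3) Q_def using locally_finite_sets_subset[OF S] by (auto simp: case_prod_beta)
  next
    fix M :: "(nat \<Rightarrow> nat) measure" and f :: "nat \<Rightarrow> (nat \<Rightarrow> nat) \<Rightarrow> nat"
    assume "\<forall>m. f m \<in> measurable M (count_space UNIV)"
    then have [measurable]: "f m \<in> measurable M (count_space UNIV)" for m by blast
    show "{\<omega> \<in> space M. Q (\<lambda>m. f m \<omega>)} \<in> sets M" unfolding Q_def
    proof (rule sets.sets_Collect_finite_All[OF _ F(1)])
      fix p :: "'e set \<times> nat"
      have "(\<lambda>\<omega>. \<Sum>m\<in>I (H \<inter> fst p). f m \<omega>) \<in> measurable M (count_space UNIV)" by measurable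
      then show "{\<omega> \<in> space M. (\<Sum>m\<in>I (H \<inter> fst p). f m \<omega>) = snd p} \<in> sets M" by measurable
    qed
  qed (use B in auto)
qed

section \<open>Mean, law and independence of Poisson counts\<close>

context prob_space
begin

lemma poisson_measurable: "poisson_point_process M \<nu> S \<Longrightarrow> S \<in> measurable M configurations"
  unfolding poisson_point_process_def by (intro measurable_configurationsI) (auto simp: locally_finite_sets_def)

lemma poisson_count_measurable:
  "poisson_point_process M \<nu> S \<Longrightarrow> B \<in> sets borel \<Longrightarrow> bounded B \<Longrightarrow> (\<lambda>\<omega>. card (S \<omega> \<inter> B)) \<in> measurable M (count_space UNIV)"
  unfolding poisson_point_process_def by blast

lemma poisson_prob:
  "poisson_point_process M \<nu> S \<Longrightarrow> B \<in> sets borel \<Longrightarrow> bounded B \<Longrightarrow>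
    prob {\<omega>\<in>space M. card (S \<omega> \<inter> B) = k} = measure \<nu> B ^ k / fact k * exp (- measure \<nu> B)"
  unfolding poisson_point_process_def by blast

lemma poisson_indep:
  "poisson_point_process M \<nu> S \<Longrightarrow> (\<And>m::nat. B m \<in> sets borel \<and> bounded (B m)) \<Longrightarrow> disjoint_family B \<Longrightarrow>
    indep_vars (\<lambda>_. count_space UNIV) (\<lambda>m \<omega>. card (S \<omega> \<inter> B m)) UNIV"
  unfolding poisson_point_process_def by blast

lemma distr_poisson_count:
  assumes "poisson_point_process M \<nu> S" "B \<in> sets borel" "bounded B"
  shows "distr M (count_space UNIV) (\<lambda>\<omega>. card (S \<omega> \<inter> B))
    = density (count_space UNIV) (\<lambda>k. ennreal (measure \<nu> B ^ k / fact k * exp (- measure \<nu> B)))"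
proof (rule measure_eqI_countable[of _ UNIV])
  fix k
  have "emeasure (distr M (count_space UNIV) (\<lambda>\<omega>. card (S \<omega> \<inter> B))) {k} = emeasure M {\<omega>\<in>space M. card (S \<omega> \<inter> B) = k}"
    using poisson_count_measurable[OF assms]
    by (subst emeasure_distr) (auto intro!: arg_cong[of _ _ "emeasure M"])
  also have "\<dots> = ennreal (measure \<nu> B ^ k / fact k * exp (- measure \<nu> B))"
    by (simp only: emeasure_eq_measure poisson_prob[OF assms])
  finally show "emeasure (distr M (count_space UNIV) (\<lambda>\<omega>. card (S \<omega> \<inter> B))) {k}
     = emeasure (density (count_space UNIV) (\<lambda>k. ennreal (measure \<nu> B ^ k / fact k * exp (- measure \<nu> B)))) {k}"
    by (subst emeasure_density) (auto simp: nn_integral_count_space_indicator[symmetric] nn_integral_count_space_finite)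
qed auto

lemma poisson_mean:
  assumes "poisson_point_process M \<nu> S" "B \<in> sets borel" "bounded B"
  shows "(\<integral>\<^sup>+\<omega>. of_nat (card (S \<omega> \<inter> B)) \<partial>M) = ennreal (measure \<nu> B)"
proof -
  define x where "x = measure \<nu> B"
  have x: "0 \<le> x" by (simp add: x_def)
  have "(\<integral>\<^sup>+\<omega>. of_nat (card (S \<omega> \<inter> B)) \<partial>M) = (\<integral>\<^sup>+k. of_nat k \<partial>distr M (count_space UNIV) (\<lambda>\<omega>. card (S \<omega> \<inter> B)))"
    using poisson_count_measurable[OF assms] by (subst nn_integral_distr) auto
  also have "\<dots> = (\<integral>\<^sup>+k. ennreal (x ^ k / fact k * exp (- x)) * of_nat k \<partial>count_space UNIV)"
    unfolding distr_poisson_count[OF assms] x_def by (subst nn_integral_density) auto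
  also have "\<dots> = (\<Sum>k. ennreal (x ^ k / fact k * exp (- x) * real k))"
    unfolding nn_integral_count_space_nat
  proof (rule suminf_cong)
    fix k
    have "ennreal (x ^ k / fact k * exp (- x)) * ennreal (real k) = ennreal (x ^ k / fact k * exp (- x) * real k)"
      by (rule ennreal_mult[symmetric]) (use x in auto)
    then show "ennreal (x ^ k / fact k * exp (- x)) * of_nat k = ennreal (x ^ k / fact k * exp (- x) * real k)"
      by (simp only: ennreal_of_nat_eq_real_of_nat)
  qed
  also have "\<dots> = ennreal x"
  proof (rule suminf_ennreal_eq)
    have "(\<lambda>k. x ^ k / fact k) sums exp x" using exp_converges[of x] by (simp add: scaleR_conv_of_real divide_inverse mult.commute)
    \<comment> \<open>The summand of the mean vanishes at 0, and at k + 1 it is x exp(-x) times the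
      k-th term of the exponential series.\<close>
    then have "(\<lambda>k. x * exp (- x) * (x ^ k / fact k)) sums (x * exp (- x) * exp x)" by (rule sums_mult)
    moreover have "x ^ Suc k / fact (Suc k) * exp (- x) * real (Suc k) = x * exp (- x) * (x ^ k / fact k)" for k
      by (simp add: divide_simps del: of_nat_Suc)
    moreover have "x * exp (- x) * exp x = x" by (simp add: exp_minus)
    ultimately have "(\<lambda>k. x ^ Suc k / fact (Suc k) * exp (- x) * real (Suc k)) sums x" by (simp only:)
    then show "(\<lambda>k. x ^ k / fact k * exp (- x) * real k) sums x" by (subst (asm) sums_Suc_iff) simp
  qed (use x in auto)
  finally show ?thesis by (simp add: x_def)
qed

text \<open>The probability is 1 - (1 + x) exp(-x), and exp(-x) is at least 1 - x. The quadratic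
  order makes the union bound over ever finer cells vanish, which excludes simultaneous
  atoms.\<close>

lemma poisson_two_le:
  assumes "poisson_point_process M \<nu> S" "B \<in> sets borel" "bounded B"
  shows "prob {\<omega>\<in>space M. 2 \<le> card (S \<omega> \<inter> B)} \<le> (measure \<nu> B)\<^sup>2"
proof -
  define x where "x = measure \<nu> B"
  note [measurable] = poisson_count_measurable[OF assms]
  have "{\<omega>\<in>space M. 2 \<le> card (S \<omega> \<inter> B)}
    = space M - ({\<omega>\<in>space M. card (S \<omega> \<inter> B) = 0} \<union> {\<omega>\<in>space M. card (S \<omega> \<inter> B) = 1})" by auto
  also have "prob \<dots> = 1 - prob ({\<omega>\<in>space M. card (S \<omega> \<inter> B) = 0} \<union> {\<omega>\<in>space M. card (S \<omega> \<inter> B) = 1})"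
    by (rule prob_compl) measurable
  also have "prob ({\<omega>\<in>space M. card (S \<omega> \<inter> B) = 0} \<union> {\<omega>\<in>space M. card (S \<omega> \<inter> B) = 1})
    = prob {\<omega>\<in>space M. card (S \<omega> \<inter> B) = 0} + prob {\<omega>\<in>space M. card (S \<omega> \<inter> B) = 1}"
    by (rule finite_measure_Union) auto
  also have "\<dots> = (1 + x) * exp (- x)"
    unfolding poisson_prob[OF assms] x_def by (simp add: algebra_simps)
  also have "1 - (1 + x) * exp (- x) \<le> 1 - (1 + x) * (1 - x)"
    using exp_ge_add_one_self[of "- x"] by (intro diff_left_mono mult_left_mono) (auto simp: x_def)
  finally show ?thesis by (simp add: x_def power2_eq_square algebra_simps)
qed

lemma poisson_null:
  assumes "poisson_point_process M \<nu> S" "B \<in> sets borel" "bounded B" "measure \<nu> B = 0"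
  shows "AE \<omega> in M. card (S \<omega> \<inter> B) = 0"
proof -
  have "prob {\<omega>\<in>space M. card (S \<omega> \<inter> B) = 0} = 1" unfolding poisson_prob[OF assms(1-3)] assms(4) by simp
  then show ?thesis by (rule AE_prob_1[THEN AE_mp]) auto
qed

text \<open>A cylinder event is a condition on independent counts with prescribed marginals, so its
  probability is that of a product measure built from the intensity alone.\<close>

lemma poisson_law_unique:
  assumes S: "poisson_point_process M \<nu> S" and S': "poisson_point_process M \<nu> S'"
  shows "distr M configurations S = distr M configurations S'"
proof (rule measure_eqI_generator_eq[OF Int_stable_count_cylinders])
  show "count_cylinders \<subseteq> Pow (locally_finite_sets :: 'b set set)" by (rule count_cylinders_subset)
  show "sets (distr M configurations S) = sigma_sets locally_finite_sets count_cylinders"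
    "sets (distr M configurations S') = sigma_sets locally_finite_sets count_cylinders"
    by (simp_all add: sets_configurations_cylinders)
  show "range (\<lambda>_::nat. locally_finite_sets) \<subseteq> (count_cylinders :: 'b set set set)"
    unfolding count_cylinders_def by (intro image_subsetI CollectI exI[of _ "{}"]) auto
  show "emeasure (distr M configurations S) locally_finite_sets \<noteq> \<infinity>"
    unfolding infinity_ennreal_def by (intro finite_measure.emeasure_finite prob_space.finite_measure prob_space_distr poisson_measurable[OF S])
  fix X :: "'b set set" assume X: "X \<in> count_cylinders"
  have U: "(UNIV :: 'b set) \<in> sets borel" by simp
  obtain B :: "nat \<Rightarrow> 'b set" and Q where B: "\<forall>m. B m \<in> sets borel \<and> bounded (B m) \<and> B m \<subseteq> (UNIV :: 'b set)" "disjoint_family B"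
    and Q: "\<forall>S\<in>locally_finite_sets. S \<inter> UNIV \<in> X \<longleftrightarrow> Q (\<lambda>m. card (S \<inter> B m))"
    and Qm: "\<forall>(M :: (nat \<Rightarrow> nat) measure) f. (\<forall>m. f m \<in> measurable M (count_space UNIV)) \<longrightarrow> {\<omega> \<in> space M. Q (\<lambda>m. f m \<omega>)} \<in> sets M"
    by (rule cylinder_partition[OF X U])
  have Xm: "X \<in> sets configurations" unfolding sets_configurations_cylinders using X by auto
  let ?P = "PiM UNIV (\<lambda>_::nat. count_space UNIV) :: (nat \<Rightarrow> nat) measure"
  have Qs: "{c \<in> space ?P. Q c} \<in> sets ?P" by (rule Qm[rule_format]) measurable
  have "emeasure (distr M configurations S) X
    = emeasure (PiM UNIV (\<lambda>m. density (count_space UNIV) (\<lambda>k. ennreal (measure \<nu> (B m) ^ k / fact k * exp (- measure \<nu> (B m))))))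
       {c \<in> space ?P. Q c}" if S: "poisson_point_process M \<nu> S" for S
  proof -
    have [measurable]: "(\<lambda>\<omega>. card (S \<omega> \<inter> B m)) \<in> measurable M (count_space UNIV)" for m
      using poisson_count_measurable[OF S] B by blast
    have LF: "S \<omega> \<in> locally_finite_sets" if "\<omega> \<in> space M" for \<omega>
      using measurable_space[OF poisson_measurable[OF S] that] by simp
    have "emeasure (distr M configurations S) X = emeasure M (S -` X \<inter> space M)"
      by (rule emeasure_distr[OF poisson_measurable[OF S] Xm])
    also have "S -` X \<inter> space M = (\<lambda>\<omega> m. card (S \<omega> \<inter> B m)) -` {c \<in> space ?P. Q c} \<inter> space M"
      using Q LF by (auto simp: space_PiM)
    also have "emeasure M \<dots> = emeasure (distr M ?P (\<lambda>\<omega> m. card (S \<omega> \<inter> B m))) {c \<in> space ?P. Q c}"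
      by (rule emeasure_distr[symmetric, OF _ Qs]) (auto intro!: measurable_PiM_single' simp: space_PiM)
    also have "distr M ?P (\<lambda>\<omega> m. card (S \<omega> \<inter> B m)) = PiM UNIV (\<lambda>m. distr M (count_space UNIV) (\<lambda>\<omega>. card (S \<omega> \<inter> B m)))"
      using indep_vars_iff_distr_eq_PiM[where I = UNIV and M' = "\<lambda>_. count_space UNIV" and X = "\<lambda>m \<omega>. card (S \<omega> \<inter> B m)"]
        poisson_indep[OF S, of B] B by (auto simp: restrict_UNIV)
    also have "\<dots> = PiM UNIV (\<lambda>m. density (count_space UNIV) (\<lambda>k. ennreal (measure \<nu> (B m) ^ k / fact k * exp (- measure \<nu> (B m)))))"
      using distr_poisson_count[OF S] B by (intro PiM_cong) auto
    finally show ?thesis .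
  qed
  from this[OF S] this[OF S'] show "emeasure (distr M configurations S) X = emeasure (distr M configurations S') X" by simp
qed auto

text \<open>For a cylinder event, counts in pieces of \<open>H\<close> and the count in the disjoint
  set \<open>B\<close> are different members of one independent family; a Dynkin argument then
  reaches all events of the restriction.\<close>

lemma poisson_restriction_indep:
  assumes S: "poisson_point_process M \<nu> S" and H: "H \<in> sets borel"
    and B: "B \<in> sets borel" "bounded B" "B \<inter> H = {}" and X: "X \<in> sets configurations"
  shows "prob {\<omega>\<in>space M. S \<omega> \<inter> H \<in> X \<and> card (S \<omega> \<inter> B) \<in> K}
    = prob {\<omega>\<in>space M. S \<omega> \<inter> H \<in> X} * prob {\<omega>\<in>space M. card (S \<omega> \<inter> B) \<in> K}"
proof -
  note [measurable] = poisson_measurable[OF S] H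
  have Bm [measurable]: "(\<lambda>\<omega>. card (S \<omega> \<inter> B)) \<in> measurable M (count_space UNIV)"
    by (rule poisson_count_measurable[OF S B(1,2)])
  have Hm [measurable]: "(\<lambda>\<omega>. S \<omega> \<inter> H) \<in> measurable M configurations" by measurable
  have K [measurable]: "{\<omega>\<in>space M. card (S \<omega> \<inter> B) \<in> K} \<in> sets M" by measurable
  have LF: "S \<omega> \<inter> H \<in> locally_finite_sets" if "\<omega> \<in> space M" for \<omega>
    using measurable_space[OF Hm that] by simp
  show ?thesis using Int_stable_count_cylinders count_cylinders_subset X[unfolded sets_configurations_cylinders]
  proof (induction X rule: sigma_sets_induct_disjoint)
    case (basic X)
    obtain B' :: "nat \<Rightarrow> 'b set" and Q where B': "\<forall>m. B' m \<in> sets borel \<and> bounded (B' m) \<and> B' m \<subseteq> H" "disjoint_family B'"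
      and Q: "\<forall>S\<in>locally_finite_sets. S \<inter> H \<in> X \<longleftrightarrow> Q (\<lambda>m. card (S \<inter> B' m))"
      and Qm: "\<forall>(M :: (nat \<Rightarrow> nat) measure) f. (\<forall>m. f m \<in> measurable M (count_space UNIV)) \<longrightarrow> {\<omega> \<in> space M. Q (\<lambda>m. f m \<omega>)} \<in> sets M"
      by (rule cylinder_partition[OF basic H])
    \<comment> \<open>The set \<open>B\<close> takes index 0 and the pieces of \<open>H\<close> are
      moved up by one, so that the two groups of indices are 0 and the positive numbers.\<close>
    define C where "C = case_nat B B'"
    have C: "C m \<in> sets borel \<and> bounded (C m)" for m unfolding C_def using B B' by (cases m) auto
    have "disjoint_family C"
      unfolding disjoint_family_on_def
    proof (intro ballI impI)
      fix m n :: nat assume "m \<noteq> n"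
      then show "C m \<inter> C n = {}"
        using B(3) B'(1) B'(2) unfolding C_def disjoint_family_on_def by (cases m; cases n) (auto; blast)+
    qed
    then have ind: "indep_vars (\<lambda>_. count_space UNIV) (\<lambda>m \<omega>. card (S \<omega> \<inter> C m)) UNIV"
      by (rule poisson_indep[OF S C])
    let ?P = "\<lambda>I. PiM I (\<lambda>_::nat. count_space UNIV) :: (nat \<Rightarrow> nat) measure"
    have iv: "indep_var (?P {0}) (\<lambda>\<omega>. restrict (\<lambda>i. card (S \<omega> \<inter> C i)) {0})
        (?P {1..}) (\<lambda>\<omega>. restrict (\<lambda>i. card (S \<omega> \<inter> C i)) {1..})"
      by (rule indep_var_restrict[OF ind]) auto
    have Q1: "{c \<in> space (?P {1..}). Q (\<lambda>m. c (Suc m))} \<in> sets (?P {1..})" by (rule Qm[rule_format]) measurable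
    have Q0: "{c \<in> space (?P {0}). c 0 \<in> K} \<in> sets (?P {0})" by measurable
    have e1: "(\<lambda>\<omega>. restrict (\<lambda>i. card (S \<omega> \<inter> C i)) {1..}) -` {c \<in> space (?P {1..}). Q (\<lambda>m. c (Suc m))} \<inter> space M
        = {\<omega>\<in>space M. S \<omega> \<inter> H \<in> X}"
      using Q measurable_space[OF poisson_measurable[OF S]] by (auto simp: space_PiM C_def)
    have e0: "(\<lambda>\<omega>. restrict (\<lambda>i. card (S \<omega> \<inter> C i)) {0}) -` {c \<in> space (?P {0}). c 0 \<in> K} \<inter> space M
        = {\<omega>\<in>space M. card (S \<omega> \<inter> B) \<in> K}"
      by (auto simp: space_PiM C_def)
    have "{\<omega>\<in>space M. S \<omega> \<inter> H \<in> X \<and> card (S \<omega> \<inter> B) \<in> K}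
      = {\<omega>\<in>space M. card (S \<omega> \<inter> B) \<in> K} \<inter> {\<omega>\<in>space M. S \<omega> \<inter> H \<in> X}" by auto
    also have "prob \<dots> = prob {\<omega>\<in>space M. card (S \<omega> \<inter> B) \<in> K} * prob {\<omega>\<in>space M. S \<omega> \<inter> H \<in> X}"
      by (rule indep_setD[OF iv[unfolded indep_var_eq, THEN conjunct2]]; intro sigma_sets.Basic CollectI exI conjI)
        (rule e0[symmetric] e1[symmetric] Q0 Q1)+
    finally show ?case by (simp add: mult.commute)
  next
    case empty show ?case by simp
  next
    case (compl X)
    have [measurable]: "X \<in> sets configurations" using compl(1) unfolding sets_configurations_cylinders .
    have 1: "{\<omega>\<in>space M. S \<omega> \<inter> H \<in> locally_finite_sets - X} = space M - {\<omega>\<in>space M. S \<omega> \<inter> H \<in> X}" using LF by auto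
    have 2: "{\<omega>\<in>space M. S \<omega> \<inter> H \<in> locally_finite_sets - X \<and> card (S \<omega> \<inter> B) \<in> K}
      = {\<omega>\<in>space M. card (S \<omega> \<inter> B) \<in> K} - {\<omega>\<in>space M. S \<omega> \<inter> H \<in> X \<and> card (S \<omega> \<inter> B) \<in> K}" using LF by auto
    show ?case unfolding 1 2
      by (subst prob_compl, measurable, subst finite_measure_Diff) (auto simp: compl(2) algebra_simps)
  next
    case (union X)
    have X [measurable]: "X n \<in> sets configurations" for n using union(2) unfolding sets_configurations_cylinders by auto
    let ?E = "\<lambda>n. {\<omega>\<in>space M. S \<omega> \<inter> H \<in> X n}"
    let ?F = "\<lambda>n. {\<omega>\<in>space M. S \<omega> \<inter> H \<in> X n \<and> card (S \<omega> \<inter> B) \<in> K}"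
    have "(\<lambda>n. prob (?E n)) sums prob (\<Union>n. ?E n)"
      using union(1) by (intro finite_measure_UNION) (auto simp: disjoint_family_on_def)
    then have "(\<lambda>n. prob (?E n) * prob {\<omega>\<in>space M. card (S \<omega> \<inter> B) \<in> K}) sums (prob (\<Union>n. ?E n) * prob {\<omega>\<in>space M. card (S \<omega> \<inter> B) \<in> K})"
      by (rule sums_mult2)
    moreover have "(\<lambda>n. prob (?F n)) sums prob (\<Union>n. ?F n)"
      using union(1) by (intro finite_measure_UNION) (auto simp: disjoint_family_on_def)
    ultimately have "prob (\<Union>n. ?F n) = prob (\<Union>n. ?E n) * prob {\<omega>\<in>space M. card (S \<omega> \<inter> B) \<in> K}"
      using union(3) by (auto dest: sums_unique2)
    moreover have "(\<Union>n. ?F n) = {\<omega>\<in>space M. S \<omega> \<inter> H \<in> (\<Union>n. X n) \<and> card (S \<omega> \<inter> B) \<in> K}"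
      "(\<Union>n. ?E n) = {\<omega>\<in>space M. S \<omega> \<inter> H \<in> (\<Union>n. X n)}" by auto
    ultimately show ?case by simp
  qed
qed

end

section \<open>Mixing of product measures\<close>

text \<open>The sets along which the limit holds form a Dynkin system. Domination of all
  \<open>\<nu> n\<close> by the one finite measure \<open>\<mu>\<close> is the key: it justifies
  exchanging the limit with a countable disjoint sum.\<close>

lemma dominated_limit_extension:
  fixes \<mu> :: "'a measure" and \<nu> :: "nat \<Rightarrow> 'a set \<Rightarrow> real"
  assumes "prob_space \<mu>" and G: "Int_stable G" "G \<subseteq> Pow (space \<mu>)" "sets \<mu> = sigma_sets (space \<mu>) G"
    and bounds: "\<And>n X. X \<in> sets \<mu> \<Longrightarrow> 0 \<le> \<nu> n X \<and> \<nu> n X \<le> measure \<mu> X"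
    and add: "\<And>n X. disjoint_family X \<Longrightarrow> range X \<subseteq> sets \<mu> \<Longrightarrow> (\<lambda>i. \<nu> n (X i)) sums \<nu> n (\<Union>i::nat. X i)"
    and top: "(\<lambda>n. \<nu> n (space \<mu>)) \<longlonglongrightarrow> c"
    and basic: "\<And>X. X \<in> G \<Longrightarrow> (\<lambda>n. \<nu> n X) \<longlonglongrightarrow> c * measure \<mu> X"
    and X: "X \<in> sets \<mu>"
  shows "(\<lambda>n. \<nu> n X) \<longlonglongrightarrow> c * measure \<mu> X"
proof -
  interpret prob_space \<mu> by fact
  show ?thesis using G(1,2) X[unfolded G(3)]
  proof (induction rule: sigma_sets_induct_disjoint)
    case (basic X)
    then show ?case by (rule assms(8))
  next
    case empty
    have "\<nu> n {} = 0" for n using bounds[of "{}" n] by simp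
    then show ?case by simp
  next
    case (compl X)
    have X: "X \<in> sets \<mu>" using compl(1) G(3) by simp
    have eq: "\<nu> n (space \<mu> - X) = \<nu> n (space \<mu>) - \<nu> n X" for n
    proof -
      have "(\<lambda>i. \<nu> n (binaryset X (space \<mu> - X) i)) sums \<nu> n (\<Union>i. binaryset X (space \<mu> - X) i)"
      proof (rule add)
        show "disjoint_family (binaryset X (space \<mu> - X))"
          by (auto simp: disjoint_family_on_def binaryset_def)
        show "range (binaryset X (space \<mu> - X)) \<subseteq> sets \<mu>" using X by (auto simp: range_binaryset_eq)
      qed
      moreover have "(\<lambda>i. \<nu> n (binaryset X (space \<mu> - X) i)) sums (\<nu> n X + \<nu> n (space \<mu> - X))"
        using bounds[of "{}" n] by (intro binaryset_sums) auto
      moreover have "(\<Union>i. binaryset X (space \<mu> - X) i) = space \<mu>"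
        using sets.sets_into_space[OF X] by (auto simp: UN_binaryset_eq)
      ultimately show ?thesis by (metis add_diff_cancel_left' sums_unique2)
    qed
    have "(\<lambda>n. \<nu> n (space \<mu>) - \<nu> n X) \<longlonglongrightarrow> c - c * measure \<mu> X"
      by (intro tendsto_diff top compl)
    then show ?case by (simp only: eq prob_compl[OF X] right_diff_distrib mult_1_right)
  next
    case (union X)
    have X: "range X \<subseteq> sets \<mu>" using union(2) G(3) by simp
    have s: "(\<lambda>i. measure \<mu> (X i)) sums measure \<mu> (\<Union>i. X i)"
      by (rule finite_measure_UNION[OF X union(1)])
    have b: "norm (\<nu> n (X i)) \<le> measure \<mu> (X i)" for n i
      using bounds[of "X i" n] X by (auto simp: range_subsetD)
    have "(\<lambda>n. \<Sum>i. \<nu> n (X i)) \<longlonglongrightarrow> (\<Sum>i. c * measure \<mu> (X i))"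
    proof (rule tannerys_theorem[THEN conjunct2, THEN conjunct2, of _ _ _ "\<lambda>i. measure \<mu> (X i)"])
      show "\<forall>\<^sub>F (i, n) in sequentially \<times>\<^sub>F sequentially. norm (\<nu> n (X i)) \<le> measure \<mu> (X i)"
        by (rule always_eventually) (use b in auto)
    qed (use union(3) s in \<open>auto simp: sums_iff\<close>)
    moreover have "(\<Sum>i. \<nu> n (X i)) = \<nu> n (\<Union>i. X i)" for n
      using add[OF union(1) X] by (simp add: sums_iff)
    moreover have "(\<Sum>i. c * measure \<mu> (X i)) = c * measure \<mu> (\<Union>i. X i)"
      using sums_mult[OF s, of c] by (simp add: sums_iff)
    ultimately show ?case by simp
  qed
qed

lemma prod_algebra_Collect:
  assumes "X \<in> prod_algebra UNIV \<kappa>"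
  obtains J E where "finite J" "\<forall>j\<in>J. E j \<in> sets (\<kappa> j)" "X = {w \<in> space (PiM UNIV \<kappa>). \<forall>j\<in>J. w j \<in> E j}"
proof -
  from assms obtain J E where J: "X = prod_emb UNIV \<kappa> J (\<Pi>\<^sub>E j\<in>J. E j)" "finite J" "\<forall>i\<in>J. E i \<in> sets (\<kappa> i)"
    by (auto simp: prod_algebra_def)
  have "X = {w \<in> space (PiM UNIV \<kappa>). \<forall>j\<in>J. w j \<in> E j}"
    unfolding J(1) prod_emb_def by (auto simp: space_PiM PiE_iff)
  with J show ?thesis by (intro that[of J E]) auto
qed

lemma (in product_prob_space) measure_PiM_Collect:
  assumes "J \<subseteq> I" "finite J" "\<And>i. i \<in> J \<Longrightarrow> X i \<in> sets (M i)"
  shows "measure (Pi\<^sub>M I M) {x\<in>space (Pi\<^sub>M I M). \<forall>i\<in>J. x i \<in> X i} = (\<Prod>i\<in>J. measure (M i) (X i))"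
  using emeasure_PiM_Collect[OF assms]
  unfolding emeasure_eq_measure M.emeasure_eq_measure
  by (simp add: prod_ennreal measure_nonneg prod_nonneg)

lemma PiM_reindex:
  assumes "\<And>i. prob_space (\<kappa> i)" "inj f" "\<And>i. \<kappa> (f i) = \<kappa> i"
  shows "(\<lambda>w j. w (f j)) \<in> measurable (PiM UNIV \<kappa>) (PiM UNIV \<kappa>)"
    and "distr (PiM UNIV \<kappa>) (PiM UNIV \<kappa>) (\<lambda>w j. w (f j)) = PiM UNIV \<kappa>"
proof -
  have "(\<lambda>w. w (f j)) \<in> measurable (PiM UNIV \<kappa>) (\<kappa> j)" for j
    using measurable_component_singleton[of "f j" UNIV \<kappa>] assms(3) by simp
  then show "(\<lambda>w j. w (f j)) \<in> measurable (PiM UNIV \<kappa>) (PiM UNIV \<kappa>)"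
  proof (intro measurable_PiM_single')
    have "w (f j) \<in> space (\<kappa> j)" if "w \<in> space (PiM UNIV \<kappa>)" for w j
    proof -
      have "w (f j) \<in> space (\<kappa> (f j))" using that by (auto simp: space_PiM PiE_iff)
      then show ?thesis by (simp only: assms(3))
    qed
    then show "(\<lambda>w j. w (f j)) \<in> space (PiM UNIV \<kappa>) \<rightarrow> (\<Pi>\<^sub>E i\<in>UNIV. space (\<kappa> i))" by auto
  qed
  show "distr (PiM UNIV \<kappa>) (PiM UNIV \<kappa>) (\<lambda>w j. w (f j)) = PiM UNIV \<kappa>"
    using distr_PiM_reindex[of UNIV \<kappa> f UNIV] assms by (simp add: restrict_UNIV)
qed

text \<open>Two cylinder events depend on finitely many coordinates each; once \<open>f n\<close>
  has moved those of one off those of the other, they are exactly independent. Invariance of the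
  product under \<open>f n\<close> supplies the domination required for the extension to all events,
  which is made one argument at a time.\<close>

theorem PiM_mixing:
  fixes \<kappa> :: "'i \<Rightarrow> 'a measure" and f :: "nat \<Rightarrow> 'i \<Rightarrow> 'i"
  assumes \<kappa>: "\<And>i. prob_space (\<kappa> i)" and f: "\<And>n. inj (f n)" "\<And>n i. \<kappa> (f n i) = \<kappa> i"
    and escape: "\<And>J J'. finite J \<Longrightarrow> finite J' \<Longrightarrow> \<forall>\<^sub>F n in sequentially. f n ` J' \<inter> J = {}"
    and XY: "X \<in> sets (PiM UNIV \<kappa>)" "Y \<in> sets (PiM UNIV \<kappa>)"
  shows "(\<lambda>n. measure (PiM UNIV \<kappa>) (X \<inter> {w \<in> space (PiM UNIV \<kappa>). (\<lambda>j. w (f n j)) \<in> Y}))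
    \<longlonglongrightarrow> measure (PiM UNIV \<kappa>) X * measure (PiM UNIV \<kappa>) Y"
proof -
  let ?P = "PiM UNIV \<kappa>"
  interpret product_prob_space \<kappa> UNIV by (rule product_prob_spaceI) (rule \<kappa>)
  define T where "T n Y = {w \<in> space ?P. (\<lambda>j. w (f n j)) \<in> Y}" for n Y
  have reindex: "(\<lambda>w j. w (f n j)) \<in> measurable ?P ?P" "distr ?P ?P (\<lambda>w j. w (f n j)) = ?P" for n
    by (rule PiM_reindex[where f = "f n"]; fact \<kappa> f)+
  have T_eq: "T n Y = (\<lambda>w j. w (f n j)) -` Y \<inter> space ?P" for n Y by (auto simp: T_def)
  have T: "T n Y \<in> sets ?P" "measure ?P (T n Y) = measure ?P Y" if "Y \<in> sets ?P" for n Y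
  proof -
    show "T n Y \<in> sets ?P" unfolding T_eq by (rule measurable_sets[OF reindex(1) that])
    show "measure ?P (T n Y) = measure ?P Y"
      unfolding T_eq by (subst (2) reindex(2)[of n, symmetric], subst measure_distr[OF reindex(1) that]) simp
  qed
  have T_UN: "T n (\<Union>i. Y i) = (\<Union>i. T n (Y i))" for n and Y :: "nat \<Rightarrow> _" by (auto simp: T_def)
  have T_space: "T n (space ?P) = space ?P" for n
    using measurable_space[OF reindex(1)[of n]] by (auto simp: T_def)
  have G: "Int_stable (prod_algebra UNIV \<kappa>)" "prod_algebra UNIV \<kappa> \<subseteq> Pow (space ?P)"
    "sets ?P = sigma_sets (space ?P) (prod_algebra UNIV \<kappa>)"
    using prod_algebra_sets_into_space[of UNIV \<kappa>] by (simp_all add: Int_stable_prod_algebra sets_PiM space_PiM)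
  have ps: "prob_space ?P" by (rule prob_space_PiM[OF \<kappa>])
  have basic: "(\<lambda>n. measure ?P (X \<inter> T n Y)) \<longlonglongrightarrow> measure ?P X * measure ?P Y"
    if X: "X \<in> prod_algebra UNIV \<kappa>" and Y: "Y \<in> prod_algebra UNIV \<kappa>" for X Y
  proof -
    obtain J E where J: "finite J" "\<forall>j\<in>J. E j \<in> sets (\<kappa> j)" "X = {w \<in> space ?P. \<forall>j\<in>J. w j \<in> E j}"
      using X by (rule prod_algebra_Collect)
    obtain J' E' where J': "finite J'" "\<forall>j\<in>J'. E' j \<in> sets (\<kappa> j)" "Y = {w \<in> space ?P. \<forall>j\<in>J'. w j \<in> E' j}"
      using Y by (rule prod_algebra_Collect)
    have "\<forall>\<^sub>F n in sequentially. measure ?P (X \<inter> T n Y) = measure ?P X * measure ?P Y"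
      using escape[OF J(1) J'(1)]
    proof eventually_elim
      case (elim n)
      \<comment> \<open>Joins the two families of constraints into one over the disjoint union of
        the index sets; on the second part the injective \<open>f n\<close> is inverted.\<close>
      define Z where "Z j = (if j \<in> J then E j else E' (inv (f n) j))" for j
      have Z1: "Z j = E j" if "j \<in> J" for j using that by (simp add: Z_def)
      have Z2: "Z (f n j) = E' j" if "j \<in> J'" for j
        using that elim f(1)[of n] by (auto simp: Z_def)
      have "X \<inter> T n Y = {w \<in> space ?P. \<forall>j\<in>J \<union> f n ` J'. w j \<in> Z j}"
        using Z1 Z2 measurable_space[OF reindex(1)[of n]] by (auto simp: J(3) J'(3) T_def ball_Un)
      also have "measure ?P \<dots> = (\<Prod>j\<in>J \<union> f n ` J'. measure (\<kappa> j) (Z j))"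
        using J J' f(2)[of n] by (intro measure_PiM_Collect) (auto simp: Z1 Z2)
      also have "\<dots> = (\<Prod>j\<in>J. measure (\<kappa> j) (Z j)) * (\<Prod>j\<in>f n ` J'. measure (\<kappa> j) (Z j))"
        using J(1) J'(1) elim by (intro prod.union_disjoint) auto
      also have "(\<Prod>j\<in>J. measure (\<kappa> j) (Z j)) = measure ?P X"
        unfolding J(3) using J by (subst measure_PiM_Collect) (auto simp: Z1)
      also have "(\<Prod>j\<in>f n ` J'. measure (\<kappa> j) (Z j)) = (\<Prod>j\<in>J'. measure (\<kappa> j) (E' j))"
        by (subst prod.reindex) (use f in \<open>auto simp: Z2 inj_on_def inj_def\<close>)
      also have "\<dots> = measure ?P Y"
        unfolding J'(3) using J' by (subst measure_PiM_Collect) auto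
      finally show ?case .
    qed
    then show ?thesis by (rule tendsto_eventually)
  qed
  \<comment> \<open>Extension in the second event with a cylinder as first event. The dominating
    measure is that of \<open>Y\<close>, because \<open>T n\<close> preserves it.\<close>
  have *: "(\<lambda>n. measure ?P (X \<inter> T n Y)) \<longlonglongrightarrow> measure ?P X * measure ?P Y"
    if X: "X \<in> prod_algebra UNIV \<kappa>" and Y: "Y \<in> sets ?P" for X Y
  proof (rule dominated_limit_extension[OF ps G _ _ _ _ Y])
    have Xs: "X \<in> sets ?P" using X G(3) by (auto intro: sigma_sets.Basic)
    fix n Y assume Y: "Y \<in> sets ?P"
    have "measure ?P (X \<inter> T n Y) \<le> measure ?P (T n Y)"
      using T(1)[OF Y] Xs by (intro finite_measure_mono) auto
    then show "0 \<le> measure ?P (X \<inter> T n Y) \<and> measure ?P (X \<inter> T n Y) \<le> measure ?P Y" using T(2)[OF Y] by simp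
  next
    have Xs: "X \<in> sets ?P" using X G(3) by (auto intro: sigma_sets.Basic)
    fix n and Y :: "nat \<Rightarrow> _" assume Y: "disjoint_family Y" "range Y \<subseteq> sets ?P"
    have "(\<lambda>i. measure ?P (X \<inter> T n (Y i))) sums measure ?P (\<Union>i. X \<inter> T n (Y i))"
    proof (rule finite_measure_UNION)
      show "range (\<lambda>i. X \<inter> T n (Y i)) \<subseteq> sets ?P" using Y(2) Xs T(1) by (auto simp: range_subsetD)
      show "disjoint_family (\<lambda>i. X \<inter> T n (Y i))" using Y(1) by (auto simp: disjoint_family_on_def T_def)
    qed
    then show "(\<lambda>i. measure ?P (X \<inter> T n (Y i))) sums measure ?P (X \<inter> T n (\<Union>i. Y i))" by (simp add: T_UN)
  next
    have "X \<inter> T n (space ?P) = X" for n using X G(2) T_space by auto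
    then show "(\<lambda>n. measure ?P (X \<inter> T n (space ?P))) \<longlonglongrightarrow> measure ?P X" by simp
  qed (rule basic[OF X])
  \<comment> \<open>Extension in the first event, now for an arbitrary second one; here the
    domination by the measure of \<open>X\<close> is immediate.\<close>
  have "(\<lambda>n. measure ?P (X \<inter> T n Y)) \<longlonglongrightarrow> measure ?P Y * measure ?P X"
  proof (rule dominated_limit_extension[OF ps G _ _ _ _ XY(1)])
    fix n X assume "X \<in> sets ?P"
    then show "0 \<le> measure ?P (X \<inter> T n Y) \<and> measure ?P (X \<inter> T n Y) \<le> measure ?P X"
      using T(1)[OF XY(2)] by (auto intro!: finite_measure_mono)
  next
    fix n and X :: "nat \<Rightarrow> _" assume X: "disjoint_family X" "range X \<subseteq> sets ?P"
    have "(\<lambda>i. measure ?P (X i \<inter> T n Y)) sums measure ?P (\<Union>i. X i \<inter> T n Y)"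
    proof (rule finite_measure_UNION)
      show "range (\<lambda>i. X i \<inter> T n Y) \<subseteq> sets ?P" using X(2) T(1)[OF XY(2)] by (auto simp: range_subsetD)
      show "disjoint_family (\<lambda>i. X i \<inter> T n Y)" using X(1) by (auto simp: disjoint_family_on_def)
    qed
    then show "(\<lambda>i. measure ?P (X i \<inter> T n Y)) sums measure ?P ((\<Union>i. X i) \<inter> T n Y)" by simp
  next
    have "space ?P \<inter> T n Y = T n Y" for n by (auto simp: T_def)
    then show "(\<lambda>n. measure ?P (space ?P \<inter> T n Y)) \<longlonglongrightarrow> measure ?P Y" using T(2)[OF XY(2)] by simp
  next
    fix X assume "X \<in> prod_algebra UNIV \<kappa>"
    from *[OF this XY(2)] show "(\<lambda>n. measure ?P (X \<inter> T n Y)) \<longlonglongrightarrow> measure ?P Y * measure ?P X"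
      by (simp add: mult.commute)
  qed
  then show ?thesis unfolding T_def by (simp add: mult.commute)
qed

section \<open>The field of driving processes\<close>

text \<open>Lifts independence of \<open>H\<close> and \<open>B\<close> from one factor to the
  field. In a cylinder event only the factor at \<open>i\<close> interacts with the count; all
  others split off in the product.\<close>

lemma PiM_restriction_indep:
  fixes \<kappa> :: "'i \<Rightarrow> 'e::euclidean_space set measure"
  assumes \<kappa>: "\<And>i. prob_space (\<kappa> i)" "\<And>i. sets (\<kappa> i) = sets configurations"
    and H: "H \<in> sets borel" and B: "B \<in> sets borel" "bounded B"
    and indep: "\<And>X. X \<in> sets configurations \<Longrightarrow>
      measure (\<kappa> i) {S \<in> locally_finite_sets. S \<inter> H \<in> X \<and> card (S \<inter> B) \<in> K}
       = measure (\<kappa> i) {S \<in> locally_finite_sets. S \<inter> H \<in> X} * measure (\<kappa> i) {S \<in> locally_finite_sets. card (S \<inter> B) \<in> K}"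
    and X: "X \<in> sets (PiM UNIV \<kappa>)"
  shows "measure (PiM UNIV \<kappa>) {w \<in> space (PiM UNIV \<kappa>). (\<lambda>j. w j \<inter> H) \<in> X \<and> card (w i \<inter> B) \<in> K}
    = measure (PiM UNIV \<kappa>) {w \<in> space (PiM UNIV \<kappa>). (\<lambda>j. w j \<inter> H) \<in> X}
      * measure (PiM UNIV \<kappa>) {w \<in> space (PiM UNIV \<kappa>). card (w i \<inter> B) \<in> K}"
proof -
  let ?P = "PiM UNIV \<kappa>"
  interpret product_prob_space \<kappa> UNIV by (rule product_prob_spaceI) (rule \<kappa>)
  have sp: "space (\<kappa> j) = locally_finite_sets" for j
    using sets_eq_imp_space_eq[OF \<kappa>(2)] by simp
  have mc: "measurable ?P (\<kappa> j) = measurable ?P configurations" for j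
    by (rule measurable_cong_sets[OF refl \<kappa>(2)])
  have comp: "(\<lambda>w. w j) \<in> measurable ?P configurations" for j
    using measurable_component_singleton[of j UNIV \<kappa>] unfolding mc by simp
  have cut: "(\<lambda>w j. w j \<inter> H) \<in> measurable ?P ?P"
  proof (rule measurable_PiM_single')
    fix j
    show "(\<lambda>w. w j \<inter> H) \<in> measurable ?P (\<kappa> j)"
      unfolding mc by (rule measurable_compose[OF comp measurable_restriction[OF H]])
  qed (auto simp: space_PiM sp PiE_iff intro: locally_finite_sets_subset[OF _ Int_lower1])
  have cnt: "(\<lambda>w. card (w i \<inter> B)) \<in> measurable ?P (count_space UNIV)"
    by (rule measurable_compose[OF comp measurable_card[OF B]])
  have E_sets: "{S \<in> locally_finite_sets. S \<inter> H \<in> X} \<in> sets configurations"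
      "{S \<in> locally_finite_sets. S \<inter> H \<in> X \<and> card (S \<inter> B) \<in> K} \<in> sets configurations"
      "{S \<in> locally_finite_sets. card (S \<inter> B) \<in> K} \<in> sets configurations"
    if "X \<in> sets configurations" for X
  proof -
    note [measurable] = measurable_restriction[OF H] measurable_card[OF B] that
    have "{S \<in> space configurations. S \<inter> H \<in> X} \<in> sets configurations" by measurable
    moreover have "{S \<in> space configurations. card (S \<inter> B) \<in> K} \<in> sets configurations" by measurable
    moreover have "{S \<in> locally_finite_sets. S \<inter> H \<in> X \<and> card (S \<inter> B) \<in> K}
      = {S \<in> space configurations. S \<inter> H \<in> X} \<inter> {S \<in> space configurations. card (S \<inter> B) \<in> K}" by auto
    ultimately show "{S \<in> locally_finite_sets. S \<inter> H \<in> X} \<in> sets configurations"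
      "{S \<in> locally_finite_sets. S \<inter> H \<in> X \<and> card (S \<inter> B) \<in> K} \<in> sets configurations"
      "{S \<in> locally_finite_sets. card (S \<inter> B) \<in> K} \<in> sets configurations" by auto
  qed
  define C where "C = {w \<in> space ?P. card (w i \<inter> B) \<in> K}"
  have C: "C \<in> sets ?P" using measurable_sets[OF cnt, of K] by (simp add: C_def vimage_def Int_def conj_commute)
  define U where "U X = {w \<in> space ?P. (\<lambda>j. w j \<inter> H) \<in> X}" for X
  have U: "U X \<in> sets ?P" if "X \<in> sets ?P" for X
    using measurable_sets[OF cut that] by (simp add: U_def vimage_def Int_def conj_commute)
  have G: "Int_stable (prod_algebra UNIV \<kappa>)" "prod_algebra UNIV \<kappa> \<subseteq> Pow (space ?P)"
    "sets ?P = sigma_sets (space ?P) (prod_algebra UNIV \<kappa>)"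
    using prod_algebra_sets_into_space[of UNIV \<kappa>] by (simp_all add: Int_stable_prod_algebra sets_PiM space_PiM)
  have "measure ?P (U X \<inter> C) = measure ?P (U X) * measure ?P C"
    using G(1,2) X[unfolded G(3)]
  proof (induction rule: sigma_sets_induct_disjoint)
    case (basic X)
    obtain J E where J: "finite J" "\<forall>j\<in>J. E j \<in> sets (\<kappa> j)" "X = {w \<in> space ?P. \<forall>j\<in>J. w j \<in> E j}"
      using basic by (rule prod_algebra_Collect)
    \<comment> \<open>Padding with the whole space lets the coordinate \<open>i\<close> be added to
      the index set even if the event does not constrain it.\<close>
    define F where "F j = (if j \<in> J then E j else locally_finite_sets)" for j
    have F: "F j \<in> sets configurations" for j
      using J(2) \<kappa>(2) sets.top[of configurations] by (auto simp: F_def)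
    define V where "V j = {S \<in> locally_finite_sets. S \<inter> H \<in> F j}" for j
    define W where "W j = (if j = i then {S \<in> locally_finite_sets. S \<inter> H \<in> F j \<and> card (S \<inter> B) \<in> K} else V j)" for j
    have VW: "V j \<in> sets (\<kappa> j)" "W j \<in> sets (\<kappa> j)" for j
      using E_sets[OF F] unfolding V_def W_def \<kappa>(2) by auto
    let ?J = "insert i J"
    have lf: "w j \<in> locally_finite_sets" "w j \<inter> H \<in> locally_finite_sets" if "w \<in> space ?P" for w j
      using that locally_finite_sets_subset[OF _ Int_lower1] by (auto simp: space_PiM sp PiE_iff)
    have cutin: "(\<lambda>j. w j \<inter> H) \<in> space ?P" if "w \<in> space ?P" for w using measurable_space[OF cut that] .
    have UX: "U X = {w \<in> space ?P. \<forall>j\<in>?J. w j \<in> V j}"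
      using lf cutin unfolding U_def J(3) V_def F_def by auto
    have UXC: "U X \<inter> C = {w \<in> space ?P. \<forall>j\<in>?J. w j \<in> W j}"
      unfolding UX using lf by (auto simp: C_def W_def V_def split: if_splits)
    have "measure ?P (U X \<inter> C) = (\<Prod>j\<in>?J. measure (\<kappa> j) (W j))"
      unfolding UXC using J(1) VW by (intro measure_PiM_Collect) auto
    also have "\<dots> = measure (\<kappa> i) (W i) * (\<Prod>j\<in>J - {i}. measure (\<kappa> j) (W j))"
      using J(1) by (simp add: prod.insert_remove)
    also have "(\<Prod>j\<in>J - {i}. measure (\<kappa> j) (W j)) = (\<Prod>j\<in>J - {i}. measure (\<kappa> j) (V j))"
      by (intro prod.cong) (auto simp: W_def)
    also have "measure (\<kappa> i) (W i) = measure (\<kappa> i) (V i) * measure (\<kappa> i) {S \<in> locally_finite_sets. card (S \<inter> B) \<in> K}"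
      using indep[OF F[of i]] by (simp add: W_def V_def)
    also have "measure (\<kappa> i) {S \<in> locally_finite_sets. card (S \<inter> B) \<in> K} = measure ?P C"
    proof -
      have "C = {w \<in> space ?P. \<forall>j\<in>{i}. w j \<in> {S \<in> locally_finite_sets. card (S \<inter> B) \<in> K}}"
        using lf by (auto simp: C_def)
      also have "measure ?P \<dots> = (\<Prod>j\<in>{i}. measure (\<kappa> j) {S \<in> locally_finite_sets. card (S \<inter> B) \<in> K})"
        using E_sets(3)[OF sets.top] unfolding \<kappa>(2)[symmetric] by (intro measure_PiM_Collect) (auto simp: \<kappa>(2))
      finally show ?thesis by simp
    qed
    finally have "measure ?P (U X \<inter> C) = (measure (\<kappa> i) (V i) * (\<Prod>j\<in>J - {i}. measure (\<kappa> j) (V j))) * measure ?P C"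
      by (simp add: mult_ac)
    also have "measure (\<kappa> i) (V i) * (\<Prod>j\<in>J - {i}. measure (\<kappa> j) (V j)) = (\<Prod>j\<in>?J. measure (\<kappa> j) (V j))"
      using J(1) by (simp add: prod.insert_remove)
    also have "\<dots> = measure ?P (U X)"
      unfolding UX using J(1) VW by (intro measure_PiM_Collect[symmetric]) auto
    finally show ?case .
  next
    case empty
    then show ?case by (simp add: U_def)
  next
    case (compl X)
    have X: "X \<in> sets ?P" using compl(1) G(3) by simp
    have 1: "U (space ?P - X) = space ?P - U X" using measurable_space[OF cut] by (auto simp: U_def)
    have 2: "(space ?P - U X) \<inter> C = C - (U X \<inter> C)" using sets.sets_into_space[OF C] by auto
    show ?case unfolding 1 2 using U[OF X] C compl(2)
      by (subst finite_measure_Diff) (auto simp: prob_compl algebra_simps)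
  next
    case (union X)
    have X: "X n \<in> sets ?P" for n using union(2) G(3) by auto
    have "(\<lambda>n. measure ?P (U (X n))) sums measure ?P (\<Union>n. U (X n))"
      using union(1) U[OF X] by (intro finite_measure_UNION) (auto simp: disjoint_family_on_def U_def)
    then have "(\<lambda>n. measure ?P (U (X n)) * measure ?P C) sums (measure ?P (\<Union>n. U (X n)) * measure ?P C)"
      by (rule sums_mult2)
    moreover have "(\<lambda>n. measure ?P (U (X n) \<inter> C)) sums measure ?P (\<Union>n. U (X n) \<inter> C)"
      using union(1) U[OF X] C by (intro finite_measure_UNION) (auto simp: disjoint_family_on_def U_def)
    moreover have "(\<Union>n. U (X n)) = U (\<Union>n. X n)" by (auto simp: U_def)
    ultimately show ?case using union(3) by (auto dest: sums_unique2)
  qed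
  moreover have "U X \<inter> C = {w \<in> space ?P. (\<lambda>j. w j \<inter> H) \<in> X \<and> card (w i \<inter> B) \<in> K}" by (auto simp: U_def C_def)
  ultimately show ?thesis unfolding U_def C_def by simp
qed

text \<open>Arrival processes are placed on the line \<open>u = 0\<close>, so that all driving processes have one type.\<close>

definition embed_line :: "real set \<Rightarrow> (real \<times> real) set" where
  "embed_line \<alpha> = (\<lambda>t. (t, 0)) ` \<alpha>"

lemma card_embed_line: "card (embed_line \<alpha> \<inter> B) = card (\<alpha> \<inter> {t. (t, 0) \<in> B})"
proof -
  have "embed_line \<alpha> \<inter> B = (\<lambda>t. (t, 0)) ` (\<alpha> \<inter> {t. (t, 0) \<in> B})" by (auto simp: embed_line_def)
  then show ?thesis by (simp add: card_image inj_on_def)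
qed

lemma measurable_embed_line: "embed_line \<in> measurable configurations configurations"
proof (rule measurable_configurationsI)
  have bdd: "bounded {t. (t, 0) \<in> B}" if "bounded B" for B :: "(real \<times> real) set"
    by (rule bounded_subset[OF bounded_fst[OF that]]) force
  show "embed_line \<alpha> \<in> locally_finite_sets" if "\<alpha> \<in> space configurations" for \<alpha>
    unfolding locally_finite_sets_def
  proof clarify
    fix B :: "(real \<times> real) set" assume "bounded B"
    have "embed_line \<alpha> \<inter> B = (\<lambda>t. (t, 0)) ` (\<alpha> \<inter> {t. (t, 0) \<in> B})" by (auto simp: embed_line_def)
    then show "finite (embed_line \<alpha> \<inter> B)"
      using that bdd[OF \<open>bounded B\<close>] by (auto simp: locally_finite_sets_def)
  qed
  fix B :: "(real \<times> real) set" assume B: "B \<in> sets borel" "bounded B"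
  have "(\<lambda>t::real. (t, 0::real)) -` B \<inter> space borel \<in> sets borel"
    by (rule measurable_sets[OF _ B(1)]) (simp add: borel_measurable_continuous_onI continuous_intros)
  then have "{t::real. (t, 0::real) \<in> B} \<in> sets borel" by (simp add: vimage_def)
  then show "(\<lambda>\<alpha>. card (embed_line \<alpha> \<inter> B)) \<in> measurable configurations (count_space UNIV)"
    unfolding card_embed_line by (intro measurable_card bdd B)
qed

text \<open>Independence of the driving processes is assumed for the sigma-algebras generated by
  their counts. The process is measurable with respect to that sigma-algebra, so the same
  independence covers all measurable functionals of it.\<close>

lemma (in prob_space) preimages_point_process_events:
  assumes "\<And>\<omega>. \<omega> \<in> space M \<Longrightarrow> S \<omega> \<in> locally_finite_sets"
    and g: "g \<in> measurable configurations N" and X: "X \<in> sets N"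
  shows "(\<lambda>\<omega>. g (S \<omega>)) -` X \<inter> space M \<in> point_process_events M S"
proof -
  define \<F> where "\<F> = {{\<omega>\<in>space M. card (S \<omega> \<inter> B) = k} | B k. B \<in> sets borel \<and> bounded B}"
  have sub: "\<F> \<subseteq> Pow (space M)" by (auto simp: \<F>_def)
  have "S \<in> measurable (sigma (space M) \<F>) configurations"
  proof (rule measurable_configurationsI)
    fix B assume B: "B \<in> sets borel" "bounded (B :: 'b set)"
    have "(\<lambda>\<omega>. card (S \<omega> \<inter> B)) -` {k} \<inter> space (sigma (space M) \<F>) \<in> sets (sigma (space M) \<F>)" for k
    proof -
      have "(\<lambda>\<omega>. card (S \<omega> \<inter> B)) -` {k} \<inter> space (sigma (space M) \<F>) = {\<omega>\<in>space M. card (S \<omega> \<inter> B) = k}"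
        using space_measure_of[OF sub] by auto
      also have "\<dots> \<in> sets (sigma (space M) \<F>)"
        unfolding sets_measure_of[OF sub] by (rule sigma_sets.Basic) (use B in \<open>auto simp: \<F>_def\<close>)
      finally show ?thesis .
    qed
    then show "(\<lambda>\<omega>. card (S \<omega> \<inter> B)) \<in> measurable (sigma (space M) \<F>) (count_space UNIV)"
      by (subst measurable_count_space_eq2_countable) auto
  qed (use assms(1) space_measure_of[OF sub] in auto)
  from measurable_sets[OF measurable_compose[OF this g] X]
  show ?thesis
    unfolding point_process_events_def \<F>_def[symmetric] using space_measure_of[OF sub] sets_measure_of[OF sub] by simp
qed

definition driving_field ::
  "('i \<Rightarrow> 'w \<Rightarrow> real set) \<Rightarrow> ('i \<Rightarrow> 'w \<Rightarrow> (real \<times> real) set) \<Rightarrow> 'w \<Rightarrow> 'i + 'i \<Rightarrow> (real \<times> real) set" where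
  "driving_field A D \<omega> = case_sum (\<lambda>i. embed_line (A i \<omega>)) (\<lambda>i. D i \<omega>)"

text \<open>Independence gives a product law; uniqueness of the Poisson law makes the factors depend
  on the kind of process and not on the site. The latter is what translation invariance
  needs.\<close>

lemma (in prob_space) distr_driving_field:
  fixes A :: "int ^ 'd::finite \<Rightarrow> 'a \<Rightarrow> real set"
  assumes dp: "driving_processes M lam A D"
  shows "driving_field A D \<in> measurable M (PiM UNIV (\<lambda>_. configurations))"
    and "distr M (PiM UNIV (\<lambda>_. configurations)) (driving_field A D)
      = PiM UNIV (case_sum (\<lambda>_. distr M configurations (\<lambda>\<omega>. embed_line (A 0 \<omega>))) (\<lambda>_. distr M configurations (D 0)))"
proof -
  have A: "poisson_point_process M (density lborel (\<lambda>_. ennreal lam)) (A i)"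
    and D: "poisson_point_process M (density lborel (indicator (UNIV \<times> {0..1}))) (D i)" for i
    using dp unfolding driving_processes_def by auto
  define X where "X i \<omega> = driving_field A D \<omega> i" for i \<omega>
  have X_Inl: "X (Inl i) = (\<lambda>\<omega>. embed_line (A i \<omega>))" and X_Inr: "X (Inr i) = D i" for i
    by (auto simp: X_def driving_field_def)
  have X: "X i \<in> measurable M configurations" for i
    using measurable_compose[OF poisson_measurable[OF A] measurable_embed_line] poisson_measurable[OF D]
    by (cases i) (simp_all add: X_Inl X_Inr)
  show "driving_field A D \<in> measurable M (PiM UNIV (\<lambda>_. configurations))"
  proof (rule measurable_PiM_single')
    have "X i \<omega> \<in> locally_finite_sets" if "\<omega> \<in> space M" for i \<omega>
      using measurable_space[OF X that] by simp
    then show "driving_field A D \<in> space M \<rightarrow> (\<Pi>\<^sub>E i\<in>UNIV. space configurations)" by (auto simp: X_def)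
  qed (use X in \<open>simp add: X_def[abs_def]\<close>)
  have "indep_sets (\<lambda>i. {X i -` Y \<inter> space M | Y. Y \<in> sets configurations}) UNIV"
  proof (rule indep_sets_mono_sets)
    show "indep_sets (case_sum (\<lambda>i. point_process_events M (A i)) (\<lambda>i. point_process_events M (D i))) UNIV"
      using dp unfolding driving_processes_def by auto
    have lf: "S \<omega> \<in> locally_finite_sets" if "poisson_point_process M \<nu> S" "\<omega> \<in> space M" for \<nu> S \<omega>
      using that unfolding poisson_point_process_def locally_finite_sets_def by auto
    fix i :: "int ^ 'd + int ^ 'd"
    show "{X i -` Y \<inter> space M | Y. Y \<in> sets configurations}
      \<subseteq> case_sum (\<lambda>i. point_process_events M (A i)) (\<lambda>i. point_process_events M (D i)) i"
    proof (cases i)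
      case (Inl j)
      then show ?thesis
        using preimages_point_process_events[OF lf[OF A] measurable_embed_line] by (auto simp: X_Inl)
    next
      case (Inr j)
      then show ?thesis
        using preimages_point_process_events[OF lf[OF D] measurable_ident] by (auto simp: X_Inr)
    qed
  qed
  then have "indep_vars (\<lambda>_. configurations) X UNIV" unfolding indep_vars_def2 using X by auto
  then have "distr M (PiM UNIV (\<lambda>_. configurations)) (driving_field A D) = PiM UNIV (\<lambda>i. distr M configurations (X i))"
    using indep_vars_iff_distr_eq_PiM[where I = UNIV and M' = "\<lambda>_. configurations" and X = X] X
    by (simp add: restrict_UNIV X_def[abs_def])
  also have "\<dots> = PiM UNIV (case_sum (\<lambda>_. distr M configurations (\<lambda>\<omega>. embed_line (A 0 \<omega>))) (\<lambda>_. distr M configurations (D 0)))"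
  proof (intro PiM_cong refl)
    fix i :: "int ^ 'd + int ^ 'd"
    have "distr M configurations (\<lambda>\<omega>. embed_line (A j \<omega>)) = distr M configurations (\<lambda>\<omega>. embed_line (A 0 \<omega>))" for j
      using distr_distr[OF measurable_embed_line poisson_measurable[OF A[of j]]]
        distr_distr[OF measurable_embed_line poisson_measurable[OF A[of 0]]] poisson_law_unique[OF A[of j] A[of 0]]
      by (simp add: comp_def)
    then show "distr M configurations (X i) = case_sum (\<lambda>_. distr M configurations (\<lambda>\<omega>. embed_line (A 0 \<omega>))) (\<lambda>_. distr M configurations (D 0)) i"
      using poisson_law_unique[OF D D] by (cases i) (auto simp: X_Inl X_Inr)
  qed
  finally show "distr M (PiM UNIV (\<lambda>_. configurations)) (driving_field A D)
      = PiM UNIV (case_sum (\<lambda>_. distr M configurations (\<lambda>\<omega>. embed_line (A 0 \<omega>))) (\<lambda>_. distr M configurations (D 0)))" .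
qed

section \<open>Countable sums\<close>

text \<open>Nonnegative sums become integrals over the counting measure, for which Tonelli and
  measurability are available. The second identity holds without summability: both sides are then
  0.\<close>

lemma infsum_eq_nn_integral:
  fixes f :: "'b \<Rightarrow> real"
  assumes "\<And>j. j \<in> S \<Longrightarrow> 0 \<le> f j"
  shows "f summable_on S \<longleftrightarrow> (\<integral>\<^sup>+j. ennreal (f j) \<partial>count_space S) < \<infinity>"
    and "infsum f S = enn2real (\<integral>\<^sup>+j. ennreal (f j) \<partial>count_space S)"
proof -
  have "f summable_on S \<longleftrightarrow> (\<lambda>j. norm (f j)) summable_on S"
    by (rule summable_on_cong) (use assms in auto)
  also have "\<dots> \<longleftrightarrow> integrable (count_space S) f"
    unfolding abs_summable_equivalent abs_summable_on_def ..
  also have "\<dots> \<longleftrightarrow> (\<integral>\<^sup>+j. ennreal (f j) \<partial>count_space S) < \<infinity>"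
  proof -
    have "(\<integral>\<^sup>+j. ennreal (norm (f j)) \<partial>count_space S) = (\<integral>\<^sup>+j. ennreal (f j) \<partial>count_space S)"
      by (rule nn_integral_cong) (use assms in auto)
    then show ?thesis unfolding integrable_iff_bounded by simp
  qed
  finally show *: "f summable_on S \<longleftrightarrow> (\<integral>\<^sup>+j. ennreal (f j) \<partial>count_space S) < \<infinity>" .
  show "infsum f S = enn2real (\<integral>\<^sup>+j. ennreal (f j) \<partial>count_space S)"
  proof (cases "f summable_on S")
    case True
    have "Infinite_Set_Sum.abs_summable_on f S"
      using True assms unfolding abs_summable_equivalent[symmetric] by (subst summable_on_cong) auto
    then have "infsum f S = integral\<^sup>L (count_space S) f"
      by (simp add: infsetsum_infsum[symmetric] infsetsum_def)
    also have "\<dots> = enn2real (\<integral>\<^sup>+j. ennreal (f j) \<partial>count_space S)"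
      by (rule integral_eq_nn_integral) (use assms in auto)
    finally show ?thesis .
  next
    case False
    then have "(\<integral>\<^sup>+j. ennreal (f j) \<partial>count_space S) = \<infinity>" using * by (auto simp: less_top[symmetric])
    with False show ?thesis by (simp add: infsum_not_exists)
  qed
qed

lemma ennreal_infsum:
  fixes f :: "'b \<Rightarrow> real"
  assumes "\<And>j. j \<in> S \<Longrightarrow> 0 \<le> f j" "f summable_on S"
  shows "ennreal (infsum f S) = (\<integral>\<^sup>+j. ennreal (f j) \<partial>count_space S)"
  using infsum_eq_nn_integral[of S f] assms by simp

lemma borel_measurable_nn_integral_count_space:
  fixes f :: "'b::countable \<Rightarrow> 'a \<Rightarrow> ennreal"
  assumes "\<And>j. f j \<in> borel_measurable M"
  shows "(\<lambda>x. \<integral>\<^sup>+j. f j x \<partial>count_space S) \<in> borel_measurable M"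
proof -
  interpret sigma_finite_measure "count_space S"
    by (rule sigma_finite_measure_count_space_countable) simp
  have "(\<lambda>p. f (snd p) (fst p)) \<in> borel_measurable (M \<Otimes>\<^sub>M count_space S)"
    by (rule measurable_compose_countable'[OF _ measurable_snd]) (use assms in measurable)
  then show ?thesis by (intro borel_measurable_nn_integral) (simp add: case_prod_beta')
qed

lemma borel_measurable_infsum:
  fixes f :: "'b::countable \<Rightarrow> 'a \<Rightarrow> real"
  assumes "\<And>j. f j \<in> borel_measurable M" "\<And>j x. 0 \<le> f j x"
  shows "(\<lambda>x. \<Sum>\<^sub>\<infinity>j\<in>S. f j x) \<in> borel_measurable M"
  unfolding infsum_eq_nn_integral(2)[of S "\<lambda>j. f j _", OF assms(2)]
  by (intro borel_measurable_enn2real borel_measurable_nn_integral_count_space measurable_compose[OF assms(1)])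
    simp

section \<open>The almost sure properties of the driving processes\<close>

locale interference_queues = prob_space M for M :: "'w measure" +
  fixes a :: "int ^ 'd::finite \<Rightarrow> real" and lam :: real
    and A :: "int ^ 'd \<Rightarrow> 'w \<Rightarrow> real set" and D :: "int ^ 'd \<Rightarrow> 'w \<Rightarrow> (real \<times> real) set"
  assumes a_nonneg: "\<And>i. 0 \<le> a i" and a_0: "a 0 = 1" and a_summable: "a summable_on UNIV"
    and lam_nonneg: "0 \<le> lam" and driving: "driving_processes M lam A D"
begin

definition law :: "int ^ 'd + int ^ 'd \<Rightarrow> (real \<times> real) set measure" where
  "law = case_sum (\<lambda>_. distr M configurations (\<lambda>\<omega>. embed_line (A 0 \<omega>))) (\<lambda>_. distr M configurations (D 0))"

text \<open>The driving field is moved to its canonical product space, where translation of the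
  lattice and restriction to the past are maps of the sample space itself.\<close>

definition P :: "(int ^ 'd + int ^ 'd \<Rightarrow> (real \<times> real) set) measure" where
  "P = PiM UNIV law"

lemma A_poisson: "poisson_point_process M (density lborel (\<lambda>_. ennreal lam)) (A i)"
  and D_poisson: "poisson_point_process M (density lborel (indicator (UNIV \<times> {0..1}))) (D i)"
  using driving unfolding driving_processes_def by auto

lemma law_prob: "prob_space (law i)" and law_sets: "sets (law i) = sets configurations"
proof -
  show "sets (law i) = sets configurations" unfolding law_def by (cases i) auto
  show "prob_space (law i)" unfolding law_def
    using measurable_compose[OF poisson_measurable[OF A_poisson] measurable_embed_line] poisson_measurable[OF D_poisson]
    by (cases i) (auto intro!: prob_space_distr)
qed

lemma prob_space_P: "prob_space P"
  unfolding P_def by (rule prob_space_PiM) (rule law_prob)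

lemma sets_P: "sets P = sets (PiM UNIV (\<lambda>_. configurations))"
  unfolding P_def by (rule sets_PiM_cong) (simp_all add: law_sets)

lemma measurable_P: "measurable P N = measurable (PiM UNIV (\<lambda>_. configurations)) N"
  by (rule measurable_cong_sets[OF sets_P refl])

lemma measurable_to_P: "measurable N P = measurable N (PiM UNIV (\<lambda>_. configurations))"
  by (rule measurable_cong_sets[OF refl sets_P])

lemma space_P: "w \<in> space P \<longleftrightarrow> (\<forall>i. w i \<in> locally_finite_sets)"
  using sets_eq_imp_space_eq[OF sets_P] by (auto simp: space_PiM PiE_iff)

lemma field_measurable: "driving_field A D \<in> measurable M P"
  unfolding measurable_to_P by (rule distr_driving_field[OF driving])

lemma P_eq: "P = distr M P (driving_field A D)"
proof -
  have "distr M P (driving_field A D) = distr M (PiM UNIV (\<lambda>_. configurations)) (driving_field A D)"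
    by (rule distr_cong) (auto simp: sets_P)
  then show ?thesis unfolding distr_driving_field(2)[OF driving] P_def law_def by simp
qed

lemma nn_integral_P: "f \<in> borel_measurable P \<Longrightarrow> (\<integral>\<^sup>+w. f w \<partial>P) = (\<integral>\<^sup>+\<omega>. f (driving_field A D \<omega>) \<partial>M)"
  using nn_integral_distr[OF field_measurable, of f] unfolding P_eq[symmetric] .

lemma AE_P: "{w \<in> space P. Q w} \<in> sets P \<Longrightarrow> (AE \<omega> in M. Q (driving_field A D \<omega>)) \<Longrightarrow> (AE w in P. Q w)"
  by (subst P_eq, subst AE_distr_iff[OF field_measurable]) auto

lemma coordinate_measurable [measurable]: "(\<lambda>w. w i) \<in> measurable P configurations"
  unfolding measurable_P by (rule measurable_component_singleton) simp

lemma count_measurable [measurable]: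
  "B \<in> sets borel \<Longrightarrow> bounded B \<Longrightarrow> (\<lambda>w. card (w i \<inter> B)) \<in> measurable P (count_space UNIV)"
  by (rule measurable_compose[OF coordinate_measurable measurable_card])

definition arr :: "(int ^ 'd + int ^ 'd \<Rightarrow> (real \<times> real) set) \<Rightarrow> int ^ 'd \<Rightarrow> real set" where
  "arr w i = {t. (t, 0) \<in> w (Inl i)}"

definition dep :: "(int ^ 'd + int ^ 'd \<Rightarrow> (real \<times> real) set) \<Rightarrow> int ^ 'd \<Rightarrow> (real \<times> real) set" where
  "dep w i = w (Inr i)"

lemma arr_field [simp]: "arr (driving_field A D \<omega>) = (\<lambda>i. A i \<omega>)"
  and dep_field [simp]: "dep (driving_field A D \<omega>) = (\<lambda>i. D i \<omega>)"
  by (auto simp: arr_def dep_def driving_field_def embed_line_def fun_eq_iff)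

lemma arrivals_arr: "arrivals (arr w i) t0 t = card (w (Inl i) \<inter> {t0<..<t} \<times> {0})"
proof -
  have "w (Inl i) \<inter> {t0<..<t} \<times> {0} = (\<lambda>t. (t, 0)) ` (arr w i \<inter> {t0<..<t})" by (auto simp: arr_def)
  then show ?thesis by (simp add: arrivals_def card_image inj_on_def)
qed

lemma arrivals_measurable [measurable]: "(\<lambda>w. arrivals (arr w i) t0 t) \<in> measurable P (count_space UNIV)"
  unfolding arrivals_arr by (rule count_measurable) (auto intro!: borel_Times bounded_Times)

lemma measure_A_intensity:
  "measure (density lborel (\<lambda>_. ennreal lam)) {t0<..<t} = lam * (t - t0)" if "t0 \<le> t"
  using that lam_nonneg by (simp add: measure_def emeasure_density nn_integral_cmult_indicator ennreal_mult[symmetric])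

lemma nn_integral_arrivals:
  assumes "t0 \<le> t"
  shows "(\<integral>\<^sup>+w. of_nat (arrivals (arr w i) t0 t) \<partial>P) = ennreal (lam * (t - t0))"
proof -
  have "(\<integral>\<^sup>+w. of_nat (arrivals (arr w i) t0 t) \<partial>P) = (\<integral>\<^sup>+\<omega>. of_nat (arrivals (A i \<omega>) t0 t) \<partial>M)"
    by (subst nn_integral_P) auto
  also have "\<dots> = ennreal (lam * (t - t0))"
    unfolding arrivals_def measure_A_intensity[OF assms, symmetric] by (rule poisson_mean[OF A_poisson]) auto
  finally show ?thesis .
qed

lemma measure_D_intensity:
  assumes "B \<in> sets borel" "bounded B"
  shows "measure (density lborel (indicator (UNIV \<times> {0..1}))) B = measure lborel (B \<inter> UNIV \<times> {0..1} :: (real \<times> real) set)"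
proof -
  have [measurable]: "(UNIV \<times> {0..1} :: (real \<times> real) set) \<in> sets borel" by (intro borel_Times) auto
  have "emeasure (density lborel (indicator (UNIV \<times> {0..1}))) B = emeasure lborel (B \<inter> UNIV \<times> {0..1})"
  proof -
    have "emeasure (density lborel (indicator (UNIV \<times> {0..1}))) B
      = (\<integral>\<^sup>+x. indicator (UNIV \<times> {0..1}) x * indicator B x \<partial>lborel)"
      by (rule emeasure_density) (use assms in auto)
    also have "\<dots> = (\<integral>\<^sup>+x. indicator (B \<inter> UNIV \<times> {0..1}) x \<partial>lborel)"
      by (intro nn_integral_cong) (simp split: split_indicator)
    also have "\<dots> = emeasure lborel (B \<inter> UNIV \<times> {0..1})"
      by (rule nn_integral_indicator) (use assms in auto)
    finally show ?thesis .
  qed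
  then show ?thesis by (simp add: measure_def)
qed

lemma measure_lborel_Times:
  fixes X Y :: "real set"
  assumes "X \<in> sets borel" "Y \<in> sets borel"
  shows "measure lborel (X \<times> Y) = measure lborel X * measure lborel Y"
proof -
  have "emeasure (lborel \<Otimes>\<^sub>M lborel) (X \<times> Y) = emeasure lborel X * emeasure lborel Y"
    by (rule lborel.emeasure_pair_measure_Times) (use assms in auto)
  then show ?thesis unfolding lborel_prod by (simp add: measure_def enn2real_mult)
qed

lemma AE_no_atoms:
  assumes "B \<in> sets borel" "bounded B" "measure lborel (B \<inter> UNIV \<times> {0..1}) = 0"
  shows "AE w in P. card (w (Inr i) \<inter> B) = 0"
proof (rule AE_P)
  show "{w \<in> space P. card (w (Inr i) \<inter> B) = 0} \<in> sets P" using assms(1,2) by measurable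
  show "AE \<omega> in M. card (driving_field A D \<omega> (Inr i) \<inter> B) = 0"
    using poisson_null[OF D_poisson assms(1,2)] assms by (simp add: driving_field_def measure_D_intensity)
qed

lemma nn_integral_atoms:
  assumes "B \<in> sets borel" "bounded B"
  shows "(\<integral>\<^sup>+w. of_nat (card (w (Inr i) \<inter> B)) \<partial>P) = ennreal (measure lborel (B \<inter> UNIV \<times> {0..1}))"
proof -
  have "(\<integral>\<^sup>+w. of_nat (card (w (Inr i) \<inter> B)) \<partial>P) = (\<integral>\<^sup>+\<omega>. of_nat (card (D i \<omega> \<inter> B)) \<partial>M)"
    by (subst nn_integral_P) (auto intro!: measurable_compose[OF count_measurable[OF assms]] simp: driving_field_def)
  also have "\<dots> = ennreal (measure lborel (B \<inter> UNIV \<times> {0..1}))"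
    unfolding measure_D_intensity[OF assms, symmetric] by (rule poisson_mean[OF D_poisson assms])
  finally show ?thesis .
qed

lemma two_atoms_le:
  assumes "B \<in> sets borel" "bounded B"
  shows "measure P {w \<in> space P. 2 \<le> card (w (Inr i) \<inter> B)} \<le> (measure lborel (B \<inter> UNIV \<times> {0..1}))\<^sup>2"
proof -
  note [measurable] = count_measurable[OF assms]
  have "{w \<in> space P. 2 \<le> card (w (Inr i) \<inter> B)} \<in> sets P" by measurable
  then have "measure P {w \<in> space P. 2 \<le> card (w (Inr i) \<inter> B)}
    = prob (driving_field A D -` {w \<in> space P. 2 \<le> card (w (Inr i) \<inter> B)} \<inter> space M)"
    using measure_distr[OF field_measurable, of "{w \<in> space P. 2 \<le> card (w (Inr i) \<inter> B)}"]
    unfolding P_eq[symmetric] by simp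
  also have "driving_field A D -` {w \<in> space P. 2 \<le> card (w (Inr i) \<inter> B)} \<inter> space M
     = {\<omega> \<in> space M. 2 \<le> card (D i \<omega> \<inter> B)}"
    using measurable_space[OF field_measurable] by (auto simp: driving_field_def)
  finally show ?thesis using poisson_two_le[OF D_poisson assms] measure_D_intensity[OF assms] by simp
qed

section \<open>An almost sure event on which the inputs are regular\<close>

definition bad_marks :: "nat \<Rightarrow> (real \<times> real) set" where
  "bad_marks n = {- real n..real n} \<times> ({- real n..0} \<union> {1<..real n})"

text \<open>Closed cells, so that they cover the window from \<open>-n\<close> to \<open>n\<close>
  at every resolution. Two atoms at one time share a cell at each resolution, hence one resolution
  without crowded cells excludes them.\<close>

definition time_cell :: "nat \<Rightarrow> nat \<Rightarrow> nat \<Rightarrow> (real \<times> real) set" where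
  "time_cell n m k = {- real n + 2 * real n * (real k / real (Suc m))..- real n + 2 * real n * (real (Suc k) / real (Suc m))} \<times> {0..1}"

text \<open>Positivity and boundedness of marks, distinct departure epochs and summable arrivals,
  all expressed by countably many counts so that the set is an event. Each condition is preserved by
  translation and by deletion of atoms.\<close>

definition good :: "(int ^ 'd + int ^ 'd \<Rightarrow> (real \<times> real) set) set" where
  "good = {w \<in> space P.
     (\<forall>i n. card (w (Inr i) \<inter> bad_marks n) = 0) \<and>
     (\<forall>i n. \<exists>m. \<forall>k\<le>m. card (w (Inr i) \<inter> time_cell n m k) \<le> 1) \<and>
     (\<forall>i n. (\<integral>\<^sup>+j. ennreal (a j * real (arrivals (arr w (i - j)) (- real n) (real n))) \<partial>count_space UNIV) < \<infinity>)}"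

lemma bad_marks: "bad_marks n \<in> sets borel" "bounded (bad_marks n)"
  and time_cell: "time_cell n m k \<in> sets borel" "bounded (time_cell n m k)"
  unfolding bad_marks_def time_cell_def by (auto intro!: borel_Times bounded_Times)

lemma sets_good: "good \<in> sets P"
proof -
  note [measurable] = count_measurable[OF bad_marks] count_measurable[OF time_cell]
    borel_measurable_nn_integral_count_space
  have [measurable]: "(\<lambda>w. \<integral>\<^sup>+j. ennreal (a j * real (arrivals (arr w (i - j)) (- real n) (real n))) \<partial>count_space UNIV)
      \<in> borel_measurable P" for i n
    by (rule borel_measurable_nn_integral_count_space) measurable
  show ?thesis unfolding good_def by measurable
qed

lemma AE_good: "AE w in P. w \<in> good"
proof -
  interpret P: prob_space P by (rule prob_space_P)
  have "AE w in P. card (w (Inr i) \<inter> bad_marks n) = 0" for i n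
  proof (rule AE_no_atoms[OF bad_marks])
    have "bad_marks n \<inter> UNIV \<times> {0..1} = {- real n..real n} \<times> (({- real n..0} \<union> {1<..real n}) \<inter> {0..1})"
      by (auto simp: bad_marks_def)
    also have "({- real n..0} \<union> {1<..real n}) \<inter> {0..1} = {0}" by auto
    finally show "measure lborel (bad_marks n \<inter> UNIV \<times> {0..1}) = 0" by (simp add: measure_lborel_Times)
  qed
  then have 1: "AE w in P. \<forall>i n. card (w (Inr i) \<inter> bad_marks n) = 0" by (simp add: AE_all_countable)
  have "AE w in P. \<exists>m. \<forall>k\<le>m. card (w (Inr i) \<inter> time_cell n m k) \<le> 1" for i n
  proof -
    define E where "E m k = {w \<in> space P. 2 \<le> card (w (Inr i) \<inter> time_cell n m k)}" for m k
    have E: "E m k \<in> sets P" for m k unfolding E_def using time_cell by measurable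
    have Ep: "measure P (E m k) \<le> (2 * real n / real (Suc m))\<^sup>2" for m k
    proof -
      have "time_cell n m k \<inter> UNIV \<times> {0..1} = time_cell n m k" by (auto simp: time_cell_def)
      moreover have "measure lborel (time_cell n m k) = 2 * real n / real (Suc m)"
      proof -
        define x where "x = - real n + 2 * real n * (real k / real (Suc m))"
        define y where "y = - real n + 2 * real n * (real (Suc k) / real (Suc m))"
        have "y - x = 2 * real n / real (Suc m)"
          by (simp add: x_def y_def add_divide_distrib distrib_left)
        moreover have "x \<le> y" using calculation by (smt (verit) divide_nonneg_nonneg of_nat_0_le_iff)
        ultimately show ?thesis
          unfolding time_cell_def x_def[symmetric] y_def[symmetric] by (subst measure_lborel_Times) auto
      qed
      ultimately show ?thesis using two_atoms_le[OF time_cell, of i n m k] by (simp add: E_def)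
    qed
    \<comment> \<open>Some cell of resolution m is crowded. With m + 1 cells of squared intensity
      (2n / (m + 1))^2 the union bound tends to 0, so almost surely some resolution has no crowded
      cell.\<close>
    define F where "F m = (\<Union>k\<le>m. E m k)" for m
    have F: "F m \<in> sets P" for m unfolding F_def using E by auto
    have Fp: "measure P (F m) \<le> (2 * real n)\<^sup>2 / real (Suc m)" for m
    proof -
      have "measure P (F m) \<le> (\<Sum>k\<le>m. measure P (E m k))"
        unfolding F_def using E by (intro P.finite_measure_subadditive_finite) auto
      also have "\<dots> \<le> (\<Sum>k\<le>m. (2 * real n / real (Suc m))\<^sup>2)" by (intro sum_mono Ep)
      also have "\<dots> = (2 * real n)\<^sup>2 / real (Suc m)"
        by (simp add: power_divide power2_eq_square del: of_nat_Suc)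
      finally show ?thesis .
    qed
    have "measure P (\<Inter>m. F m) \<le> (2 * real n)\<^sup>2 / real (Suc m)" for m
      using F by (intro order_trans[OF P.finite_measure_mono Fp[of m]]) auto
    moreover have "(\<lambda>m. (2 * real n)\<^sup>2 / real (Suc m)) \<longlonglongrightarrow> 0"
      by (rule LIMSEQ_Suc[OF lim_const_over_n])
    ultimately have "measure P (\<Inter>m. F m) \<le> 0" by (intro LIMSEQ_le_const) auto
    then have "measure P (\<Inter>m. F m) = 0" by (simp add: measure_le_0_iff)
    then have "(\<Inter>m. F m) \<in> null_sets P" using F by (auto simp: null_sets_def P.emeasure_eq_measure)
    then have "AE w in P. w \<notin> (\<Inter>m. F m)" by (rule AE_not_in)
    then show ?thesis using AE_space
    proof eventually_elim
      case (elim w)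
      then obtain m where "w \<notin> F m" by auto
      then have "\<not> 2 \<le> card (w (Inr i) \<inter> time_cell n m k)" if "k \<le> m" for k
        using elim(2) that by (auto simp: F_def E_def)
      then have "\<forall>k\<le>m. card (w (Inr i) \<inter> time_cell n m k) \<le> 1" by fastforce
      then show ?case by blast
    qed
  qed
  then have 2: "AE w in P. \<forall>i n. \<exists>m. \<forall>k\<le>m. card (w (Inr i) \<inter> time_cell n m k) \<le> 1" by (simp add: AE_all_countable)
  have "AE w in P. (\<integral>\<^sup>+j. ennreal (a j * real (arrivals (arr w (i - j)) (- real n) (real n))) \<partial>count_space UNIV) \<noteq> \<infinity>" for i n
  \<comment> \<open>The expectation is computed by Tonelli: the weights \<open>a j\<close> have a
    finite sum, and the mean number of arrivals in the window does not depend on the site.\<close>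
  proof (rule nn_integral_PInf_AE)
    show "(\<lambda>w. \<integral>\<^sup>+j. ennreal (a j * real (arrivals (arr w (i - j)) (- real n) (real n))) \<partial>count_space UNIV) \<in> borel_measurable P"
      by (rule borel_measurable_nn_integral_count_space) measurable
    have "(\<integral>\<^sup>+w. \<integral>\<^sup>+j. ennreal (a j * real (arrivals (arr w (i - j)) (- real n) (real n))) \<partial>count_space UNIV \<partial>P)
      = (\<integral>\<^sup>+j. \<integral>\<^sup>+w. ennreal (a j * real (arrivals (arr w (i - j)) (- real n) (real n))) \<partial>P \<partial>count_space UNIV)"
      by (rule nn_integral_count_space_nn_integral) measurable
    also have "\<dots> = (\<integral>\<^sup>+j. ennreal (a j * (lam * (2 * real n))) \<partial>count_space UNIV)"
    proof (rule nn_integral_cong)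
      fix j
      have "(\<integral>\<^sup>+w. ennreal (a j * real (arrivals (arr w (i - j)) (- real n) (real n))) \<partial>P)
        = (\<integral>\<^sup>+w. ennreal (a j) * of_nat (arrivals (arr w (i - j)) (- real n) (real n)) \<partial>P)"
        by (intro nn_integral_cong) (simp add: ennreal_mult a_nonneg ennreal_of_nat_eq_real_of_nat)
      also have "\<dots> = ennreal (a j) * ennreal (lam * (real n - - real n))"
        by (subst nn_integral_cmult) (measurable, simp add: nn_integral_arrivals)
      finally show "(\<integral>\<^sup>+w. ennreal (a j * real (arrivals (arr w (i - j)) (- real n) (real n))) \<partial>P)
        = ennreal (a j * (lam * (2 * real n)))" using lam_nonneg by (simp add: ennreal_mult a_nonneg)
    qed
    also have "\<dots> < \<infinity>"
      using infsum_eq_nn_integral(1)[of UNIV "\<lambda>j. a j * (lam * (2 * real n))"] a_summable a_nonneg lam_nonneg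
      by (auto intro: summable_on_cmult_left)
    finally show "(\<integral>\<^sup>+w. \<integral>\<^sup>+j. ennreal (a j * real (arrivals (arr w (i - j)) (- real n) (real n))) \<partial>count_space UNIV \<partial>P) \<noteq> \<infinity>"
      by simp
  qed
  then have 3: "AE w in P. \<forall>i n. (\<integral>\<^sup>+j. ennreal (a j * real (arrivals (arr w (i - j)) (- real n) (real n))) \<partial>count_space UNIV) < \<infinity>"
    by (simp add: AE_all_countable less_top)
  show ?thesis using 1 2 3 AE_space by eventually_elim (simp add: good_def)
qed

lemma good_space: "w \<in> good \<Longrightarrow> w \<in> space P" by (simp add: good_def)

lemma good_marks:
  assumes w: "w \<in> good" and "(r, u) \<in> dep w i"
  shows "0 < u \<and> u \<le> 1"
proof (rule ccontr)
  assume "\<not> (0 < u \<and> u \<le> 1)"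
  obtain n :: nat where n: "\<bar>r\<bar> + \<bar>u\<bar> \<le> real n" using real_arch_simple by blast
  have "(r, u) \<in> w (Inr i) \<inter> bad_marks n"
    using \<open>\<not> (0 < u \<and> u \<le> 1)\<close> n assms(2) by (auto simp: bad_marks_def dep_def)
  moreover have "finite (w (Inr i) \<inter> bad_marks n)"
    using good_space[OF w] bad_marks(2) by (auto simp: space_P locally_finite_sets_def)
  ultimately have "card (w (Inr i) \<inter> bad_marks n) \<noteq> 0" by auto
  then show False using w by (auto simp: good_def)
qed

lemma good_finite:
  assumes w: "w \<in> good"
  shows "finite (arr w i \<inter> {x..y})" "finite (dep w i \<inter> {x..y} \<times> UNIV)"
proof -
  have lf: "finite (w j \<inter> B)" if "bounded B" for j B
    using good_space[OF w] that by (auto simp: space_P locally_finite_sets_def)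
  have "finite (fst ` (w (Inl i) \<inter> {x..y} \<times> {0}))" by (intro finite_imageI lf bounded_Times) auto
  moreover have "arr w i \<inter> {x..y} \<subseteq> fst ` (w (Inl i) \<inter> {x..y} \<times> {0})" by (force simp: arr_def)
  ultimately show "finite (arr w i \<inter> {x..y})" by (rule rev_finite_subset)
  have "finite (w (Inr i) \<inter> {x..y} \<times> {0..1})" by (intro lf bounded_Times) auto
  moreover have "dep w i \<inter> {x..y} \<times> UNIV \<subseteq> w (Inr i) \<inter> {x..y} \<times> {0..1}"
    using good_marks[OF w] by (force simp: dep_def)
  ultimately show "finite (dep w i \<inter> {x..y} \<times> UNIV)" by (rule rev_finite_subset)
qed

lemma good_distinct:
  assumes w: "w \<in> good"
  shows "inj_on fst (dep w i)"
proof (rule inj_onI, rule ccontr)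
  fix p p' assume p: "p \<in> dep w i" "p' \<in> dep w i" "fst p = fst p'" "p \<noteq> p'"
  define r where "r = fst p"
  obtain n :: nat where n: "\<bar>r\<bar> + 1 \<le> real n" using real_arch_simple by blast
  then have n0: "0 < real n" by linarith
  obtain m where m: "\<And>k. k \<le> m \<Longrightarrow> card (w (Inr i) \<inter> time_cell n m k) \<le> 1" using w by (fastforce simp: good_def)
  \<comment> \<open>The position of \<open>r\<close> in units of cells. The extra 1 in the choice of
    \<open>n\<close> keeps \<open>r\<close> strictly inside the window, so that the cell number
    \<open>k\<close> is at most \<open>m\<close>.\<close>
  define x where "x = (r + real n) / (2 * real n) * real (Suc m)"
  define k where "k = nat \<lfloor>x\<rfloor>"
  have y: "0 \<le> (r + real n) / (2 * real n)" "(r + real n) / (2 * real n) < 1" using n n0 by (auto simp: field_simps)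
  have x: "0 \<le> x" "x < real (Suc m)"
    using mult_nonneg_nonneg[OF y(1), of "real (Suc m)"] mult_strict_right_mono[OF y(2), of "real (Suc m)"]
    by (auto simp: x_def)
  then have k: "real k \<le> x" "x \<le> real (Suc k)" "k \<le> m" unfolding k_def by linarith+
  have "x / real (Suc m) = (r + real n) / (2 * real n)" by (simp add: x_def del: of_nat_Suc)
  then have r: "r = - real n + 2 * real n * (x / real (Suc m))" using n0 by simp
  have "r \<in> {- real n + 2 * real n * (real k / real (Suc m))..- real n + 2 * real n * (real (Suc k) / real (Suc m))}"
    unfolding r using k n0 by (auto intro!: mult_left_mono divide_right_mono simp del: of_nat_Suc)
  then have "{p, p'} \<subseteq> w (Inr i) \<inter> time_cell n m k"
    using p good_marks[OF w, of "fst p" "snd p" i] good_marks[OF w, of "fst p'" "snd p'" i]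
    by (cases p; cases p') (auto simp: r_def time_cell_def dep_def)
  moreover have "finite (w (Inr i) \<inter> time_cell n m k)"
    using good_space[OF w] time_cell(2) by (auto simp: space_P locally_finite_sets_def)
  ultimately have "card {p, p'} \<le> card (w (Inr i) \<inter> time_cell n m k)" by (intro card_mono)
  with p(4) m[OF k(3)] show False by simp
qed

lemma good_input:
  assumes w: "w \<in> good"
  shows "interference_input a (arr w) (dep w)"
proof (rule interference_input.intro)
  show "0 \<le> a i" for i by (rule a_nonneg)
  show "a 0 = 1" by (rule a_0)
  show q: "queue_input (arr w i) (dep w i)" for i
    by standard (use good_finite[OF w] good_marks[OF w] good_distinct[OF w] in auto)
  show "summable_config a (\<lambda>i. arrivals (arr w i) t0 t)" for t0 t
    unfolding summable_config_def
  proof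
    fix i
    obtain n :: nat where n: "\<bar>t0\<bar> + \<bar>t\<bar> \<le> real n" using real_arch_simple by blast
    have s: "(\<lambda>j. a j * real (arrivals (arr w (i - j)) (- real n) (real n))) summable_on UNIV"
      using w infsum_eq_nn_integral(1)[of UNIV "\<lambda>j. a j * real (arrivals (arr w (i - j)) (- real n) (real n))"]
      by (auto simp: good_def a_nonneg)
    have "arrivals (arr w j) t0 t \<le> arrivals (arr w j) (- real n) (real n)" for j
      unfolding arrivals_def using n queue_input.finite_arrivals'(1)[OF q]
      by (intro card_mono) auto
    then show "(\<lambda>j. a j * real (arrivals (arr w (i - j)) t0 t)) summable_on UNIV"
      by (intro summable_on_comparison_test[OF s]) (auto intro!: mult_left_mono simp: a_nonneg)
  qed
qed

section \<open>Restriction to the past and translation of the lattice\<close>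

definition past :: "real \<Rightarrow> (int ^ 'd + int ^ 'd \<Rightarrow> (real \<times> real) set) \<Rightarrow> int ^ 'd + int ^ 'd \<Rightarrow> (real \<times> real) set" where
  "past T w = (\<lambda>j. w j \<inter> {..T} \<times> UNIV)"

definition translate :: "int ^ 'd \<Rightarrow> (int ^ 'd + int ^ 'd \<Rightarrow> (real \<times> real) set) \<Rightarrow> int ^ 'd + int ^ 'd \<Rightarrow> (real \<times> real) set" where
  "translate p w = (\<lambda>j. w (map_sum (\<lambda>i. i + p) (\<lambda>i. i + p) j))"

lemma arr_translate [simp]: "arr (translate p w) = (\<lambda>i. arr w (i + p))"
  and dep_translate [simp]: "dep (translate p w) = (\<lambda>i. dep w (i + p))"
  by (auto simp: arr_def dep_def translate_def)

lemma arr_past: "arr (past T w) i = arr w i \<inter> {..T}"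
  and dep_past: "dep (past T w) i = dep w i \<inter> {..T} \<times> UNIV"
  by (auto simp: arr_def dep_def past_def)

lemma translate_good:
  assumes "w \<in> good"
  shows "translate p w \<in> good"
proof -
  have "w \<in> space P" by (rule good_space[OF assms])
  then have "translate p w \<in> space P" by (auto simp: space_P translate_def)
  have tr: "translate p w (Inr i) = w (Inr (i + p))" for i by (simp add: translate_def)
  have idx: "i - j + p = i + p - j" for i j :: "int ^ 'd" by simp
  show ?thesis
    unfolding good_def mem_Collect_eq tr arr_translate idx
    using \<open>translate p w \<in> space P\<close> assms unfolding good_def by blast
qed

text \<open>Deleting atoms can only lower the counts, and every condition in \<open>good\<close> is
  an upper bound on counts. It makes events about the rates at time \<open>T\<close> expressible
  through the past.\<close>

lemma past_good:
  assumes w: "w \<in> good"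
  shows "past T w \<in> good"
proof -
  have lf: "finite (w j \<inter> B)" if "bounded B" for j B
    using good_space[OF w] that by (auto simp: space_P locally_finite_sets_def)
  have le: "card (past T w j \<inter> B) \<le> card (w j \<inter> B)" if "bounded B" for j B
    by (intro card_mono lf that) (auto simp: past_def)
  have "past T w \<in> space P" using good_space[OF w]
    by (auto simp: space_P past_def intro: locally_finite_sets_subset[OF _ Int_lower1])
  moreover have "card (past T w (Inr i) \<inter> bad_marks n) = 0" for i n
    using w le[OF bad_marks(2)[of n], of "Inr i"] by (simp add: good_def)
  moreover have "\<exists>m. \<forall>k\<le>m. card (past T w (Inr i) \<inter> time_cell n m k) \<le> 1" for i n
  proof -
    have "\<exists>m. \<forall>k\<le>m. card (w (Inr i) \<inter> time_cell n m k) \<le> 1" using w by (simp add: good_def)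
    then obtain m where "\<forall>k\<le>m. card (w (Inr i) \<inter> time_cell n m k) \<le> 1" by blast
    then show ?thesis using le[OF time_cell(2)[of n], of "Inr i"] by (meson order_trans)
  qed
  moreover have "(\<integral>\<^sup>+j. ennreal (a j * real (arrivals (arr (past T w) (i - j)) (- real n) (real n))) \<partial>count_space UNIV) < \<infinity>" for i n
  proof -
    have "arrivals (arr (past T w) j) (- real n) (real n) \<le> arrivals (arr w j) (- real n) (real n)" for j
      unfolding arrivals_arr by (rule le) (auto intro!: bounded_Times)
    then have "(\<integral>\<^sup>+j. ennreal (a j * real (arrivals (arr (past T w) (i - j)) (- real n) (real n))) \<partial>count_space UNIV)
      \<le> (\<integral>\<^sup>+j. ennreal (a j * real (arrivals (arr w (i - j)) (- real n) (real n))) \<partial>count_space UNIV)"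
      by (intro nn_integral_mono ennreal_leI mult_left_mono) (auto simp: a_nonneg)
    also have "\<dots> < \<infinity>" using w by (simp add: good_def)
    finally show ?thesis .
  qed
  ultimately show ?thesis by (simp add: good_def)
qed

end

section \<open>Discretisation of the departure times\<close>

definition grid :: "real \<Rightarrow> real \<Rightarrow> nat \<Rightarrow> nat \<Rightarrow> real" where
  "grid t0 t m k = t0 + (t - t0) * (real k / real (Suc m))"

text \<open>The summand 2 puts the level of a rounded rate more than 1 / (q + 1) and at most 2 / (q
  + 1) above the rate itself.\<close>

definition level :: "nat \<Rightarrow> int \<Rightarrow> real" where
  "level q z = (of_int z + 2) / real (Suc q)"

text \<open>The last cell is closed at \<open>t\<close>; the cut \<open>{..<t}\<close> removes an
  atom at \<open>t\<close> itself, which \<open>departures\<close> does not count.\<close>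

definition cell :: "real \<Rightarrow> real \<Rightarrow> nat \<Rightarrow> nat \<Rightarrow> real \<Rightarrow> (real \<times> real) set" where
  "cell t0 t m k l = ({grid t0 t m k<..grid t0 t m (Suc k)} \<inter> {..<t}) \<times> {0<..l}"

text \<open>
  On each time cell the rate is evaluated at the left end point, so that it only depends on the
  past, and it is rounded to one of finitely many values. Rounding to a value that exceeds the
  rate by at least \<open>1 / (q + 1)\<close> makes the approximation exact in the limit even for atoms
  whose mark equals the rate.
\<close>

definition rounded :: "nat \<Rightarrow> real \<Rightarrow> int" where
  "rounded q x = \<lfloor>real (Suc q) * x\<rfloor>"

definition grid_departures :: "(real \<times> real) set \<Rightarrow> real \<Rightarrow> real \<Rightarrow> nat \<Rightarrow> nat \<Rightarrow> (real \<Rightarrow> real) \<Rightarrow> nat" where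
  "grid_departures \<delta> t0 t q m R = (\<Sum>k\<le>m. card (\<delta> \<inter> cell t0 t m k (level q (rounded q (R (grid t0 t m k))))))"

lemma level_rounded:
  "x + 1 / real (Suc q) < level q (rounded q x)" "level q (rounded q x) \<le> x + 2 / real (Suc q)"
proof -
  define N where "N = real (Suc q)"
  have N: "N > 0" by (simp add: N_def)
  have "x < (of_int \<lfloor>N * x\<rfloor> + 1) / N" "of_int \<lfloor>N * x\<rfloor> / N \<le> x"
    using N by (auto simp: pos_less_divide_eq pos_divide_le_eq mult.commute)
  then show "x + 1 / real (Suc q) < level q (rounded q x)" "level q (rounded q x) \<le> x + 2 / real (Suc q)"
    unfolding level_def rounded_def N_def[symmetric] by (simp_all add: add_divide_distrib)
qed

lemma rounded_mono: "x \<le> y \<Longrightarrow> rounded q x \<le> rounded q y"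
  unfolding rounded_def by (intro floor_mono mult_left_mono) auto

lemma level_mono: "z \<le> z' \<Longrightarrow> level q z \<le> level q z'"
  unfolding level_def by (intro divide_right_mono) auto

lemma level_pos: "0 \<le> z \<Longrightarrow> 0 < level q z"
  unfolding level_def by (intro divide_pos_pos) auto

lemma rounded_range: "0 \<le> x \<Longrightarrow> x \<le> 1 \<Longrightarrow> rounded q x \<in> {0..int (Suc q)}"
proof -
  assume "0 \<le> x" "x \<le> 1"
  then have "0 \<le> real (Suc q) * x" "real (Suc q) * x \<le> real (Suc q)" by (auto intro!: mult_left_le)
  from this(1) floor_mono[OF this(2)] show ?thesis unfolding rounded_def by simp
qed

lemma cell_borel: "cell t0 t m k l \<in> sets borel" "bounded (cell t0 t m k l)"
  unfolding cell_def by (auto intro!: borel_Times bounded_Times bounded_Int)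

lemma grid_step: "grid t0 t m (Suc k) = grid t0 t m k + (t - t0) / real (Suc m)"
  by (simp add: grid_def add_divide_distrib distrib_left)

lemma grid_ge: "t0 \<le> t \<Longrightarrow> t0 \<le> grid t0 t m k"
  by (simp add: grid_def)

lemma grid_last: "grid t0 t m (Suc m) = t"
  by (simp add: grid_def)

text \<open>Cells are open on the left and closed on the right, so a point at position x in units of
  cells has number ceiling of x, minus 1.\<close>

definition grid_index :: "real \<Rightarrow> real \<Rightarrow> nat \<Rightarrow> real \<Rightarrow> nat" where
  "grid_index t0 t m r = nat (\<lceil>(r - t0) / (t - t0) * real (Suc m)\<rceil> - 1)"

lemma grid_index:
  assumes "t0 < r" "r < t"
  shows "grid_index t0 t m r \<le> m"
    and "grid t0 t m k < r \<and> r \<le> grid t0 t m (Suc k) \<longleftrightarrow> k = grid_index t0 t m r"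
proof -
  define N where "N = real (Suc m)"
  define x where "x = (r - t0) / (t - t0) * N"
  have N: "N > 0" by (simp add: N_def)
  have y: "(r - t0) / (t - t0) < 1" using assms by (simp add: field_simps)
  have x: "0 < x" "x < N" unfolding x_def using assms N mult_strict_right_mono[OF y N]
    by (auto simp only: mult_1 intro!: mult_pos_pos divide_pos_pos)
  have r: "r = t0 + (t - t0) * (x / N)" using assms N by (simp add: x_def)
  have lt: "grid t0 t m k < r \<longleftrightarrow> real k < x" for k
    unfolding grid_def r N_def[symmetric] using assms N by (simp add: divide_less_cancel)
  have idx: "grid_index t0 t m r = nat (\<lceil>x\<rceil> - 1)" by (simp add: grid_index_def x_def N_def)
  have "\<lceil>x\<rceil> \<le> int (Suc m)" using x by (simp add: ceiling_le_iff N_def)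
  then show "grid_index t0 t m r \<le> m" unfolding idx by linarith
  have "real k < x \<and> x \<le> real (Suc k) \<longleftrightarrow> k = nat (\<lceil>x\<rceil> - 1)" using x by linarith
  then show "grid t0 t m k < r \<and> r \<le> grid t0 t m (Suc k) \<longleftrightarrow> k = grid_index t0 t m r"
    unfolding idx using lt[of k] lt[of "Suc k"] by (simp add: not_less[symmetric])
qed

text \<open>The sampling point of the cell containing \<open>r\<close> is strictly before
  \<open>r\<close> at every resolution, which is the form in which left continuity of the rates is
  used.\<close>

lemma grid_index_left_limit:
  assumes "t0 < r" "r < t"
  shows "filterlim (\<lambda>m. grid t0 t m (grid_index t0 t m r)) (at_left r) sequentially"
proof -
  have *: "grid t0 t m (grid_index t0 t m r) < r" "r \<le> grid t0 t m (grid_index t0 t m r) + (t - t0) / real (Suc m)" for m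
    using grid_index(2)[OF assms, of m "grid_index t0 t m r"] by (auto simp: grid_step)
  have "(\<lambda>m. grid t0 t m (grid_index t0 t m r)) \<longlonglongrightarrow> r"
  proof (rule tendsto_sandwich[OF _ _ _ tendsto_const])
    have "(\<lambda>m. r - (t - t0) / real (Suc m)) \<longlonglongrightarrow> r - 0"
      by (intro tendsto_intros LIMSEQ_Suc[OF lim_const_over_n])
    then show "(\<lambda>m. r - (t - t0) / real (Suc m)) \<longlonglongrightarrow> r" by simp
    show "\<forall>\<^sub>F m in sequentially. r - (t - t0) / real (Suc m) \<le> grid t0 t m (grid_index t0 t m r)"
      using *(2) by (intro always_eventually allI) (simp add: algebra_simps)
    show "\<forall>\<^sub>F m in sequentially. grid t0 t m (grid_index t0 t m r) \<le> r"
      using *(1) by (intro always_eventually allI less_imp_le)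
  qed
  then show ?thesis using *(1) by (auto simp: filterlim_at intro!: always_eventually less_imp_neq)
qed

text \<open>Only finitely many atoms matter, so it is enough to decide each of them correctly. The
  limits are iterated: \<open>q\<close> is chosen by the atoms above their rates, and only then does
  the time grid bring the sampled rates within the tolerance that \<open>q\<close> leaves.\<close>

lemma (in queue_input) grid_departures_eventually:
  assumes "t0 < t"
    and R: "\<And>r g. t0 < r \<Longrightarrow> r < t \<Longrightarrow> filterlim g (at_left r) sequentially \<Longrightarrow> (\<lambda>m. R (g m)) \<longlonglongrightarrow> R r"
  shows "\<forall>\<^sub>F q in sequentially. \<forall>\<^sub>F m in sequentially. grid_departures \<delta> t0 t q m R = departures \<delta> t0 t R"
proof -
  define F where "F = \<delta> \<inter> {t0<..<t} \<times> UNIV"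
  have fin: "finite F" unfolding F_def by (rule finite_subset[OF _ finite_departures[of t0 t]]) force
  define g where "g m r = grid t0 t m (grid_index t0 t m r)" for m r
  have Fr: "t0 < fst p" "fst p < t" "0 < snd p" if "p \<in> F" for p
    using that marks_pos unfolding F_def by (cases p, force)+
  have lim: "(\<lambda>m. R (g m (fst p))) \<longlonglongrightarrow> R (fst p)" if "p \<in> F" for p
    unfolding g_def by (rule R[OF Fr(1,2)[OF that] grid_index_left_limit[OF Fr(1,2)[OF that]]])
  have count: "grid_departures \<delta> t0 t q m R = card {p \<in> F. snd p \<le> level q (rounded q (R (g m (fst p))))}" for q m
  proof -
    let ?C = "\<lambda>k. \<delta> \<inter> cell t0 t m k (level q (rounded q (R (grid t0 t m k))))"
    have C: "?C k = {p \<in> F. k = grid_index t0 t m (fst p) \<and> snd p \<le> level q (rounded q (R (g m (fst p))))}" for k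
    proof (intro set_eqI iffI)
      fix p assume p: "p \<in> ?C k"
      then have b: "grid t0 t m k < fst p" "fst p \<le> grid t0 t m (Suc k)" "fst p < t"
        "snd p \<le> level q (rounded q (R (grid t0 t m k)))" by (auto simp: cell_def)
      have "t0 < fst p" using grid_ge[of t0 t m k] \<open>t0 < t\<close> b by simp
      then have "p \<in> F" using p b by (cases p) (auto simp: F_def)
      moreover have "k = grid_index t0 t m (fst p)" using grid_index(2)[of t0 "fst p" t m k] \<open>t0 < fst p\<close> b by blast
      ultimately show "p \<in> {p \<in> F. k = grid_index t0 t m (fst p) \<and> snd p \<le> level q (rounded q (R (g m (fst p))))}"
        using b by (simp add: g_def)
    next
      fix p assume p: "p \<in> {p \<in> F. k = grid_index t0 t m (fst p) \<and> snd p \<le> level q (rounded q (R (g m (fst p))))}"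
      then have "p \<in> F" and k: "k = grid_index t0 t m (fst p)" by auto
      note f = Fr[OF this(1)]
      have "grid t0 t m k < fst p \<and> fst p \<le> grid t0 t m (Suc k)" using grid_index(2)[OF f(1,2)] k by blast
      then show "p \<in> ?C k" using p f k by (cases p) (auto simp: cell_def F_def g_def)
    qed
    have "{p \<in> F. snd p \<le> level q (rounded q (R (g m (fst p))))} = (\<Union>k\<in>{..m}. ?C k)"
      unfolding C using grid_index(1)[OF Fr(1,2)] by auto
    also have "card \<dots> = (\<Sum>k\<in>{..m}. card (?C k))"
      by (rule card_UN_disjoint) (use fin in \<open>auto simp: C\<close>)
    finally show ?thesis by (simp add: grid_departures_def)
  qed
  have dep: "departures \<delta> t0 t R = card {p \<in> F. snd p \<le> R (fst p)}"
    unfolding departures_def F_def by (intro arg_cong[where f = card]) auto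
  \<comment> \<open>For a mark strictly above its rate, \<open>q\<close> must be so large that even
    the raised level stays below the mark. Marks up to the rate impose nothing on
    \<open>q\<close>.\<close>
  have "\<forall>\<^sub>F q in sequentially. \<forall>p\<in>F. R (fst p) < snd p \<longrightarrow> R (fst p) + 2 / real (Suc q) < snd p"
  proof (rule eventually_ball_finite[OF fin], rule ballI)
    fix p assume "p \<in> F"
    have "(\<lambda>q. R (fst p) + 2 / real (Suc q)) \<longlonglongrightarrow> R (fst p) + 0"
      by (intro tendsto_intros LIMSEQ_Suc[OF lim_const_over_n])
    then show "\<forall>\<^sub>F q in sequentially. R (fst p) < snd p \<longrightarrow> R (fst p) + 2 / real (Suc q) < snd p"
      by (cases "R (fst p) < snd p") (auto dest: order_tendstoD(2)[of _ _ _ "snd p"])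
  qed
  then show ?thesis
  proof eventually_elim
    case (elim q)
    have "\<forall>\<^sub>F m in sequentially. \<forall>p\<in>F. snd p \<le> level q (rounded q (R (g m (fst p)))) \<longleftrightarrow> snd p \<le> R (fst p)"
    proof (rule eventually_ball_finite[OF fin], rule ballI)
      fix p assume p: "p \<in> F"
      show "\<forall>\<^sub>F m in sequentially. snd p \<le> level q (rounded q (R (g m (fst p)))) \<longleftrightarrow> snd p \<le> R (fst p)"
      proof (cases "snd p \<le> R (fst p)")
        case True
        have "\<forall>\<^sub>F m in sequentially. R (fst p) - 1 / real (Suc q) < R (g m (fst p))"
          by (rule order_tendstoD(1)[OF lim[OF p]]) simp
        then show ?thesis
        proof eventually_elim
          case (elim m)
          then show ?case using level_rounded(1)[of "R (g m (fst p))" q] True by linarith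
        qed
      next
        case False
        then have "R (fst p) < snd p - 2 / real (Suc q)" using elim p by force
        then have "\<forall>\<^sub>F m in sequentially. R (g m (fst p)) < snd p - 2 / real (Suc q)"
          by (rule order_tendstoD(2)[OF lim[OF p]])
        then show ?thesis
        proof eventually_elim
          case (elim m)
          then show ?case using level_rounded(2)[of q "R (g m (fst p))"] False by linarith
        qed
      qed
    qed
    then show ?case
    proof eventually_elim
      case (elim m)
      then have "{p \<in> F. snd p \<le> level q (rounded q (R (g m (fst p))))} = {p \<in> F. snd p \<le> R (fst p)}" by auto
      then show ?case unfolding count dep by simp
    qed
  qed
qed

section \<open>Measurability of the bracketing processes\<close>

context interference_queues
begin

text \<open>The bracket estimates and the limit identities behind measurability hold for regular
  inputs, so the measurable space is cut down to these.\<close>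

definition PG :: "(int ^ 'd + int ^ 'd \<Rightarrow> (real \<times> real) set) measure" where
  "PG = restrict_space P good"

lemma space_PG: "space PG = good"
  unfolding PG_def using sets.sets_into_space[OF sets_good] by (auto simp: space_restrict_space)

lemma measurable_PG: "f \<in> measurable P N \<Longrightarrow> f \<in> measurable PG N"
  unfolding PG_def by (rule measurable_restrict_space1)

lemma sets_PG: "X \<in> sets PG \<longleftrightarrow> X \<in> sets P \<and> X \<subseteq> good"
  unfolding PG_def using sets_good sets.sets_into_space[OF sets_good]
  by (subst sets_restrict_space_iff) (auto simp: Int_absorb1)

lemma prob_space_PG: "prob_space PG"
  unfolding PG_def
proof (rule prob_space_restrict_space[OF sets_good])
  interpret P: prob_space P by (rule prob_space_P)
  show "emeasure P good = 1"
    using P.emeasure_eq_1_AE[OF sets_good] AE_good by simp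
qed

lemma nn_integral_PG: "(\<integral>\<^sup>+w. f w \<partial>PG) = (\<integral>\<^sup>+w. f w * indicator good w \<partial>P)"
  unfolding PG_def by (rule nn_integral_restrict_space) (use sets_good sets.sets_into_space[OF sets_good] in \<open>simp add: Int_absorb2\<close>)

abbreviation "up w \<equiv> upper a (arr w) (dep w)"
abbreviation "lo w \<equiv> lower a (arr w) (dep w)"
abbreviation "slow w \<equiv> low_rate a (arr w) (dep w)"
abbreviation "fast w \<equiv> high_rate a (arr w) (dep w)"

text \<open>The cell has a random height, but after rounding only countably many heights occur; for
  each of them the count is measurable by construction.\<close>

lemma cell_count_measurable:
  assumes "R \<in> borel_measurable PG"
  shows "(\<lambda>w. card (dep w i \<inter> cell t0 t m k (level q (rounded q (R w))))) \<in> measurable PG (count_space UNIV)"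
proof (rule measurable_compose_countable[where f = "\<lambda>z w. card (dep w i \<inter> cell t0 t m k (level q z))" and g = "\<lambda>w. rounded q (R w)"])
  show "(\<lambda>w. rounded q (R w)) \<in> measurable PG (count_space UNIV)"
    unfolding rounded_def using assms by measurable
  show "(\<lambda>w. card (dep w i \<inter> cell t0 t m k (level q z))) \<in> measurable PG (count_space UNIV)" for z
    unfolding dep_def by (intro measurable_PG count_measurable cell_borel)
qed

lemma grid_departures_measurable:
  assumes "\<And>r. (\<lambda>w. R w r) \<in> borel_measurable PG"
  shows "(\<lambda>w. grid_departures (dep w i) t0 t q m (R w)) \<in> measurable PG (count_space UNIV)"
  unfolding grid_departures_def
  using cell_count_measurable[OF assms] by measurable

text \<open>The count of atoms below a random curve is an iterated limit of counts in boxes. Left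
  continuity of the curve identifies the limit at every regular input.\<close>

lemma departures_measurable:
  assumes R: "\<And>r. (\<lambda>w. R w r) \<in> borel_measurable PG"
    and lim: "\<And>w r g. w \<in> good \<Longrightarrow> t0 < r \<Longrightarrow> filterlim g (at_left r) sequentially \<Longrightarrow> (\<lambda>m. R w (g m)) \<longlonglongrightarrow> R w r"
  shows "(\<lambda>w. departures (dep w i) t0 t (R w)) \<in> measurable PG (count_space UNIV)"
proof (cases "t0 < t")
  case True
  define L where "L w = lim (\<lambda>q. lim (\<lambda>m. real (grid_departures (dep w i) t0 t q m (R w))))" for w
  have "(\<lambda>w. real (grid_departures (dep w i) t0 t q m (R w))) \<in> borel_measurable PG" for q m
    by (rule measurable_compose[OF grid_departures_measurable[OF R]]) simp
  then have L: "L \<in> borel_measurable PG"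
    unfolding L_def by (intro borel_measurable_lim_metric)
  have eq: "L w = real (departures (dep w i) t0 t (R w))" if w: "w \<in> good" for w
  proof -
    interpret queue_input "arr w i" "dep w i" by (rule interference_input.inputs[OF good_input[OF w]])
    have "\<forall>\<^sub>F q in sequentially. \<forall>\<^sub>F m in sequentially. grid_departures (dep w i) t0 t q m (R w) = departures (dep w i) t0 t (R w)"
      by (rule grid_departures_eventually[OF True]) (rule lim[OF w])
    then have "\<forall>\<^sub>F q in sequentially. lim (\<lambda>m. real (grid_departures (dep w i) t0 t q m (R w))) = real (departures (dep w i) t0 t (R w))"
      by eventually_elim (intro limI tendsto_eventually, auto elim: eventually_mono)
    then show ?thesis unfolding L_def by (intro limI tendsto_eventually)
  qed
  have "(\<lambda>w. nat \<lfloor>L w\<rfloor>) \<in> measurable PG (count_space UNIV)" using L by measurable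
  then show ?thesis
    by (rule measurable_cong[THEN iffD1, rotated]) (simp add: eq space_PG)
next
  case False
  then have "departures (dep w i) t0 t (R w) = 0" for w
    unfolding departures_def by (auto simp: card_eq_0_iff)
  then show ?thesis by simp
qed

lemma rates_measurable:
  assumes "\<And>i. (\<lambda>w. u w i) \<in> measurable PG (count_space (UNIV :: nat set))"
    and "\<And>i. (\<lambda>w. v w i) \<in> measurable PG (count_space (UNIV :: nat set))"
  shows "(\<lambda>w. rate (real (u w i)) (interference a (\<lambda>j. v w j) i)) \<in> borel_measurable PG"
proof -
  have [measurable]: "(\<lambda>w. real (u w i)) \<in> borel_measurable PG" "(\<lambda>w. real (v w i)) \<in> borel_measurable PG" for i
    using assms by (auto intro!: measurable_compose[OF assms(1)] measurable_compose[OF assms(2)])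
  have "(\<lambda>w. interference a (\<lambda>j. v w j) i) \<in> borel_measurable PG"
    unfolding interference_def by (rule borel_measurable_infsum) (measurable, simp add: a_nonneg)
  then show ?thesis unfolding rate_def by measurable
qed

lemma bracket_measurable:
  "(\<lambda>w. up w t0 k i t) \<in> measurable PG (count_space UNIV) \<and> (\<lambda>w. lo w t0 k i t) \<in> measurable PG (count_space UNIV)"
proof (induction k arbitrary: i t)
  case 0
  show ?case by (auto intro: measurable_PG)
next
  case (Suc k)
  have r: "(\<lambda>w. slow w t0 k i r) \<in> borel_measurable PG" "(\<lambda>w. fast w t0 k i r) \<in> borel_measurable PG" for r
    unfolding low_rate_def high_rate_def by (intro rates_measurable; use Suc in blast)+
  have [measurable]: "(\<lambda>w. departures (dep w i) t0 t (slow w t0 k i)) \<in> measurable PG (count_space UNIV)"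
    by (intro departures_measurable r) (rule interference_input.rates_left_limit(1)[OF good_input])
  have [measurable]: "(\<lambda>w. departures (dep w i) t0 t (fast w t0 k i)) \<in> measurable PG (count_space UNIV)"
    by (intro departures_measurable r) (rule interference_input.rates_left_limit(2)[OF good_input])
  have [measurable]: "(\<lambda>w. arrivals (arr w i) t0 t) \<in> measurable PG (count_space UNIV)"
    by (intro measurable_PG arrivals_measurable)
  show ?case unfolding upper_Suc lower_Suc by (intro conjI) measurable
qed

lemma rate_measurable: "(\<lambda>w. slow w t0 k i r) \<in> borel_measurable PG" "(\<lambda>w. fast w t0 k i r) \<in> borel_measurable PG"
  unfolding low_rate_def high_rate_def by (intro rates_measurable; use bracket_measurable in blast)+

text \<open>Adaptedness: brackets at time \<open>t\<close> only use atoms strictly before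
  \<open>t\<close>. Through it, rates at the left end of a time cell are independent of the atoms in
  that cell.\<close>

lemma bracket_past:
  "t \<le> T \<Longrightarrow> up (past T w) t0 k i t = up w t0 k i t \<and> lo (past T w) t0 k i t = lo w t0 k i t"
proof (induction k arbitrary: i t)
  case 0
  have "arr w i \<inter> {..T} \<inter> {t0<..<t} = arr w i \<inter> {t0<..<t}" using 0 by auto
  then show ?case by (simp add: arrivals_def arr_past)
next
  case (Suc k)
  have r: "slow (past T w) t0 k i r = slow w t0 k i r" "fast (past T w) t0 k i r = fast w t0 k i r" if "r < t" for r
    using Suc that unfolding low_rate_def high_rate_def by simp_all
  have "arr w i \<inter> {..T} \<inter> {t0<..<t} = arr w i \<inter> {t0<..<t}" using Suc.prems by auto
  then have 1: "arrivals (arr (past T w) i) t0 t = arrivals (arr w i) t0 t" by (simp add: arrivals_def arr_past)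
  have "{(r, u) \<in> dep (past T w) i. t0 < r \<and> r < t \<and> u \<le> slow (past T w) t0 k i r}
      = {(r, u) \<in> dep w i. t0 < r \<and> r < t \<and> u \<le> slow w t0 k i r}"
    "{(r, u) \<in> dep (past T w) i. t0 < r \<and> r < t \<and> u \<le> fast (past T w) t0 k i r}
      = {(r, u) \<in> dep w i. t0 < r \<and> r < t \<and> u \<le> fast w t0 k i r}"
    using Suc.prems by (auto simp: dep_past r)
  then show ?case unfolding upper_Suc lower_Suc departures_def 1 by simp
qed

lemma rate_past:
  "r \<le> T \<Longrightarrow> slow (past T w) t0 k i r = slow w t0 k i r" "r \<le> T \<Longrightarrow> fast (past T w) t0 k i r = fast w t0 k i r"
  unfolding low_rate_def high_rate_def using bracket_past by simp_all

lemma bracket_translate: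
  "up (translate p w) t0 k i t = up w t0 k (i + p) t \<and> lo (translate p w) t0 k i t = lo w t0 k (i + p) t"
proof (induction k arbitrary: i t)
  case (Suc k)
  have idx: "i - j + p = i + p - j" for j by simp
  show ?case
    unfolding upper.simps lower.simps interference_def Suc[THEN conjunct1] Suc[THEN conjunct2]
    unfolding arr_translate dep_translate idx by simp
qed simp

end

section \<open>The bracketing processes merge\<close>

context interference_queues
begin

section \<open>Independence of past and future atoms\<close>

lemma law_Inr_indep:
  assumes H: "H \<in> sets borel" and B: "B \<in> sets borel" "bounded B" "B \<inter> H = {}" and X: "X \<in> sets configurations"
  shows "measure (law (Inr i)) {S \<in> locally_finite_sets. S \<inter> H \<in> X \<and> card (S \<inter> B) \<in> K}
    = measure (law (Inr i)) {S \<in> locally_finite_sets. S \<inter> H \<in> X}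
      * measure (law (Inr i)) {S \<in> locally_finite_sets. card (S \<inter> B) \<in> K}"
proof -
  note D0 = poisson_measurable[OF D_poisson[of 0]]
  note [measurable] = measurable_restriction[OF H] measurable_card[OF B(1,2)] X
  have s: "{S \<in> space configurations. S \<inter> H \<in> X \<and> card (S \<inter> B) \<in> K} \<in> sets configurations"
    "{S \<in> space configurations. S \<inter> H \<in> X} \<in> sets configurations"
    "{S \<in> space configurations. card (S \<inter> B) \<in> K} \<in> sets configurations" by measurable
  have eq: "measure (law (Inr i)) {S \<in> locally_finite_sets. Q S} = prob {\<omega> \<in> space M. Q (D 0 \<omega>)}"
    if "{S \<in> space configurations. Q S} \<in> sets configurations" for Q
  proof -
    have "measure (law (Inr i)) {S \<in> space configurations. Q S} = prob (D 0 -` {S \<in> space configurations. Q S} \<inter> space M)"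
      unfolding law_def by (simp only: sum.case) (rule measure_distr[OF D0 that])
    also have "D 0 -` {S \<in> space configurations. Q S} \<inter> space M = {\<omega> \<in> space M. Q (D 0 \<omega>)}"
      using measurable_space[OF D0] by auto
    finally show ?thesis by simp
  qed
  show ?thesis
    unfolding eq[OF s(1)] eq[OF s(2)] eq[OF s(3)] by (rule poisson_restriction_indep[OF D_poisson H B X])
qed

lemma past_measurable: "past T \<in> measurable P P"
proof -
  have H: "{..T} \<times> UNIV \<in> sets (borel :: (real \<times> real) measure)" by (intro borel_Times) auto
  have lf: "past T w j \<in> locally_finite_sets" if "w \<in> space P" for w j
    unfolding past_def using that by (auto simp: space_P intro: locally_finite_sets_subset[OF _ Int_lower1])
  show ?thesis unfolding measurable_to_P
  proof (rule measurable_PiM_single')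
    show "(\<lambda>w. past T w j) \<in> measurable P configurations" for j
      unfolding past_def by (rule measurable_compose[OF coordinate_measurable measurable_restriction[OF H]])
  qed (use lf in \<open>auto simp: PiE_iff\<close>)
qed

lemma past_set_measurable: "X \<in> sets P \<Longrightarrow> {w \<in> space P. past T w \<in> X} \<in> sets P"
  using measurable_sets[OF past_measurable, of X T] by (simp add: vimage_def Int_def conj_commute)

text \<open>The expectation of a count is the sum of its tail probabilities. Each tail event
  factorises against the past, as \<open>B\<close> lies after time \<open>T\<close>.\<close>

lemma nn_integral_past_future:
  assumes X: "X \<in> sets P" and B: "B \<in> sets borel" "bounded B" "B \<inter> {..T} \<times> UNIV = {}"
  shows "(\<integral>\<^sup>+w. indicator {w \<in> space P. past T w \<in> X} w * of_nat (card (w (Inr i) \<inter> B)) \<partial>P)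
    = emeasure P {w \<in> space P. past T w \<in> X} * ennreal (measure lborel (B \<inter> UNIV \<times> {0..1}))"
proof -
  interpret P: prob_space P by (rule prob_space_P)
  note [measurable] = count_measurable[OF B(1,2), of "Inr i"] past_set_measurable[OF X, of T]
  have H: "{..T} \<times> UNIV \<in> sets (borel :: (real \<times> real) measure)" by (intro borel_Times) auto
  let ?Y = "{w \<in> space P. past T w \<in> X}"
  define f where "f w = (if w \<in> ?Y then card (w (Inr i) \<inter> B) else 0)" for w
  have f: "f \<in> measurable P (count_space UNIV)" unfolding f_def by measurable
  have "(\<integral>\<^sup>+w. indicator ?Y w * of_nat (card (w (Inr i) \<inter> B)) \<partial>P) = (\<integral>\<^sup>+w. of_nat (f w) \<partial>P)"
    by (intro nn_integral_cong) (simp add: f_def)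
  also have "\<dots> = (\<Sum>n. emeasure P {w \<in> space P. n < f w})"
    by (rule nn_integral_nat_function[OF f])
  also have "\<dots> = (\<Sum>n. emeasure P ?Y * emeasure P {w \<in> space P. n < card (w (Inr i) \<inter> B)})"
  proof (rule suminf_cong)
    fix n
    have "{w \<in> space P. n < f w} = {w \<in> space P. (\<lambda>j. w j \<inter> {..T} \<times> UNIV) \<in> X \<and> card (w (Inr i) \<inter> B) \<in> {n<..}}"
      by (auto simp: f_def past_def)
    also have "emeasure P \<dots> = ennreal (measure P {w \<in> space P. (\<lambda>j. w j \<inter> {..T} \<times> UNIV) \<in> X}
        * measure P {w \<in> space P. card (w (Inr i) \<inter> B) \<in> {n<..}})"
      unfolding P.emeasure_eq_measure unfolding P_def
      by (intro arg_cong[where f = ennreal] PiM_restriction_indep law_prob law_sets H B(1,2)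
          law_Inr_indep[OF H B] X[unfolded P_def])
    also have "\<dots> = emeasure P ?Y * emeasure P {w \<in> space P. n < card (w (Inr i) \<inter> B)}"
      by (simp only: P.emeasure_eq_measure ennreal_mult[OF measure_nonneg measure_nonneg] past_def greaterThan_iff)
    finally show "emeasure P {w \<in> space P. n < f w} = emeasure P ?Y * emeasure P {w \<in> space P. n < card (w (Inr i) \<inter> B)}" .
  qed
  also have "\<dots> = emeasure P ?Y * (\<Sum>n. emeasure P {w \<in> space P. n < card (w (Inr i) \<inter> B)})" by simp
  also have "(\<Sum>n. emeasure P {w \<in> space P. n < card (w (Inr i) \<inter> B)}) = (\<integral>\<^sup>+w. of_nat (card (w (Inr i) \<inter> B)) \<partial>P)"
    by (rule nn_integral_nat_function[symmetric]) measurable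
  also have "\<dots> = ennreal (measure lborel (B \<inter> UNIV \<times> {0..1}))" by (rule nn_integral_atoms[OF B(1,2)])
  finally show ?thesis .
qed

lemma measure_strip_le:
  assumes "t0 \<le> t" "x \<le> y"
  shows "measure lborel ((({grid t0 t m k<..grid t0 t m (Suc k)} \<inter> {..<t}) \<times> {x<..y}) \<inter> UNIV \<times> {0..1})
     \<le> (t - t0) / real (Suc m) * (y - x)"
proof -
  have le: "measure lborel (S \<inter> {u<..v}) \<le> v - u" if "u \<le> v" "S \<in> sets borel" for S and u v :: real
  proof -
    have "measure lborel (S \<inter> {u<..v}) \<le> measure lborel {u<..v}"
      by (intro measure_mono_fmeasurable fmeasurableI) (use that in auto)
    then show ?thesis using that by simp
  qed
  have "(({grid t0 t m k<..grid t0 t m (Suc k)} \<inter> {..<t}) \<times> {x<..y}) \<inter> UNIV \<times> {0..1}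
    = ({..<t} \<inter> {grid t0 t m k<..grid t0 t m (Suc k)}) \<times> ({0..1} \<inter> {x<..y})" by auto
  also have "measure lborel \<dots> = measure lborel ({..<t} \<inter> {grid t0 t m k<..grid t0 t m (Suc k)}) * measure lborel ({0..1} \<inter> {x<..y})"
    by (rule measure_lborel_Times) auto
  also have "\<dots> \<le> (t - t0) / real (Suc m) * (y - x)"
  proof (rule mult_mono)
    have "0 \<le> (t - t0) / real (Suc m)" using assms by simp
    then show "measure lborel ({..<t} \<inter> {grid t0 t m k<..grid t0 t m (Suc k)}) \<le> (t - t0) / real (Suc m)"
      using le[of "grid t0 t m k" "grid t0 t m (Suc k)" "{..<t}"] by (simp add: grid_step)
  qed (use le[OF assms(2), of "{0..1}"] assms in auto)
  finally show ?thesis .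
qed

text \<open>A discrete compensator formula. Given the rounded values of \<open>u\<close> and
  \<open>v\<close>, the region between the two levels is a fixed box after the sampling time, while
  those values are determined by the past; hence the expected number of atoms in it is the mean of
  its area.\<close>

lemma nn_integral_strip_le:
  fixes u v :: "_ \<Rightarrow> real"
  assumes "t0 \<le> t" and uv: "u \<in> borel_measurable PG" "v \<in> borel_measurable PG"
    and bounds: "\<And>w. w \<in> good \<Longrightarrow> 0 \<le> u w \<and> u w \<le> v w \<and> v w \<le> 1"
    and pst: "\<And>w. u (past (grid t0 t m k) w) = u w \<and> v (past (grid t0 t m k) w) = v w"
  shows "(\<integral>\<^sup>+w. of_nat (card (dep w i \<inter> cell t0 t m k (level q (rounded q (v w))))
      - card (dep w i \<inter> cell t0 t m k (level q (rounded q (u w))))) \<partial>PG)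
    \<le> ennreal ((t - t0) / real (Suc m)) * (\<integral>\<^sup>+w. ennreal (v w - u w + 1 / real (Suc q)) \<partial>PG)"
proof -
  interpret P: prob_space P by (rule prob_space_P)
  define h where "h = (t - t0) / real (Suc m)"
  have h: "0 \<le> h" using \<open>t0 \<le> t\<close> by (simp add: h_def)
  define T where "T = grid t0 t m k"
  \<comment> \<open>All pairs of rounded rates; finite because rates lie between 0 and 1.\<close>
  define Z where "Z = {0..int (Suc q)} \<times> {0..int (Suc q)}"
  define X where "X z = {w \<in> good. rounded q (u w) = fst z \<and> rounded q (v w) = snd z}" for z
  define B where "B z = ({grid t0 t m k<..grid t0 t m (Suc k)} \<inter> {..<t}) \<times> {level q (fst z)<..level q (snd z)}" for z
  \<comment> \<open>Factorisation needs an event about the past, so \<open>X z\<close> is replaced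
    by the event that the past belongs to it. The two agree for regular inputs, because
    \<open>u\<close> and \<open>v\<close> do not change under \<open>past\<close>.\<close>
  define Y where "Y z = {w \<in> space P. past T w \<in> X z}" for z
  have B: "B z \<in> sets borel" "bounded (B z)" "B z \<inter> {..T} \<times> UNIV = {}" for z
    unfolding B_def T_def by (auto intro!: borel_Times bounded_Times bounded_Int)
  have X: "X z \<in> sets P" for z
  proof -
    have "{w \<in> space PG. rounded q (u w) = fst z \<and> rounded q (v w) = snd z} \<in> sets PG"
      unfolding rounded_def using uv by measurable
    then show ?thesis unfolding X_def by (simp add: sets_PG space_PG)
  qed
  have Y: "Y z \<in> sets P" for z unfolding Y_def by (rule past_set_measurable[OF X])
  have XY: "w \<in> Y z \<longleftrightarrow> w \<in> X z" if "w \<in> good" for w z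
    using that past_good[OF that, of T] good_space[OF that] pst[of w] unfolding X_def Y_def T_def by auto
  have emXY: "emeasure P (Y z) = emeasure P (X z)" for z
  proof (rule emeasure_eq_AE[OF _ Y X])
    show "AE w in P. w \<in> Y z \<longleftrightarrow> w \<in> X z" using AE_good by eventually_elim (rule XY)
  qed
  have inZ: "(rounded q (u w), rounded q (v w)) \<in> Z" if "w \<in> good" for w
    using bounds[OF that] rounded_range[of "u w" q] rounded_range[of "v w" q] unfolding Z_def by auto
  have finZ: "finite Z" by (simp add: Z_def)
  define c where "c w = card (dep w i \<inter> cell t0 t m k (level q (rounded q (v w))))
      - card (dep w i \<inter> cell t0 t m k (level q (rounded q (u w))))" for w
  have c: "c w = card (w (Inr i) \<inter> B (rounded q (u w), rounded q (v w)))" if w: "w \<in> good" for w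
  proof -
    let ?l = "level q (rounded q (u w))" and ?l' = "level q (rounded q (v w))"
    have l: "0 < ?l" "?l \<le> ?l'"
      using bounds[OF w] rounded_range[of "u w" q] by (auto intro!: level_pos level_mono rounded_mono)
    have sub: "w (Inr i) \<inter> cell t0 t m k ?l \<subseteq> w (Inr i) \<inter> cell t0 t m k ?l'"
      using l(2) unfolding cell_def by auto
    have "finite (w (Inr i) \<inter> cell t0 t m k ?l')"
      using good_space[OF w] cell_borel(2) by (auto simp: space_P locally_finite_sets_def)
    then have "c w = card (w (Inr i) \<inter> cell t0 t m k ?l' - w (Inr i) \<inter> cell t0 t m k ?l)"
      unfolding c_def dep_def using card_Diff_subset[OF finite_subset[OF sub] sub] by simp
    also have "w (Inr i) \<inter> cell t0 t m k ?l' - w (Inr i) \<inter> cell t0 t m k ?l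
       = w (Inr i) \<inter> B (rounded q (u w), rounded q (v w))"
      using l unfolding cell_def B_def by auto
    finally show ?thesis .
  qed
  have single: "(\<Sum>z\<in>Z. indicator (X z) w * g z) = g (rounded q (u w), rounded q (v w))"
    if "w \<in> good" for w and g :: "_ \<Rightarrow> ennreal"
  proof -
    have "(\<Sum>z\<in>Z. indicator (X z) w * g z) = (\<Sum>z\<in>Z. if z = (rounded q (u w), rounded q (v w)) then g z else 0)"
      using that by (intro sum.cong) (auto simp: X_def split: split_indicator)
    then show ?thesis using finZ inZ[OF that] by simp
  qed
  have "(\<integral>\<^sup>+w. of_nat (c w) \<partial>PG) = (\<integral>\<^sup>+w. of_nat (c w) * indicator good w \<partial>P)" by (rule nn_integral_PG)
  also have "\<dots> \<le> (\<integral>\<^sup>+w. (\<Sum>z\<in>Z. indicator (Y z) w * of_nat (card (w (Inr i) \<inter> B z))) \<partial>P)"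
  proof (rule nn_integral_mono)
    fix w
    show "of_nat (c w) * indicator good w \<le> (\<Sum>z\<in>Z. indicator (Y z) w * of_nat (card (w (Inr i) \<inter> B z)) :: ennreal)"
    proof (cases "w \<in> good")
      case True
      have "(\<Sum>z\<in>Z. indicator (Y z) w * of_nat (card (w (Inr i) \<inter> B z)) :: ennreal)
        = (\<Sum>z\<in>Z. indicator (X z) w * of_nat (card (w (Inr i) \<inter> B z)))"
        using XY[OF True] by (intro sum.cong) (auto split: split_indicator)
      also have "\<dots> = of_nat (c w)" using single[OF True, of "\<lambda>z. of_nat (card (w (Inr i) \<inter> B z))"] c[OF True] by simp
      finally show ?thesis using True by simp
    qed simp
  qed
  also have "\<dots> = (\<Sum>z\<in>Z. \<integral>\<^sup>+w. indicator (Y z) w * of_nat (card (w (Inr i) \<inter> B z)) \<partial>P)"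
  proof (rule nn_integral_sum)
    fix z
    have "(\<lambda>w. of_nat (card (w (Inr i) \<inter> B z)) :: ennreal) \<in> borel_measurable P"
      by (rule measurable_compose[OF count_measurable[OF B(1,2)]]) simp
    then show "(\<lambda>w. indicator (Y z) w * of_nat (card (w (Inr i) \<inter> B z)) :: ennreal) \<in> borel_measurable P"
      using Y[of z] by measurable
  qed
  also have "\<dots> \<le> (\<Sum>z\<in>Z. emeasure P (X z) * ennreal (h * (level q (snd z) - level q (fst z))))"
  proof (rule sum_mono)
    fix z
    show "(\<integral>\<^sup>+w. indicator (Y z) w * of_nat (card (w (Inr i) \<inter> B z)) \<partial>P)
      \<le> emeasure P (X z) * ennreal (h * (level q (snd z) - level q (fst z)))"
    proof (cases "fst z \<le> snd z")
      case True
      have "(\<integral>\<^sup>+w. indicator (Y z) w * of_nat (card (w (Inr i) \<inter> B z)) \<partial>P)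
        = emeasure P (Y z) * ennreal (measure lborel (B z \<inter> UNIV \<times> {0..1}))"
        unfolding Y_def by (rule nn_integral_past_future[OF X B])
      also have "\<dots> \<le> emeasure P (X z) * ennreal (h * (level q (snd z) - level q (fst z)))"
        unfolding emXY B_def h_def
        by (intro mult_left_mono ennreal_leI measure_strip_le[OF \<open>t0 \<le> t\<close>] level_mono True) auto
      finally show ?thesis .
    next
      case False
      then have "B z = {}" using level_mono[of "snd z" "fst z" q] by (auto simp: B_def)
      then show ?thesis by simp
    qed
  qed
  also have "\<dots> = (\<Sum>z\<in>Z. \<integral>\<^sup>+w. indicator (X z) w * ennreal (h * (level q (snd z) - level q (fst z))) \<partial>P)"
    using X by (intro sum.cong refl) (subst nn_integral_multc, auto)
  also have "\<dots> = (\<integral>\<^sup>+w. (\<Sum>z\<in>Z. indicator (X z) w * ennreal (h * (level q (snd z) - level q (fst z)))) \<partial>P)"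
    by (rule nn_integral_sum[symmetric]) (use X in auto)
  also have "\<dots> \<le> (\<integral>\<^sup>+w. ennreal h * ennreal (v w - u w + 1 / real (Suc q)) * indicator good w \<partial>P)"
  proof (rule nn_integral_mono)
    fix w
    show "(\<Sum>z\<in>Z. indicator (X z) w * ennreal (h * (level q (snd z) - level q (fst z))))
      \<le> ennreal h * ennreal (v w - u w + 1 / real (Suc q)) * indicator good w"
    proof (cases "w \<in> good")
      case True
      have "(\<Sum>z\<in>Z. indicator (X z) w * ennreal (h * (level q (snd z) - level q (fst z))))
        = ennreal (h * (level q (rounded q (v w)) - level q (rounded q (u w))))"
        using single[OF True, of "\<lambda>z. ennreal (h * (level q (snd z) - level q (fst z)))"] by simp
      \<comment> \<open>The upper level exceeds \<open>v\<close> by at most 2 / (q + 1), the lower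
        one exceeds \<open>u\<close> by at least 1 / (q + 1); the difference is the summand 1 / (q +
        1).\<close>
      also have "\<dots> \<le> ennreal (h * (v w - u w + 1 / real (Suc q)))"
        using level_rounded(2)[of q "v w"] level_rounded(1)[of "u w" q] h
        by (intro ennreal_leI mult_left_mono) (auto simp: add_divide_distrib[symmetric] field_simps)
      also have "\<dots> = ennreal h * ennreal (v w - u w + 1 / real (Suc q))"
        using bounds[OF True] h by (intro ennreal_mult) auto
      finally show ?thesis using True by simp
    next
      case False
      then show ?thesis by (simp add: X_def)
    qed
  qed
  also have "\<dots> = (\<integral>\<^sup>+w. ennreal h * ennreal (v w - u w + 1 / real (Suc q)) \<partial>PG)" by (rule nn_integral_PG[symmetric])
  also have "\<dots> = ennreal h * (\<integral>\<^sup>+w. ennreal (v w - u w + 1 / real (Suc q)) \<partial>PG)"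
    by (rule nn_integral_cmult) (use uv in measurable)
  finally show ?thesis unfolding c_def h_def .
qed

text \<open>The k-fold iterated integral: at stage 0 the mean number of arrivals, and each further
  stage is the sum of the weights times the integral of the previous stage from \<open>t0\<close> to
  \<open>t\<close>.\<close>

definition gap_bound :: "real \<Rightarrow> nat \<Rightarrow> real \<Rightarrow> real" where
  "gap_bound t0 k t = lam * (\<Sum>\<^sub>\<infinity>j. a j) ^ k * (t - t0) ^ Suc k / fact (Suc k)"

lemma sum_a_nonneg: "0 \<le> (\<Sum>\<^sub>\<infinity>j. a j)"
  by (rule infsum_nonneg) (rule a_nonneg)

lemma gap_bound_nonneg: "t0 \<le> t \<Longrightarrow> 0 \<le> gap_bound t0 k t"
  unfolding gap_bound_def using lam_nonneg sum_a_nonneg by (intro divide_nonneg_nonneg mult_nonneg_nonneg) auto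

text \<open>On one interval the increasing function (n + 1) x^n is at most its mean, so its value at
  the left end underestimates the integral. Algebraically, every term of the factorisation of the
  difference of powers is at least x^n.\<close>

lemma power_riemann_sum_le:
  assumes "0 \<le> x" "x \<le> y"
  shows "(y - x) * x ^ n * real (Suc n) \<le> y ^ Suc n - x ^ Suc n"
proof -
  have "(y - x) * (\<Sum>p<Suc n. x ^ n) \<le> (y - x) * (\<Sum>p<Suc n. x ^ p * y ^ (n - p))"
  proof (intro mult_left_mono sum_mono)
    fix p assume "p \<in> {..<Suc n}"
    then have "x ^ n = x ^ p * x ^ (n - p)" by (simp flip: power_add)
    also have "\<dots> \<le> x ^ p * y ^ (n - p)" using assms by (intro mult_left_mono power_mono) auto
    finally show "x ^ n \<le> x ^ p * y ^ (n - p)" .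
  qed (use assms in auto)
  also have "\<dots> = y ^ Suc n - x ^ Suc n"
    using diff_power_eq_sum[of x n y] by (simp only: minus_diff_eq[of "x ^ Suc n", symmetric] minus_diff_eq[of x, symmetric] mult_minus_left)
  finally show ?thesis by (simp add: mult_ac)
qed

text \<open>Left Riemann sums of an increasing power lie below the integral, so no discretisation
  error is left; the bounds of the single cells telescope.\<close>

lemma gap_bound_riemann_sum_le:
  assumes "t0 \<le> t"
  shows "(\<Sum>j\<le>m. (t - t0) / real (Suc m) * ((\<Sum>\<^sub>\<infinity>j. a j) * gap_bound t0 k (grid t0 t m j))) \<le> gap_bound t0 (Suc k) t"
proof -
  define C where "C = (\<Sum>\<^sub>\<infinity>j. a j)"
  define y where "y j = grid t0 t m j - t0" for j
  have "(t - t0) / real (Suc m) * (C * gap_bound t0 k (grid t0 t m j))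
     \<le> lam * C ^ Suc k / fact (Suc (Suc k)) * (y (Suc j) ^ Suc (Suc k) - y j ^ Suc (Suc k))" for j
  proof -
    have yj: "0 \<le> y j" "y j \<le> y (Suc j)" "y (Suc j) - y j = (t - t0) / real (Suc m)"
      using assms grid_ge[OF assms, of m j] by (auto simp: y_def grid_step)
    have f: "(fact (Suc (Suc k)) :: real) = real (Suc (Suc k)) * fact (Suc k)" by (rule fact_Suc)
    have "(t - t0) / real (Suc m) * (C * gap_bound t0 k (grid t0 t m j))
      = lam * C ^ Suc k / fact (Suc (Suc k)) * ((y (Suc j) - y j) * y j ^ Suc k * real (Suc (Suc k)))"
      unfolding gap_bound_def C_def[symmetric] yj(3) f y_def[symmetric] by (simp add: divide_simps del: of_nat_Suc fact_Suc)
    also have "\<dots> \<le> lam * C ^ Suc k / fact (Suc (Suc k)) * (y (Suc j) ^ Suc (Suc k) - y j ^ Suc (Suc k))"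
      using lam_nonneg sum_a_nonneg power_riemann_sum_le[OF yj(1,2), of "Suc k"]
      by (intro mult_left_mono) (auto simp: C_def)
    finally show ?thesis .
  qed
  then have "(\<Sum>j\<le>m. (t - t0) / real (Suc m) * (C * gap_bound t0 k (grid t0 t m j)))
    \<le> (\<Sum>j\<le>m. lam * C ^ Suc k / fact (Suc (Suc k)) * (y (Suc j) ^ Suc (Suc k) - y j ^ Suc (Suc k)))"
    by (rule sum_mono)
  also have "\<dots> = lam * C ^ Suc k / fact (Suc (Suc k)) * (y (Suc m) ^ Suc (Suc k) - y 0 ^ Suc (Suc k))"
    using sum_lessThan_telescope[of "\<lambda>j. y j ^ Suc (Suc k)" "Suc m"]
    by (simp only: sum_distrib_left[symmetric] lessThan_Suc_atMost)
  also have "\<dots> = gap_bound t0 (Suc k) t"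
    unfolding y_def grid_last by (simp add: grid_def gap_bound_def C_def)
  finally show ?thesis unfolding C_def .
qed

text \<open>The pointwise Lipschitz bound is a convolution with \<open>a\<close>. Integrating term
  by term and using a bound \<open>b\<close> common to all sites turns it into the total weight
  times \<open>b\<close>.\<close>

lemma nn_integral_rate_gap_le:
  assumes IH: "\<And>i. (\<integral>\<^sup>+w. of_nat (up w t0 k i r - lo w t0 k i r) \<partial>PG) \<le> ennreal b" and "0 \<le> b"
  shows "(\<integral>\<^sup>+w. ennreal (fast w t0 k i r - slow w t0 k i r) \<partial>PG) \<le> ennreal ((\<Sum>\<^sub>\<infinity>j. a j) * b)"
proof -
  have m: "(\<lambda>w. of_nat (up w t0 k (i - j) r - lo w t0 k (i - j) r) :: ennreal) \<in> borel_measurable PG" for j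
  proof -
    note [measurable] = bracket_measurable[of t0 k "i - j" r, THEN conjunct1] bracket_measurable[of t0 k "i - j" r, THEN conjunct2]
    have "(\<lambda>w. up w t0 k (i - j) r - lo w t0 k (i - j) r) \<in> measurable PG (count_space UNIV)" by measurable
    then show ?thesis by (rule measurable_compose) simp
  qed
  have "(\<integral>\<^sup>+w. ennreal (fast w t0 k i r - slow w t0 k i r) \<partial>PG)
    \<le> (\<integral>\<^sup>+w. (\<integral>\<^sup>+j. ennreal (a j) * of_nat (up w t0 k (i - j) r - lo w t0 k (i - j) r) \<partial>count_space UNIV) \<partial>PG)"
  proof (rule nn_integral_mono)
    fix w assume "w \<in> space PG"
    then interpret I: interference_input a "arr w" "dep w" by (intro good_input) (simp add: space_PG)
    have nn: "0 \<le> a j * (real (up w t0 k (i - j) r) - real (lo w t0 k (i - j) r))" for j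
      using I.lower_le_upper by (auto intro!: mult_nonneg_nonneg a_nonneg)
    have "(\<lambda>j. a j * real (up w t0 k (i - j) r)) summable_on UNIV"
      using I.summable_upper unfolding summable_config_def by blast
    then have sm: "(\<lambda>j. a j * (real (up w t0 k (i - j) r) - real (lo w t0 k (i - j) r))) summable_on UNIV"
      by (rule summable_on_comparison_test) (use nn in \<open>auto intro!: mult_left_mono simp: a_nonneg\<close>)
    have "ennreal (fast w t0 k i r - slow w t0 k i r)
      \<le> ennreal (\<Sum>\<^sub>\<infinity>j. a j * (real (up w t0 k (i - j) r) - real (lo w t0 k (i - j) r)))"
      by (intro ennreal_leI I.rate_gap)
    also have "\<dots> = (\<integral>\<^sup>+j. ennreal (a j * (real (up w t0 k (i - j) r) - real (lo w t0 k (i - j) r))) \<partial>count_space UNIV)"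
      by (rule ennreal_infsum[OF nn sm])
    also have "\<dots> = (\<integral>\<^sup>+j. ennreal (a j) * of_nat (up w t0 k (i - j) r - lo w t0 k (i - j) r) \<partial>count_space UNIV)"
      using I.lower_le_upper
      by (intro nn_integral_cong) (simp add: ennreal_mult a_nonneg ennreal_of_nat_eq_real_of_nat of_nat_diff)
    finally show "ennreal (fast w t0 k i r - slow w t0 k i r)
      \<le> (\<integral>\<^sup>+j. ennreal (a j) * of_nat (up w t0 k (i - j) r - lo w t0 k (i - j) r) \<partial>count_space UNIV)" .
  qed
  also have "(\<integral>\<^sup>+w. (\<integral>\<^sup>+j. ennreal (a j) * of_nat (up w t0 k (i - j) r - lo w t0 k (i - j) r) \<partial>count_space UNIV) \<partial>PG)
    = (\<integral>\<^sup>+j. (\<integral>\<^sup>+w. ennreal (a j) * of_nat (up w t0 k (i - j) r - lo w t0 k (i - j) r) \<partial>PG) \<partial>count_space UNIV)"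
    by (rule nn_integral_count_space_nn_integral) (use m in auto)
  also have "\<dots> \<le> (\<integral>\<^sup>+j. ennreal (a j * b) \<partial>count_space UNIV)"
  proof (rule nn_integral_mono)
    fix j
    have "(\<integral>\<^sup>+w. ennreal (a j) * of_nat (up w t0 k (i - j) r - lo w t0 k (i - j) r) \<partial>PG)
      = ennreal (a j) * (\<integral>\<^sup>+w. of_nat (up w t0 k (i - j) r - lo w t0 k (i - j) r) \<partial>PG)"
      by (rule nn_integral_cmult[OF m])
    also have "\<dots> \<le> ennreal (a j) * ennreal b" by (intro mult_left_mono IH) simp
    finally show "(\<integral>\<^sup>+w. ennreal (a j) * of_nat (up w t0 k (i - j) r - lo w t0 k (i - j) r) \<partial>PG) \<le> ennreal (a j * b)"
      using \<open>0 \<le> b\<close> by (simp add: ennreal_mult a_nonneg)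
  qed
  also have "\<dots> = ennreal (\<Sum>\<^sub>\<infinity>j. a j * b)"
    by (rule ennreal_infsum[symmetric]) (use a_summable a_nonneg \<open>0 \<le> b\<close> in \<open>auto intro: summable_on_cmult_left\<close>)
  also have "(\<Sum>\<^sub>\<infinity>j. a j * b) = (\<Sum>\<^sub>\<infinity>j. a j) * b" by (rule infsum_cmult_left) (use a_summable in simp)
  finally show ?thesis .
qed

text \<open>The strip estimates are summed over the time cells. The rate gaps add up to a Riemann
  sum, and the rounding errors to the elapsed time divided by q + 1, whatever the number of
  cells.\<close>

lemma grid_gap_le:
  assumes "t0 \<le> t"
    and IH: "\<And>i r. t0 \<le> r \<Longrightarrow> (\<integral>\<^sup>+w. of_nat (up w t0 k i r - lo w t0 k i r) \<partial>PG) \<le> ennreal (gap_bound t0 k r)"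
  shows "(\<integral>\<^sup>+w. of_nat (grid_departures (dep w i) t0 t q m (fast w t0 k i)
      - grid_departures (dep w i) t0 t q m (slow w t0 k i)) \<partial>PG)
    \<le> ennreal (gap_bound t0 (Suc k) t + (t - t0) / real (Suc q))"
proof -
  interpret PG: prob_space PG by (rule prob_space_PG)
  define C where "C = (\<Sum>\<^sub>\<infinity>j. a j)"
  define h where "h = (t - t0) / real (Suc m)"
  have h: "0 \<le> h" using assms(1) by (simp add: h_def)
  define g where "g j = grid t0 t m j" for j
  have g: "t0 \<le> g j" for j unfolding g_def by (rule grid_ge[OF assms(1)])
  define c where "c R w j = card (dep w i \<inter> cell t0 t m j (level q (rounded q (R (g j)))))" for R w j
  have cm: "(\<lambda>w. c (fast w t0 k i) w j) \<in> measurable PG (count_space UNIV)"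
    "(\<lambda>w. c (slow w t0 k i) w j) \<in> measurable PG (count_space UNIV)" for j
    unfolding c_def by (intro cell_count_measurable rate_measurable)+
  have "(\<Sum>j\<in>J. x j) - (\<Sum>j\<in>J. y j) \<le> (\<Sum>j\<in>J. x j - y j)" if "finite J" for J and x y :: "nat \<Rightarrow> nat"
    using that by (induction J) auto
  then have "(\<integral>\<^sup>+w. of_nat (grid_departures (dep w i) t0 t q m (fast w t0 k i)
      - grid_departures (dep w i) t0 t q m (slow w t0 k i)) \<partial>PG)
    \<le> (\<integral>\<^sup>+w. of_nat (\<Sum>j\<le>m. c (fast w t0 k i) w j - c (slow w t0 k i) w j) \<partial>PG)"
    unfolding grid_departures_def c_def g_def by (intro nn_integral_mono of_nat_mono) auto
  also have "\<dots> = (\<Sum>j\<le>m. \<integral>\<^sup>+w. of_nat (c (fast w t0 k i) w j - c (slow w t0 k i) w j) \<partial>PG)"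
    unfolding of_nat_sum
  proof (rule nn_integral_sum)
    fix j
    note [measurable] = cm[of j]
    have "(\<lambda>w. c (fast w t0 k i) w j - c (slow w t0 k i) w j) \<in> measurable PG (count_space UNIV)" by measurable
    then show "(\<lambda>w. of_nat (c (fast w t0 k i) w j - c (slow w t0 k i) w j) :: ennreal) \<in> borel_measurable PG"
      by (rule measurable_compose) simp
  qed
  also have "\<dots> \<le> (\<Sum>j\<le>m. ennreal (h * (C * gap_bound t0 k (g j)) + h / real (Suc q)))"
  proof (rule sum_mono)
    fix j
    have "(\<integral>\<^sup>+w. of_nat (c (fast w t0 k i) w j - c (slow w t0 k i) w j) \<partial>PG)
      \<le> ennreal h * (\<integral>\<^sup>+w. ennreal (fast w t0 k i (g j) - slow w t0 k i (g j) + 1 / real (Suc q)) \<partial>PG)"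
      unfolding c_def h_def g_def
      by (rule nn_integral_strip_le[OF assms(1) rate_measurable])
        (auto simp: rate_past interference_input.rate_interference_bounds[OF good_input])
    also have "(\<integral>\<^sup>+w. ennreal (fast w t0 k i (g j) - slow w t0 k i (g j) + 1 / real (Suc q)) \<partial>PG)
      = (\<integral>\<^sup>+w. ennreal (fast w t0 k i (g j) - slow w t0 k i (g j)) + ennreal (1 / real (Suc q)) \<partial>PG)"
      by (intro nn_integral_cong ennreal_plus)
        (auto simp: space_PG interference_input.rate_interference_bounds[OF good_input])
    also have "\<dots> = (\<integral>\<^sup>+w. ennreal (fast w t0 k i (g j) - slow w t0 k i (g j)) \<partial>PG) + ennreal (1 / real (Suc q))"
    proof -
      note [measurable] = rate_measurable
      have "(\<lambda>w. ennreal (fast w t0 k i (g j) - slow w t0 k i (g j))) \<in> borel_measurable PG" by measurable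
      then show ?thesis by (subst nn_integral_add) (simp_all add: PG.emeasure_space_1)
    qed
    also have "\<dots> \<le> ennreal (C * gap_bound t0 k (g j)) + ennreal (1 / real (Suc q))"
      unfolding C_def by (intro add_right_mono nn_integral_rate_gap_le IH g gap_bound_nonneg)
    also have "\<dots> = ennreal (C * gap_bound t0 k (g j) + 1 / real (Suc q))"
      using sum_a_nonneg gap_bound_nonneg[OF g] by (intro ennreal_plus[symmetric]) (auto simp: C_def)
    finally have "(\<integral>\<^sup>+w. of_nat (c (fast w t0 k i) w j - c (slow w t0 k i) w j) \<partial>PG)
      \<le> ennreal h * ennreal (C * gap_bound t0 k (g j) + 1 / real (Suc q))"
      by (simp add: mult_left_mono)
    also have "\<dots> = ennreal (h * (C * gap_bound t0 k (g j)) + h / real (Suc q))"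
      using sum_a_nonneg gap_bound_nonneg[OF g, of k j] h
      by (subst ennreal_mult[symmetric]) (auto simp: C_def algebra_simps)
    finally show "(\<integral>\<^sup>+w. of_nat (c (fast w t0 k i) w j - c (slow w t0 k i) w j) \<partial>PG)
      \<le> ennreal (h * (C * gap_bound t0 k (g j)) + h / real (Suc q))" .
  qed
  also have "\<dots> = ennreal (\<Sum>j\<le>m. h * (C * gap_bound t0 k (g j)) + h / real (Suc q))"
    using sum_a_nonneg gap_bound_nonneg[OF g] h by (intro sum_ennreal) (auto simp: C_def)
  also have "\<dots> \<le> ennreal (gap_bound t0 (Suc k) t + (t - t0) / real (Suc q))"
  proof (rule ennreal_leI)
    have "(\<Sum>j\<le>m. h / real (Suc q)) = (t - t0) / real (Suc q)" by (simp add: h_def del: of_nat_Suc)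
    then show "(\<Sum>j\<le>m. h * (C * gap_bound t0 k (g j)) + h / real (Suc q)) \<le> gap_bound t0 (Suc k) t + (t - t0) / real (Suc q)"
      using gap_bound_riemann_sum_le[OF assms(1), of m k] by (simp add: sum.distrib h_def C_def g_def)
  qed
  finally show ?thesis .
qed

text \<open>Both bounds share their arrivals, so their gap is controlled by the difference of the
  departures under the two rates. Fatou's lemma, once for each of the two grid limits, transfers the
  estimate from grid departures to true ones, and the rounding error vanishes with
  \<open>q\<close>.\<close>

lemma nn_integral_gap_le:
  "t0 \<le> t \<Longrightarrow> (\<integral>\<^sup>+w. of_nat (up w t0 k i t - lo w t0 k i t) \<partial>PG) \<le> ennreal (gap_bound t0 k t)"
proof (induction k arbitrary: i t)
  case 0
  have "(\<integral>\<^sup>+w. of_nat (up w t0 0 i t - lo w t0 0 i t) \<partial>PG) \<le> (\<integral>\<^sup>+w. of_nat (arrivals (arr w i) t0 t) \<partial>P)"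
    unfolding nn_integral_PG by (intro nn_integral_mono) (auto split: split_indicator)
  also have "\<dots> = ennreal (gap_bound t0 0 t)" by (simp add: nn_integral_arrivals[OF 0] gap_bound_def)
  finally show ?case .
next
  case (Suc k)
  define d where "d q m w = grid_departures (dep w i) t0 t q m (fast w t0 k i) - grid_departures (dep w i) t0 t q m (slow w t0 k i)" for q m w
  have dm: "(\<lambda>w. of_nat (d q m w) :: ennreal) \<in> borel_measurable PG" for q m
  proof -
    note [measurable] = grid_departures_measurable[OF rate_measurable(1)] grid_departures_measurable[OF rate_measurable(2)]
    have "d q m \<in> measurable PG (count_space UNIV)" unfolding d_def by measurable
    then show ?thesis by (rule measurable_compose) simp
  qed
  have "(\<integral>\<^sup>+w. of_nat (up w t0 (Suc k) i t - lo w t0 (Suc k) i t) \<partial>PG)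
    \<le> (\<integral>\<^sup>+w. liminf (\<lambda>q. liminf (\<lambda>m. of_nat (d q m w))) \<partial>PG)"
  proof (rule nn_integral_mono)
    fix w assume "w \<in> space PG"
    then have w: "w \<in> good" by (simp add: space_PG)
    interpret I: interference_input a "arr w" "dep w" by (rule good_input[OF w])
    show "of_nat (up w t0 (Suc k) i t - lo w t0 (Suc k) i t) \<le> liminf (\<lambda>q. liminf (\<lambda>m. of_nat (d q m w) :: ennreal))"
    proof (cases "t0 < t")
      case True
      define e where "e = departures (dep w i) t0 t (fast w t0 k i) - departures (dep w i) t0 t (slow w t0 k i)"
      have "\<forall>\<^sub>F q in sequentially. \<forall>\<^sub>F m in sequentially. grid_departures (dep w i) t0 t q m (fast w t0 k i) = departures (dep w i) t0 t (fast w t0 k i)"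
        by (rule queue_input.grid_departures_eventually[OF I.inputs True]) (rule I.rates_left_limit)
      moreover have "\<forall>\<^sub>F q in sequentially. \<forall>\<^sub>F m in sequentially. grid_departures (dep w i) t0 t q m (slow w t0 k i) = departures (dep w i) t0 t (slow w t0 k i)"
        by (rule queue_input.grid_departures_eventually[OF I.inputs True]) (rule I.rates_left_limit)
      ultimately have "\<forall>\<^sub>F q in sequentially. \<forall>\<^sub>F m in sequentially. d q m w = e"
        by eventually_elim (rule eventually_elim2, assumption, assumption, simp add: d_def e_def)
      then have "\<forall>\<^sub>F q in sequentially. liminf (\<lambda>m. of_nat (d q m w) :: ennreal) = of_nat e"
        by eventually_elim (intro lim_imp_Liminf tendsto_eventually, auto elim: eventually_mono)
      then have "liminf (\<lambda>q. liminf (\<lambda>m. of_nat (d q m w) :: ennreal)) = of_nat e"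
        by (intro lim_imp_Liminf tendsto_eventually) auto
      \<comment> \<open>With truncated subtraction the arrivals still cancel: (x - y) - (x - z)
        \<le> z - y.\<close>
      moreover have "up w t0 (Suc k) i t - lo w t0 (Suc k) i t \<le> e"
        unfolding upper_Suc lower_Suc e_def by linarith
      ultimately show ?thesis by simp
    next
      case False
      then have "arrivals (arr w i) t0 t = 0" by (intro I.arrivals_before_start) simp
      then have "up w t0 (Suc k) i t = 0" using I.upper_le[of t0 "Suc k" i t] by (simp del: upper.simps)
      then show ?thesis by (simp del: upper.simps)
    qed
  qed
  also have "\<dots> \<le> liminf (\<lambda>q. \<integral>\<^sup>+w. liminf (\<lambda>m. of_nat (d q m w)) \<partial>PG)"
    by (rule nn_integral_liminf) (use dm in measurable)
  also have "\<dots> \<le> liminf (\<lambda>q. ennreal (gap_bound t0 (Suc k) t + (t - t0) / real (Suc q)))"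
  proof (intro Liminf_mono always_eventually allI)
    fix q
    have "(\<integral>\<^sup>+w. liminf (\<lambda>m. of_nat (d q m w)) \<partial>PG) \<le> liminf (\<lambda>m. \<integral>\<^sup>+w. of_nat (d q m w) \<partial>PG)"
      by (rule nn_integral_liminf) (rule dm)
    also have "\<dots> \<le> liminf (\<lambda>m::nat. ennreal (gap_bound t0 (Suc k) t + (t - t0) / real (Suc q)))"
      unfolding d_def by (intro Liminf_mono always_eventually allI grid_gap_le Suc)
    finally show "(\<integral>\<^sup>+w. liminf (\<lambda>m. of_nat (d q m w)) \<partial>PG) \<le> ennreal (gap_bound t0 (Suc k) t + (t - t0) / real (Suc q))"
      by (simp add: Liminf_const)
  qed
  also have "\<dots> = ennreal (gap_bound t0 (Suc k) t)"
  proof (rule lim_imp_Liminf)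
    have "(\<lambda>q. gap_bound t0 (Suc k) t + (t - t0) / real (Suc q)) \<longlonglongrightarrow> gap_bound t0 (Suc k) t + 0"
      by (intro tendsto_intros LIMSEQ_Suc[OF lim_const_over_n])
    then show "(\<lambda>q. ennreal (gap_bound t0 (Suc k) t + (t - t0) / real (Suc q))) \<longlonglongrightarrow> ennreal (gap_bound t0 (Suc k) t)"
      by (intro tendsto_ennrealI) simp
  qed simp
  finally show ?case .
qed

lemma gap_bound_tendsto_0: "(\<lambda>k. gap_bound t0 k t) \<longlonglongrightarrow> 0"
proof -
  define C where "C = (\<Sum>\<^sub>\<infinity>j. a j)"
  \<comment> \<open>The base C + 1 is at least 1, so the exponent k can be raised to k + 1 and the
    bound becomes a term of the exponential series.\<close>
  define x where "x = (C + 1) * (t - t0)"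
  have C: "0 \<le> C" unfolding C_def by (rule sum_a_nonneg)
  have "(\<lambda>k. \<bar>x\<bar> ^ k / fact k) \<longlonglongrightarrow> 0"
    using summable_LIMSEQ_zero[OF summable_exp[of "\<bar>x\<bar>"]] by (simp add: divide_inverse mult.commute)
  then have lim: "(\<lambda>k. lam * (\<bar>x\<bar> ^ Suc k / fact (Suc k))) \<longlonglongrightarrow> lam * 0"
    by (intro tendsto_intros LIMSEQ_Suc)
  show ?thesis
  proof (rule Lim_null_comparison)
    show "(\<lambda>k. lam * (\<bar>x\<bar> ^ Suc k / fact (Suc k))) \<longlonglongrightarrow> 0" using lim by simp
    have "norm (gap_bound t0 k t) \<le> lam * (\<bar>x\<bar> ^ Suc k / fact (Suc k))" for k
    proof -
      have "norm (gap_bound t0 k t) = lam * ((C ^ k * \<bar>t - t0\<bar> ^ Suc k) / fact (Suc k))"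
        unfolding gap_bound_def C_def[symmetric] using lam_nonneg C by (simp add: abs_mult power_abs del: power_Suc)
      also have "\<dots> \<le> lam * (((C + 1) ^ Suc k * \<bar>t - t0\<bar> ^ Suc k) / fact (Suc k))"
      proof (intro mult_left_mono divide_right_mono mult_right_mono)
        have "C ^ k \<le> (C + 1) ^ k" using C by (intro power_mono) auto
        also have "\<dots> \<le> (C + 1) ^ Suc k" using C by (intro power_increasing) auto
        finally show "C ^ k \<le> (C + 1) ^ Suc k" .
      qed (use lam_nonneg in auto)
      also have "(C + 1) ^ Suc k * \<bar>t - t0\<bar> ^ Suc k = \<bar>x\<bar> ^ Suc k"
        unfolding x_def using C by (simp only: abs_mult power_mult_distrib)
      finally show ?thesis .
    qed
    then show "\<forall>\<^sub>F k in sequentially. norm (gap_bound t0 k t) \<le> lam * (\<bar>x\<bar> ^ Suc k / fact (Suc k))"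
      by (intro always_eventually allI)
  qed
qed

text \<open>Bounds that differ are at least 1 apart, so the probability that they never meet is at
  most the expected gap at any stage, which tends to 0.\<close>

lemma AE_merge: "AE w in PG. \<exists>k. up w t0 k i t = lo w t0 k i t"
proof -
  interpret PG: prob_space PG by (rule prob_space_PG)
  note m = bracket_measurable[of t0 _ i t, THEN conjunct1] bracket_measurable[of t0 _ i t, THEN conjunct2]
  define E where "E = {w \<in> space PG. \<forall>k. up w t0 k i t \<noteq> lo w t0 k i t}"
  have E: "E \<in> sets PG" unfolding E_def using m by measurable
  show ?thesis
  proof (cases "t0 \<le> t")
    case True
    have "emeasure PG E \<le> ennreal (gap_bound t0 k t)" for k
    proof -
      have "emeasure PG E = (\<integral>\<^sup>+w. indicator E w \<partial>PG)" using E by simp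
      also have "\<dots> \<le> (\<integral>\<^sup>+w. of_nat (up w t0 k i t - lo w t0 k i t) \<partial>PG)"
      proof (intro nn_integral_mono)
        fix w assume "w \<in> space PG"
        then have le: "lo w t0 k i t \<le> up w t0 k i t"
          using interference_input.lower_le_upper[OF good_input] by (simp add: space_PG)
        show "indicator E w \<le> (of_nat (up w t0 k i t - lo w t0 k i t) :: ennreal)"
        proof (cases "w \<in> E")
          case True
          then have "up w t0 k i t \<noteq> lo w t0 k i t" unfolding E_def by blast
          with le have "1 \<le> up w t0 k i t - lo w t0 k i t" by linarith
          then have "of_nat 1 \<le> (of_nat (up w t0 k i t - lo w t0 k i t) :: ennreal)" by (rule of_nat_mono)
          with True show ?thesis by simp
        qed simp
      qed
      also have "\<dots> \<le> ennreal (gap_bound t0 k t)" by (rule nn_integral_gap_le[OF True])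
      finally show ?thesis .
    qed
    moreover have "(\<lambda>k. ennreal (gap_bound t0 k t)) \<longlonglongrightarrow> ennreal 0" by (intro tendsto_ennrealI gap_bound_tendsto_0)
    ultimately have "emeasure PG E \<le> ennreal 0" by (intro LIMSEQ_le_const) auto
    then have "E \<in> null_sets PG" using E by (auto simp: null_sets_def)
    then have "AE w in PG. w \<notin> E" by (rule AE_not_in)
    then show ?thesis using AE_space by eventually_elim (auto simp: E_def)
  next
    case False
    show ?thesis
    proof (rule AE_I2, rule exI)
      fix w assume "w \<in> space PG"
      show "up w t0 0 i t = lo w t0 0 i t" using False by (simp add: arrivals_def)
    qed
  qed
qed

end

section \<open>Consequences of strong mixing\<close>

lemma LIMSEQ_of_uniform_approximation:
  fixes y :: "nat \<Rightarrow> real"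
  assumes lim: "\<And>k. (\<lambda>n. x k n) \<longlonglongrightarrow> l k" and e: "e \<longlonglongrightarrow> 0"
    and y: "\<And>k n. \<bar>y n - x k n\<bar> \<le> e k" and l: "\<And>k. \<bar>L - l k\<bar> \<le> e k"
  shows "y \<longlonglongrightarrow> L"
proof (rule LIMSEQ_I)
  fix r :: real assume r: "0 < r"
  obtain k where k: "e k < r / 3" using order_tendstoD(2)[OF e, of "r / 3"] r
    by (auto dest!: eventually_happens)
  obtain N where N: "\<And>n. n \<ge> N \<Longrightarrow> \<bar>x k n - l k\<bar> < r / 3"
    using LIMSEQ_D[OF lim[of k], of "r / 3"] r by auto
  have "norm (y n - L) < r" if "n \<ge> N" for n
    using N[OF that] y[of n k] l[of k] k unfolding real_norm_def by linarith
  then show "\<exists>N. \<forall>n\<ge>N. norm (y n - L) < r" by blast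
qed

locale mixing_system = prob_space \<mu> for \<mu> :: "'a measure" +
  fixes T :: "'a \<Rightarrow> 'a"
  assumes T_measurable: "T \<in> measurable \<mu> \<mu>" and T_preserving: "distr \<mu> \<mu> T = \<mu>"
    and mixing: "strongly_mixing \<mu> T"
begin

lemma power_measurable [measurable]: "T ^^ n \<in> measurable \<mu> \<mu>"
  and power_preserving: "distr \<mu> \<mu> (T ^^ n) = \<mu>"
proof (induction n)
  case 0
  { case 1 show ?case by (simp add: id_def) }
  { case 2 show ?case by (simp add: id_def distr_id) }
next
  case (Suc n)
  { case 1 show ?case using measurable_compose[OF Suc(1) T_measurable] by (simp add: comp_def) }
  { case 2
    have "distr \<mu> \<mu> (T ^^ Suc n) = distr (distr \<mu> \<mu> (T ^^ n)) \<mu> T"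
      by (subst distr_distr[OF T_measurable Suc(1)]) simp
    then show ?case by (simp only: Suc(2) T_preserving) }
qed

section \<open>Decorrelation of square integrable functions\<close>

definition square_integrable :: "('a \<Rightarrow> real) \<Rightarrow> bool" where
  "square_integrable f \<longleftrightarrow> f \<in> borel_measurable \<mu> \<and> integrable \<mu> (\<lambda>x. (f x)\<^sup>2)"

lemma square_integrable_power:
  assumes "square_integrable g"
  shows "square_integrable (\<lambda>x. g ((T ^^ n) x))" "(\<integral>x. (g ((T ^^ n) x))\<^sup>2 \<partial>\<mu>) = (\<integral>x. (g x)\<^sup>2 \<partial>\<mu>)"
    "(\<integral>x. g ((T ^^ n) x) \<partial>\<mu>) = (\<integral>x. g x \<partial>\<mu>)"
proof -
  have g [measurable]: "g \<in> borel_measurable \<mu>" and i: "integrable \<mu> (\<lambda>x. (g x)\<^sup>2)"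
    using assms by (auto simp: square_integrable_def)
  have "integrable (distr \<mu> \<mu> (T ^^ n)) (\<lambda>x. (g x)\<^sup>2)" by (simp add: power_preserving i)
  then show "square_integrable (\<lambda>x. g ((T ^^ n) x))"
    unfolding square_integrable_def by (subst (asm) integrable_distr_eq) auto
  have "(\<integral>x. (g x)\<^sup>2 \<partial>distr \<mu> \<mu> (T ^^ n)) = (\<integral>x. (g ((T ^^ n) x))\<^sup>2 \<partial>\<mu>)" by (rule integral_distr) auto
  then show "(\<integral>x. (g ((T ^^ n) x))\<^sup>2 \<partial>\<mu>) = (\<integral>x. (g x)\<^sup>2 \<partial>\<mu>)" by (simp add: power_preserving)
  have "(\<integral>x. g x \<partial>distr \<mu> \<mu> (T ^^ n)) = (\<integral>x. g ((T ^^ n) x) \<partial>\<mu>)" by (rule integral_distr) auto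
  then show "(\<integral>x. g ((T ^^ n) x) \<partial>\<mu>) = (\<integral>x. g x \<partial>\<mu>)" by (simp add: power_preserving)
qed

lemma square_integrable_product:
  assumes "square_integrable f" "square_integrable g"
  shows "integrable \<mu> (\<lambda>x. f x * g x)"
proof (rule Bochner_Integration.integrable_bound)
  show "integrable \<mu> (\<lambda>x. (f x)\<^sup>2 + (g x)\<^sup>2)" using assms by (auto simp: square_integrable_def)
  show "(\<lambda>x. f x * g x) \<in> borel_measurable \<mu>" using assms by (auto simp: square_integrable_def)
  have "\<bar>f x * g x\<bar> \<le> (f x)\<^sup>2 + (g x)\<^sup>2" for x
    using sum_squares_bound[of "\<bar>f x\<bar>" "\<bar>g x\<bar>"] mult_nonneg_nonneg[OF abs_ge_zero abs_ge_zero, of "f x" "g x"]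
    unfolding abs_mult power2_abs by linarith
  then show "AE x in \<mu>. norm (f x * g x) \<le> norm ((f x)\<^sup>2 + (g x)\<^sup>2)" by (intro always_eventually) auto
qed

lemma square_integrable_const: "square_integrable (\<lambda>_. c)"
  by (simp add: square_integrable_def)

lemma square_integrable_integrable: "square_integrable f \<Longrightarrow> integrable \<mu> f"
  using square_integrable_product[of f "\<lambda>_. 1"] square_integrable_const by simp

lemma square_integrable_diff:
  assumes "square_integrable f" "square_integrable g"
  shows "square_integrable (\<lambda>x. f x - g x)"
proof -
  have "integrable \<mu> (\<lambda>x. (f x)\<^sup>2 - 2 * (f x * g x) + (g x)\<^sup>2)"
    using assms square_integrable_product[OF assms] by (auto simp: square_integrable_def)
  then show ?thesis using assms by (auto simp: square_integrable_def power2_diff algebra_simps)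
qed

text \<open>
  From \<open>2 |r h| \<le> r\<^sup>2 / \<eta> + \<eta> h\<^sup>2\<close>; a form of the Cauchy-Schwarz inequality that is linear in \<open>\<eta>\<close>.
\<close>

lemma integral_product_le:
  assumes r: "square_integrable r" and h: "square_integrable h"
    and \<eta>: "0 < \<eta>" "(\<integral>x. (r x)\<^sup>2 \<partial>\<mu>) \<le> \<eta>\<^sup>2"
  shows "\<bar>\<integral>x. r x * h x \<partial>\<mu>\<bar> \<le> \<eta> * (1 + (\<integral>x. (h x)\<^sup>2 \<partial>\<mu>))"
proof -
  have i: "integrable \<mu> (\<lambda>x. (r x)\<^sup>2)" "integrable \<mu> (\<lambda>x. (h x)\<^sup>2)" using r h by (auto simp: square_integrable_def)
  have "\<bar>\<integral>x. r x * h x \<partial>\<mu>\<bar> \<le> (\<integral>x. \<bar>r x * h x\<bar> \<partial>\<mu>)" by (rule integral_abs_bound)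
  also have "\<dots> \<le> (\<integral>x. (r x)\<^sup>2 / \<eta> + \<eta> * (h x)\<^sup>2 \<partial>\<mu>)"
  proof (rule integral_mono)
    fix x
    have "0 \<le> (\<bar>r x\<bar> - \<eta> * \<bar>h x\<bar>)\<^sup>2" by simp
    then have "\<eta> * (2 * (\<bar>r x\<bar> * \<bar>h x\<bar>)) \<le> (r x)\<^sup>2 + \<eta>\<^sup>2 * (h x)\<^sup>2"
      by (simp add: power2_diff power_mult_distrib algebra_simps)
    also have "\<dots> = \<eta> * ((r x)\<^sup>2 / \<eta> + \<eta> * (h x)\<^sup>2)" using \<eta>(1) by (simp add: field_simps power2_eq_square)
    finally have "2 * (\<bar>r x\<bar> * \<bar>h x\<bar>) \<le> (r x)\<^sup>2 / \<eta> + \<eta> * (h x)\<^sup>2" using \<eta>(1) by (simp only: mult_le_cancel_left_pos)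
    then show "\<bar>r x * h x\<bar> \<le> (r x)\<^sup>2 / \<eta> + \<eta> * (h x)\<^sup>2"
      using mult_nonneg_nonneg[OF abs_ge_zero abs_ge_zero, of "r x" "h x"] unfolding abs_mult by linarith
  qed (use i square_integrable_product[OF r h] in auto)
  also have "\<dots> = (\<integral>x. (r x)\<^sup>2 \<partial>\<mu>) / \<eta> + \<eta> * (\<integral>x. (h x)\<^sup>2 \<partial>\<mu>)" using i by simp
  also have "\<dots> \<le> \<eta>\<^sup>2 / \<eta> + \<eta> * (\<integral>x. (h x)\<^sup>2 \<partial>\<mu>)" using \<eta> by (intro add_right_mono divide_right_mono) auto
  finally show ?thesis using \<eta>(1) by (simp add: power2_eq_square algebra_simps)
qed

definition decorrelates :: "('a \<Rightarrow> real) \<Rightarrow> ('a \<Rightarrow> real) \<Rightarrow> bool" where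
  "decorrelates f g \<longleftrightarrow> (\<lambda>n. \<integral>x. f x * g ((T ^^ n) x) \<partial>\<mu>) \<longlonglongrightarrow> (\<integral>x. f x \<partial>\<mu>) * (\<integral>x. g x \<partial>\<mu>)"

lemma approximation_errors:
  fixes f :: "'a \<Rightarrow> real" and s :: "nat \<Rightarrow> 'a \<Rightarrow> real"
  assumes lim: "(\<lambda>k. \<integral>x. (f x - s k x)\<^sup>2 \<partial>\<mu>) \<longlonglongrightarrow> 0"
  obtains \<eta> where "\<eta> \<longlonglongrightarrow> 0" "\<forall>k. 0 < \<eta> k \<and> (\<integral>x. (f x - s k x)\<^sup>2 \<partial>\<mu>) \<le> (\<eta> k)\<^sup>2"
proof -
  \<comment> \<open>The summand 1 / (k + 1) keeps \<open>\<eta> k\<close> positive even when the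
    approximation is exact, as the product estimate divides by it.\<close>
  define \<eta> where "\<eta> k = sqrt (\<integral>x. (f x - s k x)\<^sup>2 \<partial>\<mu>) + 1 / real (Suc k)" for k
  have nn: "0 \<le> (\<integral>x. (f x - s k x)\<^sup>2 \<partial>\<mu>)" for k by simp
  have "\<eta> \<longlonglongrightarrow> sqrt 0 + 0"
    unfolding \<eta>_def[abs_def] by (intro tendsto_intros lim LIMSEQ_Suc[OF lim_const_over_n])
  moreover have "0 < \<eta> k \<and> (\<integral>x. (f x - s k x)\<^sup>2 \<partial>\<mu>) \<le> (\<eta> k)\<^sup>2" for k
  proof
    show "0 < \<eta> k" unfolding \<eta>_def using nn[of k] by (intro add_nonneg_pos) auto
    have "(\<integral>x. (f x - s k x)\<^sup>2 \<partial>\<mu>) = (sqrt (\<integral>x. (f x - s k x)\<^sup>2 \<partial>\<mu>))\<^sup>2" using nn[of k] by simp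
    also have "\<dots> \<le> (\<eta> k)\<^sup>2" unfolding \<eta>_def using nn[of k] by (intro power_mono) auto
    finally show "(\<integral>x. (f x - s k x)\<^sup>2 \<partial>\<mu>) \<le> (\<eta> k)\<^sup>2" .
  qed
  ultimately show ?thesis by (intro that[of \<eta>]) auto
qed

text \<open>The error of replacing \<open>f\<close> by \<open>s k\<close> is uniform in
  \<open>n\<close>, because composition with a measure preserving power of \<open>T\<close> does not
  change the second moment of \<open>g\<close>.\<close>

lemma decorrelates_limit_left:
  assumes f: "square_integrable f" and g: "square_integrable g" and s: "\<And>k. square_integrable (s k)"
    and lim: "(\<lambda>k. \<integral>x. (f x - s k x)\<^sup>2 \<partial>\<mu>) \<longlonglongrightarrow> 0" and d: "\<And>k. decorrelates (s k) g"
  shows "decorrelates f g"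
proof -
  obtain \<eta> where \<eta>: "\<eta> \<longlonglongrightarrow> 0" "\<forall>k. 0 < \<eta> k \<and> (\<integral>x. (f x - s k x)\<^sup>2 \<partial>\<mu>) \<le> (\<eta> k)\<^sup>2"
    using approximation_errors[OF lim] .
  \<comment> \<open>One term for the integral of the product and one for the product of the means;
    the factor 2 is the product estimate against the constant 1.\<close>
  define e where "e k = \<eta> k * (1 + (\<integral>x. (g x)\<^sup>2 \<partial>\<mu>)) + \<eta> k * 2 * \<bar>\<integral>x. g x \<partial>\<mu>\<bar>" for k
  have b: "\<bar>\<integral>x. (f x - s k x) * h x \<partial>\<mu>\<bar> \<le> \<eta> k * (1 + (\<integral>x. (h x)\<^sup>2 \<partial>\<mu>))" if "square_integrable h" for h k
    by (rule integral_product_le[OF square_integrable_diff[OF f s] that]) (use \<eta> in auto)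
  have e0: "0 \<le> \<eta> k * (1 + (\<integral>x. (g x)\<^sup>2 \<partial>\<mu>))" "0 \<le> \<eta> k * 2 * \<bar>\<integral>x. g x \<partial>\<mu>\<bar>" for k
    using \<eta>(2)[rule_format, of k] by (auto intro!: mult_nonneg_nonneg add_nonneg_nonneg integral_nonneg less_imp_le)
  show ?thesis unfolding decorrelates_def
  proof (rule LIMSEQ_of_uniform_approximation)
    show "(\<lambda>n. \<integral>x. s k x * g ((T ^^ n) x) \<partial>\<mu>) \<longlonglongrightarrow> (\<integral>x. s k x \<partial>\<mu>) * (\<integral>x. g x \<partial>\<mu>)" for k
      using d[of k] by (simp add: decorrelates_def)
    have "e \<longlonglongrightarrow> 0 * (1 + (\<integral>x. (g x)\<^sup>2 \<partial>\<mu>)) + 0 * 2 * \<bar>\<integral>x. g x \<partial>\<mu>\<bar>"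
      unfolding e_def[abs_def] by (intro tendsto_intros \<eta>(1))
    then show "e \<longlonglongrightarrow> 0" by simp
    fix k n
    note gn = square_integrable_power[OF g, of n]
    have "(\<integral>x. f x * g ((T ^^ n) x) \<partial>\<mu>) - (\<integral>x. s k x * g ((T ^^ n) x) \<partial>\<mu>) = (\<integral>x. (f x - s k x) * g ((T ^^ n) x) \<partial>\<mu>)"
      using square_integrable_product[OF f gn(1)] square_integrable_product[OF s gn(1)]
      by (simp add: left_diff_distrib Bochner_Integration.integral_diff)
    then show "\<bar>(\<integral>x. f x * g ((T ^^ n) x) \<partial>\<mu>) - (\<integral>x. s k x * g ((T ^^ n) x) \<partial>\<mu>)\<bar> \<le> e k"
      using b[OF gn(1), of k] e0[of k] unfolding gn(2) e_def by simp
  next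
    fix k
    have "\<bar>(\<integral>x. f x \<partial>\<mu>) - (\<integral>x. s k x \<partial>\<mu>)\<bar> \<le> \<eta> k * 2"
      using b[OF square_integrable_const[of 1], of k] square_integrable_integrable[OF f] square_integrable_integrable[OF s]
      by (simp add: Bochner_Integration.integral_diff prob_space)
    then have "\<bar>(\<integral>x. f x \<partial>\<mu>) - (\<integral>x. s k x \<partial>\<mu>)\<bar> * \<bar>\<integral>x. g x \<partial>\<mu>\<bar> \<le> \<eta> k * 2 * \<bar>\<integral>x. g x \<partial>\<mu>\<bar>"
      by (rule mult_right_mono) simp
    then show "\<bar>(\<integral>x. f x \<partial>\<mu>) * (\<integral>x. g x \<partial>\<mu>) - (\<integral>x. s k x \<partial>\<mu>) * (\<integral>x. g x \<partial>\<mu>)\<bar> \<le> e k"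
      using e0(1)[of k] unfolding e_def by (simp add: abs_mult[symmetric] left_diff_distrib)
  qed
qed

text \<open>Here the approximation error itself is composed with the power of \<open>T\<close>; its
  second moment is again unchanged, so the bound is uniform in \<open>n\<close>.\<close>

lemma decorrelates_limit_right:
  assumes f: "square_integrable f" and g: "square_integrable g" and s: "\<And>k. square_integrable (s k)"
    and lim: "(\<lambda>k. \<integral>x. (g x - s k x)\<^sup>2 \<partial>\<mu>) \<longlonglongrightarrow> 0" and d: "\<And>k. decorrelates f (s k)"
  shows "decorrelates f g"
proof -
  obtain \<eta> where \<eta>: "\<eta> \<longlonglongrightarrow> 0" "\<forall>k. 0 < \<eta> k \<and> (\<integral>x. (g x - s k x)\<^sup>2 \<partial>\<mu>) \<le> (\<eta> k)\<^sup>2"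
    using approximation_errors[OF lim] .
  define e where "e k = \<eta> k * (1 + (\<integral>x. (f x)\<^sup>2 \<partial>\<mu>)) + \<eta> k * 2 * \<bar>\<integral>x. f x \<partial>\<mu>\<bar>" for k
  have e0: "0 \<le> \<eta> k * (1 + (\<integral>x. (f x)\<^sup>2 \<partial>\<mu>))" "0 \<le> \<eta> k * 2 * \<bar>\<integral>x. f x \<partial>\<mu>\<bar>" for k
    using \<eta>(2)[rule_format, of k] by (auto intro!: mult_nonneg_nonneg add_nonneg_nonneg integral_nonneg less_imp_le)
  show ?thesis unfolding decorrelates_def
  proof (rule LIMSEQ_of_uniform_approximation)
    show "(\<lambda>n. \<integral>x. f x * s k ((T ^^ n) x) \<partial>\<mu>) \<longlonglongrightarrow> (\<integral>x. f x \<partial>\<mu>) * (\<integral>x. s k x \<partial>\<mu>)" for k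
      using d[of k] by (simp add: decorrelates_def)
    have "e \<longlonglongrightarrow> 0 * (1 + (\<integral>x. (f x)\<^sup>2 \<partial>\<mu>)) + 0 * 2 * \<bar>\<integral>x. f x \<partial>\<mu>\<bar>"
      unfolding e_def[abs_def] by (intro tendsto_intros \<eta>(1))
    then show "e \<longlonglongrightarrow> 0" by simp
    fix k n
    note rn = square_integrable_power[OF square_integrable_diff[OF g s], of n k]
    have "(\<integral>x. f x * g ((T ^^ n) x) \<partial>\<mu>) - (\<integral>x. f x * s k ((T ^^ n) x) \<partial>\<mu>)
      = (\<integral>x. (g ((T ^^ n) x) - s k ((T ^^ n) x)) * f x \<partial>\<mu>)"
      using square_integrable_product[OF f square_integrable_power(1)[OF g, of n]]
        square_integrable_product[OF f square_integrable_power(1)[OF s, of k n]]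
      by (simp add: right_diff_distrib mult.commute Bochner_Integration.integral_diff)
    moreover have "\<bar>\<integral>x. (g ((T ^^ n) x) - s k ((T ^^ n) x)) * f x \<partial>\<mu>\<bar> \<le> \<eta> k * (1 + (\<integral>x. (f x)\<^sup>2 \<partial>\<mu>))"
      by (rule integral_product_le[OF rn(1) f]) (use \<eta> rn(2) in auto)
    ultimately show "\<bar>(\<integral>x. f x * g ((T ^^ n) x) \<partial>\<mu>) - (\<integral>x. f x * s k ((T ^^ n) x) \<partial>\<mu>)\<bar> \<le> e k"
      using e0(2)[of k] unfolding e_def by simp
  next
    fix k
    have "\<bar>\<integral>x. (g x - s k x) * 1 \<partial>\<mu>\<bar> \<le> \<eta> k * (1 + (\<integral>x. 1\<^sup>2 \<partial>\<mu>))"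
      by (rule integral_product_le[OF square_integrable_diff[OF g s] square_integrable_const]) (use \<eta> in auto)
    then have "\<bar>(\<integral>x. g x \<partial>\<mu>) - (\<integral>x. s k x \<partial>\<mu>)\<bar> \<le> \<eta> k * 2"
      using square_integrable_integrable[OF g] square_integrable_integrable[OF s]
      by (simp add: Bochner_Integration.integral_diff prob_space)
    then have "\<bar>(\<integral>x. g x \<partial>\<mu>) - (\<integral>x. s k x \<partial>\<mu>)\<bar> * \<bar>\<integral>x. f x \<partial>\<mu>\<bar> \<le> \<eta> k * 2 * \<bar>\<integral>x. f x \<partial>\<mu>\<bar>"
      by (rule mult_right_mono) simp
    then show "\<bar>(\<integral>x. f x \<partial>\<mu>) * (\<integral>x. g x \<partial>\<mu>) - (\<integral>x. f x \<partial>\<mu>) * (\<integral>x. s k x \<partial>\<mu>)\<bar> \<le> e k"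
      using e0(1)[of k] unfolding e_def by (simp add: abs_mult[symmetric] right_diff_distrib mult.commute)
  qed
qed

lemma simple_function_square_integrable: "simple_function \<mu> s \<Longrightarrow> square_integrable s"
proof -
  assume s: "simple_function \<mu> s"
  then have "finite (s ` space \<mu>)" by (rule simple_functionD)
  then obtain c where c: "\<And>x. x \<in> space \<mu> \<Longrightarrow> \<bar>s x\<bar> \<le> c"
    using finite_imp_bounded[of "s ` space \<mu>"] by (auto simp: bounded_iff)
  have "integrable \<mu> (\<lambda>x. (s x)\<^sup>2)"
  proof (rule integrable_const_bound[of _ "c\<^sup>2"])
    show "AE x in \<mu>. norm ((s x)\<^sup>2) \<le> c\<^sup>2"
    proof (rule AE_I2)
      fix x assume "x \<in> space \<mu>"
      then have "\<bar>s x\<bar> \<le> \<bar>c\<bar>" using c[of x] by linarith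
      then show "norm ((s x)\<^sup>2) \<le> c\<^sup>2" by (simp add: abs_le_square_iff)
    qed
  qed (use borel_measurable_simple_function[OF s] in measurable)
  then show ?thesis using borel_measurable_simple_function[OF s] by (simp add: square_integrable_def)
qed

text \<open>Both functions are finite combinations of indicators of their level sets, and mixing
  applies to each pair of level sets.\<close>

lemma decorrelates_simple:
  assumes f: "simple_function \<mu> f" and g: "simple_function \<mu> g"
  shows "decorrelates f g"
proof -
  define Af where "Af y = f -` {y} \<inter> space \<mu>" for y
  define Ag where "Ag y = g -` {y} \<inter> space \<mu>" for y
  have sets: "Af y \<in> events" "Ag y \<in> events" for y
    unfolding Af_def Ag_def using f g by (auto intro: simple_functionD)
  have fin: "finite (f ` space \<mu>)" "finite (g ` space \<mu>)" using f g by (auto intro: simple_functionD)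
  have rep: "f x = (\<Sum>y\<in>f ` space \<mu>. y * indicator (Af y) x)" "g x = (\<Sum>y\<in>g ` space \<mu>. y * indicator (Ag y) x)"
    if "x \<in> space \<mu>" for x
  proof -
    have "(\<Sum>y\<in>f ` space \<mu>. y * indicator (Af y) x) = (\<Sum>y\<in>f ` space \<mu>. if y = f x then y else 0)"
      by (intro sum.cong) (use that in \<open>auto simp: Af_def split: split_indicator\<close>)
    then show "f x = (\<Sum>y\<in>f ` space \<mu>. y * indicator (Af y) x)" using fin(1) that by simp
    have "(\<Sum>y\<in>g ` space \<mu>. y * indicator (Ag y) x) = (\<Sum>y\<in>g ` space \<mu>. if y = g x then y else 0)"
      by (intro sum.cong) (use that in \<open>auto simp: Ag_def split: split_indicator\<close>)
    then show "g x = (\<Sum>y\<in>g ` space \<mu>. y * indicator (Ag y) x)" using fin(2) that by simp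
  qed
  have TA: "(T ^^ n) -` Ag z \<inter> space \<mu> \<in> events" for n z by (rule measurable_sets[OF power_measurable sets(2)])
  have "(\<integral>x. f x * g ((T ^^ n) x) \<partial>\<mu>)
    = (\<Sum>y\<in>f ` space \<mu>. \<Sum>z\<in>g ` space \<mu>. y * z * measure \<mu> (Af y \<inter> ((T ^^ n) -` Ag z \<inter> space \<mu>)))" for n
  proof -
    have "(\<integral>x. f x * g ((T ^^ n) x) \<partial>\<mu>)
      = (\<integral>x. (\<Sum>y\<in>f ` space \<mu>. \<Sum>z\<in>g ` space \<mu>. y * z * indicator (Af y \<inter> ((T ^^ n) -` Ag z \<inter> space \<mu>)) x) \<partial>\<mu>)"
    proof (rule Bochner_Integration.integral_cong[OF refl])
      fix x assume x: "x \<in> space \<mu>"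
      have Tx: "(T ^^ n) x \<in> space \<mu>" by (rule measurable_space[OF power_measurable x])
      show "f x * g ((T ^^ n) x) = (\<Sum>y\<in>f ` space \<mu>. \<Sum>z\<in>g ` space \<mu>. y * z * indicator (Af y \<inter> ((T ^^ n) -` Ag z \<inter> space \<mu>)) x)"
        unfolding rep(1)[OF x] rep(2)[OF Tx] sum_product
        by (intro sum.cong refl) (use x in \<open>auto split: split_indicator\<close>)
    qed
    also have "\<dots> = (\<Sum>y\<in>f ` space \<mu>. \<Sum>z\<in>g ` space \<mu>. y * z * measure \<mu> (Af y \<inter> ((T ^^ n) -` Ag z \<inter> space \<mu>)))"
    proof -
      have int: "integrable \<mu> (\<lambda>x. y * z * indicator (Af y \<inter> ((T ^^ n) -` Ag z \<inter> space \<mu>)) x)" for y z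
        using sets TA by (intro integrable_mult_right integrable_real_indicator) (auto simp: emeasure_eq_measure)
      have ind: "(\<integral>x. indicator E x \<partial>\<mu>) = measure \<mu> E" if "E \<in> events" for E
        using sets.sets_into_space[OF that] by (simp add: Int_absorb2)
      have "(\<integral>x. (\<Sum>y\<in>f ` space \<mu>. \<Sum>z\<in>g ` space \<mu>. y * z * indicator (Af y \<inter> ((T ^^ n) -` Ag z \<inter> space \<mu>)) x) \<partial>\<mu>)
        = (\<Sum>y\<in>f ` space \<mu>. \<integral>x. (\<Sum>z\<in>g ` space \<mu>. y * z * indicator (Af y \<inter> ((T ^^ n) -` Ag z \<inter> space \<mu>)) x) \<partial>\<mu>)"
        by (rule Bochner_Integration.integral_sum) (rule Bochner_Integration.integrable_sum, rule int)
      also have "\<dots> = (\<Sum>y\<in>f ` space \<mu>. \<Sum>z\<in>g ` space \<mu>. \<integral>x. y * z * indicator (Af y \<inter> ((T ^^ n) -` Ag z \<inter> space \<mu>)) x \<partial>\<mu>)"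
        by (intro sum.cong refl Bochner_Integration.integral_sum int)
      also have "\<dots> = (\<Sum>y\<in>f ` space \<mu>. \<Sum>z\<in>g ` space \<mu>. y * z * measure \<mu> (Af y \<inter> ((T ^^ n) -` Ag z \<inter> space \<mu>)))"
        by (intro sum.cong refl, subst integral_mult_right_zero, subst ind) (use sets TA in auto)
      finally show ?thesis .
    qed
    finally show ?thesis .
  qed
  moreover have "(\<lambda>n. \<Sum>y\<in>f ` space \<mu>. \<Sum>z\<in>g ` space \<mu>. y * z * measure \<mu> (Af y \<inter> ((T ^^ n) -` Ag z \<inter> space \<mu>)))
    \<longlonglongrightarrow> (\<Sum>y\<in>f ` space \<mu>. \<Sum>z\<in>g ` space \<mu>. y * z * (measure \<mu> (Af y) * measure \<mu> (Ag z)))"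
    using mixing sets unfolding strongly_mixing_def by (intro tendsto_sum tendsto_mult_left) blast
  moreover have "(\<integral>x. (\<Sum>y\<in>I. y * indicator (E y) x) \<partial>\<mu>) = (\<Sum>y\<in>I. y * measure \<mu> (E y))"
    if E: "\<And>y. E y \<in> events" for I and E :: "real \<Rightarrow> 'a set"
  proof -
    have "(\<integral>x. (\<Sum>y\<in>I. y * indicator (E y) x) \<partial>\<mu>) = (\<Sum>y\<in>I. \<integral>x. y * indicator (E y) x \<partial>\<mu>)"
      by (rule Bochner_Integration.integral_sum)
        (use E in \<open>auto intro!: integrable_mult_right integrable_real_indicator simp: emeasure_eq_measure\<close>)
    then show ?thesis using E sets.sets_into_space[OF E] by (simp add: Int_absorb2)
  qed
  then have "(\<integral>x. f x \<partial>\<mu>) = (\<Sum>y\<in>f ` space \<mu>. y * measure \<mu> (Af y))"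
    "(\<integral>x. g x \<partial>\<mu>) = (\<Sum>y\<in>g ` space \<mu>. y * measure \<mu> (Ag y))"
    using sets by (simp_all only: Bochner_Integration.integral_cong[OF refl rep(1)] Bochner_Integration.integral_cong[OF refl rep(2)])
  ultimately show ?thesis unfolding decorrelates_def by (simp add: sum_product mult_ac)
qed

lemma simple_approximation:
  assumes f: "square_integrable f"
  obtains s where "\<forall>k. simple_function \<mu> (s k)" "(\<lambda>k. \<integral>x. (f x - s k x)\<^sup>2 \<partial>\<mu>) \<longlonglongrightarrow> 0"
proof -
  have fm: "f \<in> borel_measurable \<mu>" and fi: "integrable \<mu> (\<lambda>x. (f x)\<^sup>2)" using f by (auto simp: square_integrable_def)
  obtain s where s': "\<forall>k. simple_function \<mu> (s k)" "\<forall>x\<in>space \<mu>. (\<lambda>k. s k x) \<longlonglongrightarrow> f x"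
    "\<forall>k. \<forall>x\<in>space \<mu>. norm (s k x) \<le> 2 * norm (f x)"
    using borel_measurable_implies_sequence_metric[OF fm, of 0] by auto
  note s = s'[rule_format]
  have sm: "s k \<in> borel_measurable \<mu>" for k by (rule borel_measurable_simple_function[OF s(1)])
  have "(\<lambda>k. \<integral>x. (f x - s k x)\<^sup>2 \<partial>\<mu>) \<longlonglongrightarrow> (\<integral>x. 0 \<partial>\<mu>)"
  proof (rule integral_dominated_convergence)
    \<comment> \<open>The approximants satisfy |s| \<le> 2 |f|, hence |f - s| \<le> 3 |f|, and 9 is
      the square of 3.\<close>
    show "integrable \<mu> (\<lambda>x. 9 * (f x)\<^sup>2)" using fi by simp
    show "AE x in \<mu>. (\<lambda>k. (f x - s k x)\<^sup>2) \<longlonglongrightarrow> 0"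
    proof (rule AE_I2)
      fix x assume "x \<in> space \<mu>"
      from tendsto_power[OF tendsto_diff[OF tendsto_const[of "f x"] s(2)[OF this]], of 2]
      show "(\<lambda>k. (f x - s k x)\<^sup>2) \<longlonglongrightarrow> 0" by simp
    qed
    show "AE x in \<mu>. norm ((f x - s k x)\<^sup>2) \<le> 9 * (f x)\<^sup>2" for k
    proof (rule AE_I2)
      fix x assume "x \<in> space \<mu>"
      then have "\<bar>f x - s k x\<bar> \<le> \<bar>3 * f x\<bar>" using s(3)[of x k] by simp
      then have "(f x - s k x)\<^sup>2 \<le> (3 * f x)\<^sup>2" by (simp add: abs_le_square_iff)
      then show "norm ((f x - s k x)\<^sup>2) \<le> 9 * (f x)\<^sup>2" by (simp add: power_mult_distrib)
    qed
  qed (use fm sm in measurable)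
  then show ?thesis using s(1) by (intro that[of s]) auto
qed

theorem decorrelation:
  assumes f: "square_integrable f" and g: "square_integrable g"
  shows "(\<lambda>n. \<integral>x. f x * g ((T ^^ n) x) \<partial>\<mu>) \<longlonglongrightarrow> (\<integral>x. f x \<partial>\<mu>) * (\<integral>x. g x \<partial>\<mu>)"
proof -
  obtain s where s: "\<forall>k. simple_function \<mu> (s k)" "(\<lambda>k. \<integral>x. (f x - s k x)\<^sup>2 \<partial>\<mu>) \<longlonglongrightarrow> 0"
    using simple_approximation[OF f] .
  obtain r where r: "\<forall>k. simple_function \<mu> (r k)" "(\<lambda>k. \<integral>x. (g x - r k x)\<^sup>2 \<partial>\<mu>) \<longlonglongrightarrow> 0"
    using simple_approximation[OF g] .
  have "decorrelates (s k) g" for k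
    by (rule decorrelates_limit_right[OF _ g _ r(2)])
      (use s(1) r(1) in \<open>auto intro: simple_function_square_integrable decorrelates_simple\<close>)
  then have "decorrelates f g"
    by (intro decorrelates_limit_left[OF f g _ s(2)]) (use s(1) in \<open>auto intro: simple_function_square_integrable\<close>)
  then show ?thesis by (simp add: decorrelates_def)
qed

text \<open>For an invariant event the mixing sequence is constantly its own probability, which
  therefore equals its square.\<close>

lemma invariant_trivial:
  assumes A: "A \<in> events" and inv: "T -` A \<inter> space \<mu> = A"
  shows "prob A = 0 \<or> prob A = 1"
proof -
  have sub: "A \<subseteq> space \<mu>" by (rule sets.sets_into_space[OF A])
  have iter: "(T ^^ n) -` A \<inter> space \<mu> = A" for n
  proof (induction n)
    case (Suc n)
    have "(T ^^ Suc n) -` A \<inter> space \<mu> = (T ^^ n) -` (T -` A \<inter> space \<mu>) \<inter> space \<mu>"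
      using measurable_space[OF power_measurable[of n]] by auto
    then show ?case unfolding inv Suc .
  qed (use sub in auto)
  have "(\<lambda>n. prob (A \<inter> ((T ^^ n) -` A \<inter> space \<mu>))) \<longlonglongrightarrow> prob A * prob A"
    using mixing A unfolding strongly_mixing_def by blast
  then have "prob A = prob A * prob A" unfolding iter by (simp add: LIMSEQ_const_iff)
  then show ?thesis by auto
qed

end

section \<open>Measurability on the configuration space\<close>

lemma measurable_borel_nat: "measurable M (borel :: nat measure) = measurable M (count_space UNIV)"
  by (rule measurable_cong_sets[OF refl sets_borel_eq_count_space])

lemma configuration_coordinate [measurable]:
  "(\<lambda>x. x i) \<in> measurable (borel :: (int ^ 'd::finite \<Rightarrow> nat) measure) (count_space UNIV)"
proof -
  have "(\<lambda>x. x i) \<in> measurable (PiM UNIV (\<lambda>_. borel)) (borel :: nat measure)"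
    by (rule measurable_component_singleton) simp
  then show ?thesis unfolding measurable_borel_nat[symmetric] measurable_cong_sets[OF sets_PiM_equal_borel refl] .
qed

lemma configuration_measurable:
  assumes "\<And>i. (\<lambda>w. f w i) \<in> measurable M (count_space UNIV)"
  shows "f \<in> measurable M (borel :: (int ^ 'd::finite \<Rightarrow> nat) measure)"
proof -
  have "f \<in> measurable M (PiM UNIV (\<lambda>_. borel))"
    by (rule measurable_PiM_single') (use assms in \<open>auto simp: measurable_borel_nat\<close>)
  then show ?thesis unfolding measurable_cong_sets[OF refl sets_PiM_equal_borel] .
qed

lemma lim_nat_measurable:
  fixes f :: "nat \<Rightarrow> 'a \<Rightarrow> nat"
  assumes [measurable]: "\<And>n. f n \<in> measurable M (count_space UNIV)"
  shows "(\<lambda>w. lim (\<lambda>n. f n w)) \<in> measurable M (count_space UNIV)"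
proof (subst measurable_count_space_eq2_countable)
  \<comment> \<open>The value of \<open>lim\<close> for a sequence without limit: the predicate that
    it describes is then constantly false. Convergence of natural numbers means being eventually
    constant, so both cases are countable conditions.\<close>
  define c0 :: nat where "c0 = (THE l. False)"
  have conv: "(\<lambda>n. f n w) \<longlonglongrightarrow> c \<longleftrightarrow> (\<exists>N. \<forall>n\<ge>N. f n w = c)" for w c
    by (simp add: tendsto_discrete eventually_sequentially)
  have eq: "lim (\<lambda>n. f n w) = c \<longleftrightarrow>
      (\<exists>N. \<forall>n\<ge>N. f n w = c) \<or> (c = c0 \<and> (\<forall>c'. \<not> (\<exists>N. \<forall>n\<ge>N. f n w = c')))" for w c
  proof (cases "\<exists>c'. (\<lambda>n. f n w) \<longlonglongrightarrow> c'")
    case True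
    then obtain c' where c': "(\<lambda>n. f n w) \<longlonglongrightarrow> c'" by blast
    have "lim (\<lambda>n. f n w) = c'" by (rule limI[OF c'])
    moreover have "(\<lambda>n. f n w) \<longlonglongrightarrow> c \<Longrightarrow> c = c'" using c' LIMSEQ_unique by blast
    ultimately show ?thesis using c' conv by blast
  next
    case False
    then have "(\<lambda>l. (\<lambda>n. f n w) \<longlonglongrightarrow> l) = (\<lambda>_. False)" by auto
    then have "lim (\<lambda>n. f n w) = c0" by (simp add: Topological_Spaces.Lim_def c0_def)
    then show ?thesis using False conv by blast
  qed
  have "{w \<in> space M. lim (\<lambda>n. f n w) = c} \<in> sets M" for c
    unfolding eq by measurable
  then show "(\<lambda>w. lim (\<lambda>n. f n w)) \<in> space M \<rightarrow> UNIV
      \<and> (\<forall>c\<in>UNIV. (\<lambda>w. lim (\<lambda>n. f n w)) -` {c} \<inter> space M \<in> sets M)"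
    by (auto simp: vimage_def Int_def conj_commute)
qed

text \<open>The chosen trajectories only agree almost everywhere with a measurable map. Their
  preimages differ from events by subsets of null sets, so they are events of the completion with
  the same measure.\<close>

lemma distr_completion_AE:
  assumes X: "X \<in> measurable M N" and Y: "\<And>\<omega>. \<omega> \<in> space M \<Longrightarrow> Y \<omega> \<in> space N"
    and eq: "AE \<omega> in M. X \<omega> = Y \<omega>"
  shows "distr (completion M) N Y = distr M N X"
proof -
  have pre: "Y -` B \<inter> space M \<in> sets (completion M)" "emeasure (completion M) (Y -` B \<inter> space M) = emeasure M (X -` B \<inter> space M)"
    if B: "B \<in> sets N" for B
  proof -
    have XB: "X -` B \<inter> space M \<in> sets M" by (rule measurable_sets[OF X B])
    have ae: "AE \<omega> in completion M. \<omega> \<in> X -` B \<inter> space M \<longleftrightarrow> \<omega> \<in> Y -` B \<inter> space M"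
      using AE_completion[OF eq] by eventually_elim auto
    show 1: "Y -` B \<inter> space M \<in> sets (completion M)"
      by (rule completion.in_sets_AE[OF ae]) (use XB in auto)
    have "emeasure (completion M) (Y -` B \<inter> space M) = emeasure (completion M) (X -` B \<inter> space M)"
      by (rule emeasure_eq_AE) (use ae 1 XB in \<open>auto elim!: eventually_mono\<close>)
    then show "emeasure (completion M) (Y -` B \<inter> space M) = emeasure M (X -` B \<inter> space M)" using XB by simp
  qed
  have Ym: "Y \<in> measurable (completion M) N"
    by (rule measurableI) (use Y pre(1) in auto)
  show ?thesis
  proof (rule measure_eqI)
    fix B assume "B \<in> sets (distr (completion M) N Y)"
    then have B: "B \<in> sets N" by simp
    show "emeasure (distr (completion M) N Y) B = emeasure (distr M N X) B"
      using pre(2)[OF B] by (simp add: emeasure_distr[OF Ym B] emeasure_distr[OF X B])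
  qed simp
qed

lemma lattice_shift_measurable:
  "lattice_shift h \<in> measurable (borel :: (int ^ 'd::finite \<Rightarrow> nat) measure) borel"
  unfolding lattice_shift_def by (rule configuration_measurable) measurable

lemma lattice_shift_power: "(lattice_shift h ^^ n) x = (\<lambda>i. x (i + int n *s axis h 1))"
proof (induction n)
  case (Suc n)
  have "axis h 1 + int n *s axis h 1 = int (Suc n) *s axis h 1"
    by (simp add: vec_eq_iff axis_def algebra_simps)
  then show ?case using Suc by (simp add: lattice_shift_def add.assoc)
qed (simp add: vec_eq_iff)

lemma finite_window: "finite {l :: int ^ 'd::finite. sup_norm l \<le> int K}"
proof (rule finite_subset)
  show "{l :: int ^ 'd. sup_norm l \<le> int K} \<subseteq> vec_lambda ` (\<Pi>\<^sub>E i\<in>UNIV. {- int K..int K})"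
  proof
    fix l :: "int ^ 'd" assume "l \<in> {l. sup_norm l \<le> int K}"
    then have "\<bar>l $ h\<bar> \<le> int K" for h unfolding sup_norm_def by (auto simp: Max_le_iff)
    then have "(\<lambda>h. l $ h) \<in> (\<Pi>\<^sub>E i\<in>UNIV. {- int K..int K})" by (auto simp: abs_le_iff minus_le_iff)
    then show "l \<in> vec_lambda ` (\<Pi>\<^sub>E i\<in>UNIV. {- int K..int K})" by (intro image_eqI[of _ _ "\<lambda>h. l $ h"]) auto
  qed
  show "finite (vec_lambda ` (\<Pi>\<^sub>E i\<in>(UNIV :: 'd set). {- int K..int K}))"
    by (intro finite_imageI finite_PiE) auto
qed

text \<open>A window has finitely many sites and natural lengths, so only countably many windows
  occur. Hence every real function of a window is measurable.\<close>

lemma window_measurable: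
  "window K p \<in> measurable (borel :: (int ^ 'd::finite \<Rightarrow> nat) measure) (count_space UNIV)"
proof -
  define F where "F = {l :: int ^ 'd. sup_norm l \<le> int K}"
  have F: "finite F" unfolding F_def by (rule finite_window)
  let ?R = "\<Pi>\<^sub>E l\<in>F. (UNIV :: nat set)"
  have R: "countable ?R" by (rule countable_PiE[OF F]) auto
  have "window K p \<in> measurable borel (count_space ?R)"
  proof (subst measurable_count_space_eq_countable[OF R], intro conjI ballI)
    show "window K p \<in> space borel \<rightarrow> ?R" by (auto simp: window_def F_def)
    fix v assume v: "v \<in> ?R"
    have "window K p -` {v} \<inter> space borel = {x \<in> space borel. \<forall>l\<in>F. x (p + l) = v l}"
      using v by (auto simp: window_def F_def fun_eq_iff PiE_iff extensional_def)
    also have "\<dots> \<in> sets borel"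
      by (rule sets.sets_Collect_finite_All[OF _ F]) measurable
    finally show "window K p -` {v} \<inter> space borel \<in> sets borel" .
  qed
  then show ?thesis by (rule measurable_compose[of _ _ "count_space ?R" "\<lambda>x. x", simplified]) simp
qed

section \<open>The stationary state as a factor of the driving processes\<close>

context interference_queues
begin

text \<open>An explicit version of the stationary state: for each integer starting time the value of
  the lower bracket at the first stage where the brackets meet. It is built from translation
  covariant ingredients for every \<open>w\<close>, not only almost surely.\<close>

definition state :: "real \<Rightarrow> (int ^ 'd + int ^ 'd \<Rightarrow> (real \<times> real) set) \<Rightarrow> int ^ 'd \<Rightarrow> nat" where
  "state s w i = (if w \<in> good
     then lim (\<lambda>n. lo w (- real n) (LEAST k. up w (- real n) k i s = lo w (- real n) k i s) i s) else 0)"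

lemma state_measurable: "state s \<in> measurable P borel"
proof (rule configuration_measurable)
  fix i
  define L where "L n w = lo w (- real n) (LEAST k. up w (- real n) k i s = lo w (- real n) k i s) i s" for n w
  have "L n \<in> measurable PG (count_space UNIV)" for n
    unfolding L_def
  proof (rule measurable_compose_countable[where f = "\<lambda>k w. lo w (- real n) k i s"])
    show "(\<lambda>w. lo w (- real n) k i s) \<in> measurable PG (count_space UNIV)" for k
      using bracket_measurable by blast
    note [measurable] = bracket_measurable[of "- real n" _ i s, THEN conjunct1] bracket_measurable[of "- real n" _ i s, THEN conjunct2]
    show "(\<lambda>w. LEAST k. up w (- real n) k i s = lo w (- real n) k i s) \<in> measurable PG (count_space UNIV)" by measurable
  qed
  then have "(\<lambda>w. lim (\<lambda>n. L n w)) \<in> measurable PG (count_space UNIV)" by (rule lim_nat_measurable)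
  then have "(\<lambda>w. if w \<in> good then lim (\<lambda>n. L n w) else 0) \<in> measurable P (count_space UNIV)"
    using sets_good sets.sets_into_space[OF sets_good]
    by (subst measurable_If_restrict_space_iff) (auto simp: PG_def Collect_conj_eq[symmetric] Int_absorb1 Int_def[symmetric])
  then show "(\<lambda>w. state s w i) \<in> measurable P (count_space UNIV)" unfolding state_def L_def .
qed

lemma AE_no_atoms_at: "AE w in P. \<forall>i. s \<notin> arr w i \<and> s \<notin> fst ` dep w i"
proof -
  have "AE w in P. card (w (Inl i) \<inter> {s} \<times> {0}) = 0" for i
  proof (rule AE_P)
    have B: "{s} \<times> {0} \<in> sets (borel :: (real \<times> real) measure)" "bounded ({s} \<times> {0::real})"
      by (auto intro!: borel_Times bounded_Times)
    show "{w \<in> space P. card (w (Inl i) \<inter> {s} \<times> {0}) = 0} \<in> sets P"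
      using measurable_sets[OF count_measurable[OF B, of "Inl i"], of "{0}"] by (simp add: vimage_def Int_def conj_commute)
    have "{t. (t, 0::real) \<in> {s} \<times> {0}} = {s}" by auto
    moreover have "measure (density lborel (\<lambda>_. ennreal lam)) {s} = 0"
      by (simp add: measure_def emeasure_density nn_integral_cmult_indicator)
    ultimately show "AE \<omega> in M. card (driving_field A D \<omega> (Inl i) \<inter> {s} \<times> {0}) = 0"
      using poisson_null[OF A_poisson, of "{s}" i] by (simp add: driving_field_def card_embed_line)
  qed
  moreover have "AE w in P. card (w (Inr i) \<inter> {s} \<times> {0..1}) = 0" for i
  proof (rule AE_no_atoms)
    have "{s} \<times> {0..1} \<inter> UNIV \<times> {0..1} = {s} \<times> {0..1::real}" by auto
    then show "measure lborel (({s} \<times> {0..1}) \<inter> UNIV \<times> {0..1 :: real}) = 0" by (simp add: measure_lborel_Times)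
  qed (auto intro!: borel_Times bounded_Times)
  ultimately have "AE w in P. \<forall>i. card (w (Inl i) \<inter> {s} \<times> {0}) = 0 \<and> card (w (Inr i) \<inter> {s} \<times> {0..1}) = 0"
    by (simp add: AE_all_countable)
  then show ?thesis using AE_good
  proof eventually_elim
    case (elim w)
    have "bounded ({s} \<times> {0..1 :: real})" by (intro bounded_Times) auto
    then have lf: "finite (w j \<inter> {s} \<times> {0..1})" for j
      using good_space[OF elim(2)] by (simp add: space_P locally_finite_sets_def)
    show ?case
    proof (intro allI conjI notI)
      fix i assume "s \<in> arr w i"
      then have "(s, 0) \<in> w (Inl i) \<inter> {s} \<times> {0}" by (simp add: arr_def)
      moreover have "finite (w (Inl i) \<inter> {s} \<times> {0})" by (rule finite_subset[OF _ lf]) auto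
      ultimately show False using elim(1) by (metis card_0_eq empty_iff)
    next
      fix i assume "s \<in> fst ` dep w i"
      then obtain u where "(s, u) \<in> dep w i" by auto
      then have "(s, u) \<in> w (Inr i) \<inter> {s} \<times> {0..1}" using good_marks[OF elim(2), of s u i] by (simp add: dep_def)
      then show False using elim(1) lf by (metis card_0_eq empty_iff)
    qed
  qed
qed

text \<open>Merging at all sites and all integer starting times is a countable intersection of
  almost sure events. Together with regularity and the absence of atoms at \<open>s\<close> it
  identifies the limit pathwise.\<close>

lemma AE_state: "AE w in P. (\<lambda>i. queue_from_past a (arr w) (dep w) i s) = state s w"
proof -
  have "AE w in PG. \<forall>i. \<forall>n::nat. \<exists>k. up w (- real n) k i s = lo w (- real n) k i s"
    by (simp add: AE_all_countable AE_merge)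
  then have "AE w in P. w \<in> good \<longrightarrow> (\<forall>i. \<forall>n::nat. \<exists>k. up w (- real n) k i s = lo w (- real n) k i s)"
    unfolding PG_def using sets_good sets.sets_into_space[OF sets_good]
    by (subst (asm) AE_restrict_space_iff) (auto simp: Int_absorb2)
  then show ?thesis using AE_good AE_no_atoms_at[of s]
  proof eventually_elim
    case (elim w)
    then have w: "w \<in> good" by simp
    show ?case
    proof
      fix i
      show "queue_from_past a (arr w) (dep w) i s = state s w i"
        using interference_input.queue_from_past_eq[OF good_input[OF w], of i s] elim w by (simp add: state_def)
    qed
  qed
qed

lemma minimal_stationary_distribution_eq: "minimal_stationary_distribution M a A D s = distr P borel (state s)"
proof -
  have "AE \<omega> in distr M P (driving_field A D). (\<lambda>i. queue_from_past a (arr \<omega>) (dep \<omega>) i s) = state s \<omega>"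
    unfolding P_eq[symmetric] by (rule AE_state)
  then have "AE \<omega> in M. state s (driving_field A D \<omega>) = (\<lambda>i. queue_from_past a (\<lambda>k. A k \<omega>) (\<lambda>k. D k \<omega>) i s)"
    by (rule AE_distrD[OF field_measurable, THEN eventually_mono]) simp
  then have "minimal_stationary_distribution M a A D s = distr M borel (\<lambda>\<omega>. state s (driving_field A D \<omega>))"
    unfolding minimal_stationary_distribution_def
    by (intro distr_completion_AE measurable_compose[OF field_measurable state_measurable]) auto
  also have "\<dots> = distr (distr M P (driving_field A D)) borel (state s)"
    by (subst distr_distr[OF state_measurable field_measurable]) (simp add: comp_def)
  finally show ?thesis unfolding P_eq[symmetric] .
qed

section \<open>Equivariance of the state and mixing of its law\<close>

lemma translate_good_iff: "translate p w \<in> good \<longleftrightarrow> w \<in> good"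
proof
  assume "translate p w \<in> good"
  then have "translate (- p) (translate p w) \<in> good" by (rule translate_good)
  moreover have "translate (- p) (translate p w) = w"
    unfolding translate_def by (rule ext) (simp add: sum.map_comp comp_def sum.map_ident)
  ultimately show "w \<in> good" by simp
qed (rule translate_good)

lemma state_translate: "state s (translate p w) = (\<lambda>i. state s w (i + p))"
  unfolding state_def translate_good_iff bracket_translate[THEN conjunct1] bracket_translate[THEN conjunct2] ..

lemma inj_translation: "inj (map_sum (\<lambda>i :: int ^ 'd. i + p) (\<lambda>i :: int ^ 'd. i + p))"
  by (rule sum.inj_map) (auto simp: inj_def)

lemma law_translation: "law (map_sum (\<lambda>i. i + p) (\<lambda>i. i + p) j) = law j"
  by (cases j) (auto simp: law_def)

lemma translate_preserving: "translate p \<in> measurable P P" "distr P P (translate p) = P"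
proof -
  have t: "translate p = (\<lambda>w j. w (map_sum (\<lambda>i. i + p) (\<lambda>i. i + p) j))" by (simp add: translate_def fun_eq_iff)
  note reindex = PiM_reindex[where \<kappa> = law and f = "map_sum (\<lambda>i. i + p) (\<lambda>i. i + p)", OF law_prob inj_translation law_translation]
  show "translate p \<in> measurable P P" "distr P P (translate p) = P"
    unfolding t P_def by (rule reindex)+
qed

text \<open>The \<open>h\<close>-th coordinate of a translated site grows by exactly
  \<open>n\<close>, so a given site is moved onto another given site for at most one
  \<open>n\<close>.\<close>

lemma translations_escape:
  fixes J J' :: "(int ^ 'd + int ^ 'd) set"
  assumes "finite J" "finite J'"
  shows "\<forall>\<^sub>F n in sequentially. map_sum (\<lambda>i. i + int n *s axis h 1) (\<lambda>i. i + int n *s axis h 1) ` J' \<inter> J = {}"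
proof -
  have "\<forall>\<^sub>F n in sequentially. map_sum (\<lambda>i. i + int n *s axis h 1) (\<lambda>i. i + int n *s axis h 1) j' \<noteq> j" for j j' :: "int ^ 'd + int ^ 'd"
  proof -
    define c :: "int ^ 'd + int ^ 'd \<Rightarrow> int" where "c = case_sum (\<lambda>i. i $ h) (\<lambda>i. i $ h)"
    have "c (map_sum (\<lambda>i. i + int n *s axis h 1) (\<lambda>i. i + int n *s axis h 1) j') = c j' + int n" for n
      by (cases j') (auto simp: c_def axis_def)
    then have "n = nat (c j - c j')" if "map_sum (\<lambda>i. i + int n *s axis h 1) (\<lambda>i. i + int n *s axis h 1) j' = j" for n
      using that by auto
    then show ?thesis
      by (intro eventually_sequentiallyI[of "Suc (nat (c j - c j'))"]) fastforce
  qed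
  then have "\<forall>\<^sub>F n in sequentially. \<forall>j\<in>J. \<forall>j'\<in>J'. map_sum (\<lambda>i. i + int n *s axis h 1) (\<lambda>i. i + int n *s axis h 1) j' \<noteq> j"
    by (intro eventually_ball_finite assms ballI)
  then show ?thesis by eventually_elim auto
qed

lemma stationary_distribution_preserving:
  "probability_preserving (distr P borel (state s)) (lattice_shift h)"
proof -
  let ?\<mu> = "distr P borel (state s)"
  interpret P: prob_space P by (rule prob_space_P)
  have m: "lattice_shift h \<in> measurable ?\<mu> ?\<mu>" using lattice_shift_measurable by simp
  \<comment> \<open>The state intertwines the shift of configurations with the translation of the
    driving field, so the image of an invariant law is invariant.\<close>
  have comm: "lattice_shift h \<circ> state s = state s \<circ> translate (axis h 1)"
    by (auto simp: fun_eq_iff lattice_shift_def state_translate)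
  have "distr ?\<mu> ?\<mu> (lattice_shift h) = distr ?\<mu> borel (lattice_shift h)" by (rule distr_cong) auto
  also have "\<dots> = distr P borel (lattice_shift h \<circ> state s)"
    by (rule distr_distr[OF lattice_shift_measurable state_measurable])
  also have "\<dots> = distr (distr P P (translate (axis h 1))) borel (state s)"
    unfolding comm by (rule distr_distr[OF state_measurable translate_preserving(1), symmetric])
  also have "\<dots> = ?\<mu>" by (simp add: translate_preserving(2))
  finally show ?thesis
    unfolding probability_preserving_def using m P.prob_space_distr[OF state_measurable] by blast
qed

lemma stationary_distribution_mixing:
  "strongly_mixing (distr P borel (state s)) (lattice_shift h)"
  unfolding strongly_mixing_def
proof (intro ballI)
  let ?\<mu> = "distr P borel (state s)"
  fix X Y assume "X \<in> sets ?\<mu>" "Y \<in> sets ?\<mu>"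
  then have X: "X \<in> sets borel" and Y: "Y \<in> sets borel" by auto
  define X' where "X' = state s -` X \<inter> space P"
  define Y' where "Y' = state s -` Y \<inter> space P"
  have XY': "X' \<in> sets P" "Y' \<in> sets P" unfolding X'_def Y'_def by (intro measurable_sets[OF state_measurable] X Y)+
  have pn: "(lattice_shift h ^^ n) \<in> measurable borel borel" for n
  proof (induction n)
    case (Suc n)
    show ?case unfolding funpow.simps(2) by (rule measurable_comp[OF Suc lattice_shift_measurable])
  qed (simp add: id_def)
  have "measure ?\<mu> (X \<inter> ((lattice_shift h ^^ n) -` Y \<inter> space ?\<mu>))
     = measure P (X' \<inter> {w \<in> space P. translate (int n *s axis h 1) w \<in> Y'})" for n
  proof -
    have s: "X \<inter> ((lattice_shift h ^^ n) -` Y \<inter> space ?\<mu>) \<in> sets borel"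
      using measurable_sets[OF pn Y, of n] X by simp
    have "measure ?\<mu> (X \<inter> ((lattice_shift h ^^ n) -` Y \<inter> space ?\<mu>))
      = measure P (state s -` (X \<inter> ((lattice_shift h ^^ n) -` Y \<inter> space ?\<mu>)) \<inter> space P)"
      by (rule measure_distr[OF state_measurable s])
    also have "state s -` (X \<inter> ((lattice_shift h ^^ n) -` Y \<inter> space ?\<mu>)) \<inter> space P
      = X' \<inter> {w \<in> space P. translate (int n *s axis h 1) w \<in> Y'}"
      using measurable_space[OF translate_preserving(1)]
      by (auto simp: X'_def Y'_def lattice_shift_power state_translate)
    finally show ?thesis .
  qed
  \<comment> \<open>By equivariance the events of the configuration pull back to events of the
    driving field and their shifts to translates, so mixing of the product measure is all that is
    required.\<close>
  moreover have "(\<lambda>n. measure P (X' \<inter> {w \<in> space P. translate (int n *s axis h 1) w \<in> Y'})) \<longlonglongrightarrow> measure P X' * measure P Y'"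
    unfolding P_def translate_def
    by (rule PiM_mixing[where f = "\<lambda>n. map_sum (\<lambda>i. i + int n *s axis h 1) (\<lambda>i. i + int n *s axis h 1)"])
      (use law_prob inj_translation law_translation translations_escape XY'[unfolded P_def] in auto)
  moreover have "measure ?\<mu> X = measure P X'" "measure ?\<mu> Y = measure P Y'"
    unfolding X'_def Y'_def by (intro measure_distr[OF state_measurable] X Y)+
  ultimately show "(\<lambda>n. measure ?\<mu> (X \<inter> ((lattice_shift h ^^ n) -` Y \<inter> space ?\<mu>))) \<longlonglongrightarrow> measure ?\<mu> X * measure ?\<mu> Y"
    by simp
qed

end

theorem theorem2p3:
  fixes M :: "'w measure"
    and a :: "int ^ 'd::finite \<Rightarrow> real"
    and lam s :: real
    and A :: "int ^ 'd \<Rightarrow> 'w \<Rightarrow> real set"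
    and D :: "int ^ 'd \<Rightarrow> 'w \<Rightarrow> (real \<times> real) set"
    and \<mu> :: "(int ^ 'd \<Rightarrow> nat) measure"
  assumes "\<And>i. a i \<ge> 0" and "\<And>i. a i = a (- i)" and "a 0 = 1" and "a summable_on UNIV"
    and "0 \<le> lam" and "lam < 1 / (\<Sum>\<^sub>\<infinity>j. a j)"
    and "prob_space M" and "driving_processes M lam A D"
    and "\<mu> = minimal_stationary_distribution M a A D s"
  shows "(\<forall>(K::nat) (h::'d) (f::(int ^ 'd \<Rightarrow> nat) \<Rightarrow> real) (g::(int ^ 'd \<Rightarrow> nat) \<Rightarrow> real).
            integrable \<mu> (\<lambda>x. (f (window K 0 x))\<^sup>2) \<longrightarrow>
            integrable \<mu> (\<lambda>x. (g (window K 0 x))\<^sup>2) \<longrightarrow>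
            (\<lambda>n. \<integral>x. f (window K 0 x) * g (window K (int n *s axis h 1) x) \<partial>\<mu>)
              \<longlonglongrightarrow> (\<integral>x. f (window K 0 x) \<partial>\<mu>) * (\<integral>x. g (window K 0 x) \<partial>\<mu>))
         \<and> (\<forall>h::'d. probability_preserving \<mu> (lattice_shift h) \<and> strongly_mixing \<mu> (lattice_shift h))
         \<and> ergodic_family \<mu> (lattice_shift :: 'd \<Rightarrow> (int ^ 'd \<Rightarrow> nat) \<Rightarrow> int ^ 'd \<Rightarrow> nat)"
proof -
  interpret Q: interference_queues M a lam A D
    by (intro interference_queues.intro interference_queues_axioms.intro assms)
  have \<mu>: "\<mu> = distr Q.P borel (Q.state s)" using assms(9) Q.minimal_stationary_distribution_eq by simp
  have pp: "probability_preserving \<mu> (lattice_shift h)" for h :: 'd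
    unfolding \<mu> by (rule Q.stationary_distribution_preserving)
  have mix: "strongly_mixing \<mu> (lattice_shift h)" for h :: 'd
    unfolding \<mu> by (rule Q.stationary_distribution_mixing)
  have sys: "mixing_system \<mu> (lattice_shift h)" for h :: 'd
    using pp[of h] mix[of h] unfolding probability_preserving_def
    by (auto intro!: mixing_system.intro mixing_system_axioms.intro)
  have sets: "sets \<mu> = sets borel" by (simp add: \<mu>)
  have m: "(\<lambda>x. f (window K 0 x)) \<in> borel_measurable \<mu>" for K and f :: "_ \<Rightarrow> real"
    unfolding measurable_cong_sets[OF sets refl] by (rule measurable_compose[OF window_measurable]) simp
  have "(\<lambda>n. \<integral>x. f (window K 0 x) * g (window K (int n *s axis h 1) x) \<partial>\<mu>)
      \<longlonglongrightarrow> (\<integral>x. f (window K 0 x) \<partial>\<mu>) * (\<integral>x. g (window K 0 x) \<partial>\<mu>)"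
    if "integrable \<mu> (\<lambda>x. (f (window K 0 x))\<^sup>2)" "integrable \<mu> (\<lambda>x. (g (window K 0 x))\<^sup>2)"
    for K and h :: 'd and f g :: "_ \<Rightarrow> real"
  proof -
    interpret S: mixing_system \<mu> "lattice_shift h" by (rule sys)
    \<comment> \<open>The window around a distant site is the window around the origin after
      shifting, so the covariances are those of a mixing transformation.\<close>
    have "window K (int n *s axis h 1) x = window K 0 ((lattice_shift h ^^ n) x)" for n and x :: "int ^ 'd \<Rightarrow> nat"
      by (simp add: window_def lattice_shift_power add.commute)
    then show ?thesis
      using S.decorrelation[of "\<lambda>x. f (window K 0 x)" "\<lambda>x. g (window K 0 x)"] that m
      by (simp add: S.square_integrable_def)
  qed
  \<comment> \<open>A jointly invariant event is invariant under any one of the shifts, and this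
    shift is mixing.\<close>
  moreover have "ergodic_family \<mu> (lattice_shift :: 'd \<Rightarrow> (int ^ 'd \<Rightarrow> nat) \<Rightarrow> int ^ 'd \<Rightarrow> nat)"
    unfolding ergodic_family_def using mixing_system.invariant_trivial[OF sys] by blast
  ultimately show ?thesis using pp mix by blast
qed

end
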